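(* Assume the Markov semigroup $(P_t)$ on the Polish space $(E,\rho)$ is Feller, and that: (1) there exist a measurable $V:E\to[0,\infty)$, a concave differentiable function $\phi:\mathbb R_+\to\mathbb R_+$ increasing to infinity with $\phi(0)=0$, and a constant $K>0$ such that $P_tV(x)\le V(x)-\int_0^tP_s(\phi\circ V)(x)\,ds+Kt$ for all $t\ge0$, $x\in E$; (2) $\rho\wedge1\le\theta$ for a premetric $\theta$; (3) Assumption A holds (with this $\theta$) for some functions $r,L$; (4) there exists $t_0>0$ such that for any $M>0$, Assumption B1 holds for $B=\{V\le M\}$ and $t_0$. Then $(P_t)$ has a unique invariant probability measure $\pi$, and for any $\delta\in(0,1)$ there exist constants $C_1,C_2>0$ such that for all $x\in E$ and $t\ge0$, $$W_{\rho\wedge1}(P_t(x,\cdot),\pi)\le\frac{C_1(1+\phi(V(x))^\delta)}{\phi(H_\phi^{-1}(C_2t))^\delta},$$ where $H_\phi(x):=\int_1^x\frac{du}{\phi(u)}$, $x\ge1$.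
   Context: $(E,\rho)$ is a Polish space with Borel $\sigma$-field $\mathcal E$; $\{P_t\}_{t\ge0}$ is a Markov transition function with semigroup $P_t\phi(x)=\int\phi(y)P_t(x,dy)$ and $\mathbb P_x$ the law of the corresponding Markov process started at $x$. Feller means $P_t$ maps bounded continuous functions to bounded continuous functions. A premetric is a lower semicontinuous $\theta:E\times E\to\mathbb R_+$ with $\theta(x,y)=0\iff x=y$. For a distance-like (symmetric, lower semicontinuous, vanishing exactly on the diagonal) or metric $d$, $W_d(\mu,\nu):=\inf\int d\,d\lambda$ over couplings $\lambda$ of $\mu,\nu$; $d_{TV}(\mu,\nu)=\sup_A|\mu(A)-\nu(A)|$. Assumption A: there exist a non-increasing $r:\mathbb R_+\to\mathbb R_+$ with $r(t)\to0$ and a locally bounded $L:\mathbb R_+\to\mathbb R_+$ such that for any $x,y\in E$ there exist random processes $X^{x,y},Y^{x,y}$ on a common probability space with (1) $\mathrm{Law}(X^{x,y})=\mathbb P_x$ and $d_{TV}(\mathrm{Law}(Y^{x,y}_t),P_t(y,\cdot))\le L(t)\theta(x,y)$, $t\ge0$; (2) $\mathbb E\theta(X^{x,y}_t,Y^{x,y}_t)\le r(t)\theta(x,y)$, $t\ge0$. Assumption B1 (for a set $B$ and $t_0>0$): for any $\varepsilon>0$ there is a measurable $D$ with $\inf_{x\in B}P_{t_0}(x,D)>0$ and $\sup_{x,y\in D}\theta(x,y)\le\varepsilon$. *)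

theory Defs
  imports "HOL-Probability.Probability"
begin

text \<open>The Polish space (E, rho) is a type of class polish_space with rho = dist,
  and its Borel sigma-field is borel.  Time parameter ranges over t >= 0.\<close>

definition markov_tf :: "(real \<Rightarrow> 'a::topological_space \<Rightarrow> 'a measure) \<Rightarrow> bool" where
  "markov_tf P \<longleftrightarrow>
     (\<forall>t\<ge>0. \<forall>x. prob_space (P t x) \<and> sets (P t x) = sets borel) \<and>
     (\<forall>t\<ge>0. \<forall>A\<in>sets borel. (\<lambda>x. emeasure (P t x) A) \<in> borel_measurable borel) \<and>
     (\<forall>x. P 0 x = return borel x) \<and>
     (\<forall>s\<ge>0. \<forall>t\<ge>0. \<forall>x. \<forall>A\<in>sets borel.
        emeasure (P (s + t) x) A = (\<integral>\<^sup>+ y. emeasure (P t y) A \<partial>P s x))"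

definition feller :: "(real \<Rightarrow> 'a::topological_space \<Rightarrow> 'a measure) \<Rightarrow> bool" where
  "feller P \<longleftrightarrow>
     (\<forall>t\<ge>0. \<forall>f::'a \<Rightarrow> real. continuous_on UNIV f \<and> bounded (range f) \<longrightarrow>
        continuous_on UNIV (\<lambda>x. \<integral>y. f y \<partial>P t x) \<and> bounded (range (\<lambda>x. \<integral>y. f y \<partial>P t x)))"

text \<open>Finite-dimensional distributions of the Markov process started at x:
  the list [(h0,A0),(h1,A1),...] stands for the event
  X_{t0} in A0, X_{t1} in A1, ... with t_i = h0 + ... + h_i.\<close>
fun mkv_fdd :: "(real \<Rightarrow> 'a \<Rightarrow> 'a measure) \<Rightarrow> 'a \<Rightarrow> (real \<times> 'a set) list \<Rightarrow> ennreal" where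
  "mkv_fdd P x [] = 1"
| "mkv_fdd P x ((h, A) # rest) = (\<integral>\<^sup>+ y. indicator A y * mkv_fdd P y rest \<partial>P h x)"

text \<open>Law(X) = P_x: the process X on the probability space M is a Markov process
  with transition function P started at x (equality of the laws on the product
  sigma-field over times t >= 0, i.e. equality of all finite-dimensional distributions).\<close>
definition has_markov_law ::
  "(real \<Rightarrow> 'a::topological_space \<Rightarrow> 'a measure) \<Rightarrow> 'a \<Rightarrow> 'w measure \<Rightarrow> (real \<Rightarrow> 'w \<Rightarrow> 'a) \<Rightarrow> bool" where
  "has_markov_law P x M X \<longleftrightarrow>
     prob_space M \<and> (\<forall>t\<ge>0. X t \<in> measurable M borel) \<and>
     (\<forall>l. (\<forall>i<length l. fst (l ! i) \<ge> 0 \<and> snd (l ! i) \<in> sets borel) \<longrightarrow>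
        emeasure M {\<omega>\<in>space M. \<forall>i<length l. X (\<Sum>j\<le>i. fst (l ! j)) \<omega> \<in> snd (l ! i)}
          = mkv_fdd P x l)"

definition premetric :: "('a::topological_space \<Rightarrow> 'a \<Rightarrow> real) \<Rightarrow> bool" where
  "premetric \<theta> \<longleftrightarrow>
     (\<forall>c. open {p::'a \<times> 'a. c < \<theta> (fst p) (snd p)}) \<and>
     (\<forall>x y. \<theta> x y \<ge> 0) \<and> (\<forall>x y. \<theta> x y = 0 \<longleftrightarrow> x = y)"

definition dTV :: "'a measure \<Rightarrow> 'a measure \<Rightarrow> real" where
  "dTV \<mu> \<nu> = (SUP A\<in>sets \<mu>. \<bar>measure \<mu> A - measure \<nu> A\<bar>)"

definition couplings :: "'a::topological_space measure \<Rightarrow> 'a measure \<Rightarrow> ('a \<times> 'a) measure set" where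
  "couplings \<mu> \<nu> = {c. sets c = sets (borel \<Otimes>\<^sub>M borel) \<and> prob_space c \<and>
      distr c borel fst = \<mu> \<and> distr c borel snd = \<nu>}"

definition wasserstein :: "('a::topological_space \<Rightarrow> 'a \<Rightarrow> real) \<Rightarrow> 'a measure \<Rightarrow> 'a measure \<Rightarrow> ennreal" where
  "wasserstein d \<mu> \<nu> = (INF c\<in>couplings \<mu> \<nu>. \<integral>\<^sup>+ z. ennreal (d (fst z) (snd z)) \<partial>c)"

definition invariant_prob :: "(real \<Rightarrow> 'a::topological_space \<Rightarrow> 'a measure) \<Rightarrow> 'a measure \<Rightarrow> bool" where
  "invariant_prob P \<pi> \<longleftrightarrow> prob_space \<pi> \<and> sets \<pi> = sets borel \<and>
     (\<forall>t\<ge>0. \<forall>A\<in>sets borel. (\<integral>\<^sup>+ x. emeasure (P t x) A \<partial>\<pi>) = emeasure \<pi> A)"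

definition assumption_A ::
  "'w itself \<Rightarrow> (real \<Rightarrow> 'a::topological_space \<Rightarrow> 'a measure) \<Rightarrow> ('a \<Rightarrow> 'a \<Rightarrow> real)
     \<Rightarrow> (real \<Rightarrow> real) \<Rightarrow> (real \<Rightarrow> real) \<Rightarrow> bool" where
  "assumption_A (_::'w itself) P \<theta> r L \<longleftrightarrow>
     (\<forall>s\<ge>0. r s \<ge> 0) \<and> antimono_on {0..} r \<and> (r \<longlongrightarrow> 0) at_top \<and>
     (\<forall>s\<ge>0. L s \<ge> 0) \<and> (\<forall>T\<ge>0. bounded (L ` {0..T})) \<and>
     (\<forall>x y. \<exists>(M::'w measure) X Y.
        has_markov_law P x M X \<and> (\<forall>t\<ge>0. Y t \<in> measurable M borel) \<and>
        (\<forall>t\<ge>0. dTV (distr M borel (Y t)) (P t y) \<le> L t * \<theta> x y) \<and>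
        (\<forall>t\<ge>0. (\<integral>\<^sup>+ \<omega>. ennreal (\<theta> (X t \<omega>) (Y t \<omega>)) \<partial>M) \<le> ennreal (r t * \<theta> x y)))"

definition assumption_B1 ::
  "(real \<Rightarrow> 'a::topological_space \<Rightarrow> 'a measure) \<Rightarrow> ('a \<Rightarrow> 'a \<Rightarrow> real) \<Rightarrow> 'a set \<Rightarrow> real \<Rightarrow> bool" where
  "assumption_B1 P \<theta> B t0 \<longleftrightarrow>
     (\<forall>\<epsilon>>0. \<exists>D\<in>sets borel. (\<exists>c>0. \<forall>x\<in>B. measure (P t0 x) D \<ge> c) \<and>
        (\<forall>x\<in>D. \<forall>y\<in>D. \<theta> x y \<le> \<epsilon>))"

definition H_phi :: "(real \<Rightarrow> real) \<Rightarrow> real \<Rightarrow> real" where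
  "H_phi \<phi> x = integral {1..x} (\<lambda>u. 1 / \<phi> u)"

definition H_phi_inv :: "(real \<Rightarrow> real) \<Rightarrow> real \<Rightarrow> real" where
  "H_phi_inv \<phi> s = (THE y. y \<ge> 1 \<and> H_phi \<phi> y = s)"

end

theory Submission
  imports Defs
begin

(* Distances between laws are measured on the dual side, by the supremum over functions that are 1-Lipschitz for
   min dist 1. This needs no measurable choice of couplings, and Kantorovich duality for finite transport problems,
   transferred by quantization, turns the final estimates into Wasserstein bounds.

   Fix a skeleton step h with r h <= 1/4 and write Q = P h, d = min 1 (N * theta) with N = 1 + 4 * L h. By Assumption A,
   and by redrawing Y so that it has law P h y, d is contracted by the factor 1/2 where d < 1. Assumption B1 propagates
   from t0 to all later times, hence sublevel sets of V are d-small for Q. With v = V + h * phi(V) the Lyapunov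
   inequality becomes a drift inequality for Q, and Hoelder's inequality propagates bounds of the form

     kantorovich (Q^n x) (Q^n y) <= d x y powr (1 - q) * (J n x + J n y) powr q

   from n to n + 1, where J n x = b^n * exp (l * H (min (v x) s)) + (1/2 + beta * v x) / (beta * s), b = 1 - eta * l / 4:
   Q may enlarge J by a fixed factor where d contracts, and must not enlarge it elsewhere. Given a target level R, the
   choice phi s = phi a powr (1 - q) * phi R powr q with a = max (v x) (v y) and l proportional to phi' s gives the rate
   (phi a / phi R) powr (q * q) as soon as n is of order H R.

   The invariant measure is a limit of Cesaro averages, which are Cauchy in the Kantorovich distance; completeness is
   obtained from the Ionescu-Tulcea theorem by chaining near-optimal transport kernels. *)

section \<open>Transport problems on finite sets\<close>

lemma compact_function_box: "compact {p :: 'b \<Rightarrow> real. \<forall>z. 0 \<le> p z \<and> p z \<le> B}"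
proof -
  have "{p :: 'b \<Rightarrow> real. \<forall>z. 0 \<le> p z \<and> p z \<le> B} = PiE UNIV (\<lambda>_. {0..B})"
    by (auto simp: PiE_iff)
  moreover have "compactin (product_topology (\<lambda>_::'b. euclidean) UNIV) (PiE UNIV (\<lambda>_. {0..B}))"
    by (subst compactin_PiE) auto
  ultimately show ?thesis
    by (simp add: euclidean_product_topology flip: compactin_euclidean_iff)
qed

lemma linear_coefficient_nonneg:
  fixes G C b :: real
  assumes "0 < b" and quadratic_nonneg: "\<And>e. 0 < e \<Longrightarrow> e \<le> b \<Longrightarrow> 0 \<le> e * G + e\<^sup>2 * C"
  shows "0 \<le> G"
proof (rule tendsto_lowerbound)
  show "((\<lambda>e. G + e * C) \<longlongrightarrow> G) (at_right 0)"
    by (auto intro!: tendsto_eq_intros)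
  show "\<forall>\<^sub>F e in at_right 0. 0 \<le> G + e * C"
    using eventually_at_right_real[OF \<open>0 < b\<close>]
  proof eventually_elim
    case (elim e)
    then have "0 \<le> e * (G + e * C)"
      using quadratic_nonneg[of e] by (simp add: power2_eq_square algebra_simps)
    then show ?case
      using elim by (simp add: zero_le_mult_iff)
  qed
qed simp

locale finite_transport =
  fixes I :: "'a set" and m k :: "'a \<Rightarrow> real" and c :: "'a \<Rightarrow> 'a \<Rightarrow> real"
  assumes finite: "finite I"
    and m_nonneg: "\<And>x. x \<in> I \<Longrightarrow> 0 \<le> m x" and sum_m: "sum m I = 1"
    and k_nonneg: "\<And>x. x \<in> I \<Longrightarrow> 0 \<le> k x" and sum_k: "sum k I = 1"
    and c_nonneg: "\<And>x y. 0 \<le> c x y" and c_le_1: "\<And>x y. c x y \<le> 1"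
    and c_refl: "\<And>x. c x x = 0" and c_triangle: "\<And>x y z. c x z \<le> c x y + c y z"
begin

definition row_sum :: "('a \<times> 'a \<Rightarrow> real) \<Rightarrow> 'a \<Rightarrow> real" where
  "row_sum p x = (\<Sum>y\<in>I. p (x, y))"

definition col_sum :: "('a \<times> 'a \<Rightarrow> real) \<Rightarrow> 'a \<Rightarrow> real" where
  "col_sum p y = (\<Sum>x\<in>I. p (x, y))"

definition cost :: "('a \<times> 'a \<Rightarrow> real) \<Rightarrow> real" where
  "cost p = (\<Sum>x\<in>I. \<Sum>y\<in>I. p (x, y) * c x y)"

definition defect :: "('a \<times> 'a \<Rightarrow> real) \<Rightarrow> real" where
  "defect p = (\<Sum>x\<in>I. (row_sum p x - m x)\<^sup>2) + (\<Sum>y\<in>I. (col_sum p y - k y)\<^sup>2)"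

(* At a minimiser of the penalised cost the rescaled marginal errors row_potential and col_potential
   are dual feasible and satisfy complementary slackness. *)
definition penalised :: "real \<Rightarrow> ('a \<times> 'a \<Rightarrow> real) \<Rightarrow> real" where
  "penalised \<tau> p = cost p + defect p / (2 * \<tau>)"

(* The marginals of a minimiser of the penalised cost are at most 3, so that 4 leaves room to increase its entries. *)
definition plan_box :: "('a \<times> 'a \<Rightarrow> real) set" where
  "plan_box = {p. \<forall>z. 0 \<le> p z \<and> p z \<le> 4}"

lemma continuous_on_entry: "continuous_on S (\<lambda>p :: 'a \<times> 'a \<Rightarrow> real. p z)"
  by (rule continuous_on_subset[OF continuous_on_product_coordinates]) simp

lemma continuous_on_cost: "continuous_on S cost"
  unfolding cost_def[abs_def] by (intro continuous_intros continuous_on_entry)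

lemma continuous_on_defect: "continuous_on S defect"
  unfolding defect_def[abs_def] row_sum_def col_sum_def by (intro continuous_intros continuous_on_entry)

lemma continuous_attains_inf_plan_box:
  assumes "continuous_on plan_box F"
  obtains p where "p \<in> plan_box" "\<And>p'. p' \<in> plan_box \<Longrightarrow> (F p :: real) \<le> F p'"
proof -
  have "compact plan_box" "plan_box \<noteq> {}"
    unfolding plan_box_def by (rule compact_function_box) (auto intro: exI[of _ "\<lambda>_. 0"])
  from continuous_attains_inf[OF this assms] show ?thesis
    using that by blast
qed

lemma defect_nonneg: "0 \<le> defect p"
  unfolding defect_def by (intro add_nonneg_nonneg sum_nonneg) auto

lemma defect_eq_0_iff: "defect p = 0 \<longleftrightarrow> (\<forall>x\<in>I. row_sum p x = m x \<and> col_sum p x = k x)"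
  unfolding defect_def using finite
  by (subst add_nonneg_eq_0_iff) (auto simp: sum_nonneg sum_nonneg_eq_0_iff)

lemma square_row_sum_le_defect: "x \<in> I \<Longrightarrow> (row_sum p x - m x)\<^sup>2 \<le> defect p"
  and square_col_sum_le_defect: "x \<in> I \<Longrightarrow> (col_sum p x - k x)\<^sup>2 \<le> defect p"
  using member_le_sum[of x I "\<lambda>x. (row_sum p x - m x)\<^sup>2"] member_le_sum[of x I "\<lambda>x. (col_sum p x - k x)\<^sup>2"] finite
    sum_nonneg[of I "\<lambda>x. (row_sum p x - m x)\<^sup>2"] sum_nonneg[of I "\<lambda>x. (col_sum p x - k x)\<^sup>2"]
  by (auto simp: defect_def)

lemma cost_nonneg: "p \<in> plan_box \<Longrightarrow> 0 \<le> cost p"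
  unfolding cost_def plan_box_def by (intro sum_nonneg mult_nonneg_nonneg c_nonneg) auto

lemma m_le_1: "x \<in> I \<Longrightarrow> m x \<le> 1" and k_le_1: "x \<in> I \<Longrightarrow> k x \<le> 1"
  using member_le_sum[of x I m] member_le_sum[of x I k] m_nonneg k_nonneg sum_m sum_k finite by auto

lemma product_plan: "\<exists>p\<in>plan_box. defect p = 0 \<and> cost p \<le> 1"
proof
  define p where "p z = (if z \<in> I \<times> I then m (fst z) * k (snd z) else 0)" for z
  show "p \<in> plan_box"
    by (auto simp: plan_box_def p_def m_nonneg k_nonneg intro!: order_trans[OF mult_mono[OF m_le_1 k_le_1]])
  have "defect p = 0"
    unfolding defect_eq_0_iff using sum_m sum_k
    by (simp add: row_sum_def col_sum_def p_def flip: sum_distrib_left sum_distrib_right)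
  moreover have "cost p \<le> 1"
  proof -
    have "cost p \<le> (\<Sum>x\<in>I. \<Sum>y\<in>I. p (x, y))"
      unfolding cost_def by (intro sum_mono mult_left_le c_le_1) (auto simp: p_def m_nonneg k_nonneg)
    also have "\<dots> = 1"
      using sum_m sum_k by (simp add: p_def flip: sum_distrib_left)
    finally show ?thesis .
  qed
  ultimately show "defect p = 0 \<and> cost p \<le> 1" ..
qed

definition row_potential :: "real \<Rightarrow> ('a \<times> 'a \<Rightarrow> real) \<Rightarrow> 'a \<Rightarrow> real" where
  "row_potential \<tau> p x = (m x - row_sum p x) / \<tau>"

definition col_potential :: "real \<Rightarrow> ('a \<times> 'a \<Rightarrow> real) \<Rightarrow> 'a \<Rightarrow> real" where
  "col_potential \<tau> p y = (k y - col_sum p y) / \<tau>"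

lemma penalised_perturb:
  assumes "a \<in> I" "b \<in> I" "0 < \<tau>"
  shows "penalised \<tau> (p((a, b) := p (a, b) + e))
    = penalised \<tau> p + e * (c a b - row_potential \<tau> p a - col_potential \<tau> p b) + e\<^sup>2 / \<tau>"
proof -
  define p' where "p' = p((a, b) := p (a, b) + e)"
  have p': "p' (x, y) = p (x, y) + (if x = a then if y = b then e else 0 else 0)" for x y
    by (auto simp: p'_def)
  have "(row_sum p' x - m x)\<^sup>2
      = (row_sum p x - m x)\<^sup>2 + (if x = a then 2 * e * (row_sum p a - m a) + e\<^sup>2 else 0)" for x
    using assms finite by (auto simp: row_sum_def p' sum.distrib power2_eq_square algebra_simps)
  moreover have "(col_sum p' y - k y)\<^sup>2
      = (col_sum p y - k y)\<^sup>2 + (if y = b then 2 * e * (col_sum p b - k b) + e\<^sup>2 else 0)" for y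
    using assms finite by (auto simp: col_sum_def p' sum.distrib power2_eq_square algebra_simps)
  ultimately have defect: "defect p' = defect p + 2 * e * (row_sum p a - m a) + 2 * e * (col_sum p b - k b) + 2 * e\<^sup>2"
    using assms finite by (simp add: defect_def sum.distrib)
  have cost: "cost p' = cost p + e * c a b"
  proof -
    have "p' (x, y) * c x y = p (x, y) * c x y + (if x = a then if y = b then e * c a b else 0 else 0)" for x y
      by (auto simp: p' algebra_simps)
    moreover have "(\<Sum>x\<in>I. \<Sum>y\<in>I. if x = a then if y = b then e * c a b else 0 else 0)
        = (\<Sum>x\<in>I. if x = a then e * c a b else 0)"
      using assms finite by (intro sum.cong) auto
    ultimately show ?thesis
      using assms finite by (simp add: cost_def sum.distrib)
  qed
  show ?thesis
    unfolding p'_def[symmetric] penalised_def defect cost row_potential_def col_potential_def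
    using assms(3) by (simp add: field_simps)
qed

lemma dual_potential:
  assumes "\<And>a b. a \<in> I \<Longrightarrow> b \<in> I \<Longrightarrow> u a + v b \<le> c a b"
  obtains f where "\<And>x y. f x - f y \<le> c x y" "\<And>x. x \<in> I \<Longrightarrow> u x \<le> f x" "\<And>x. x \<in> I \<Longrightarrow> f x \<le> - v x"
proof
  define f where "f x = Min ((\<lambda>j. c x j - v j) ` I)" for x
  have "I \<noteq> {}" using sum_m by auto
  have f_le: "f x \<le> c x j - v j" if "j \<in> I" for x j
    unfolding f_def using that finite by (intro Min_le) auto
  have f_attained: "\<exists>j\<in>I. f x = c x j - v j" for x
    using Min_in[of "(\<lambda>j. c x j - v j) ` I"] finite \<open>I \<noteq> {}\<close> unfolding f_def by blast
  show "f x - f y \<le> c x y" for x y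
  proof -
    obtain j where "j \<in> I" "f y = c y j - v j" using f_attained by blast
    with f_le[of j x] c_triangle[of x j y] show ?thesis by simp
  qed
  show "u x \<le> f x" if "x \<in> I" for x
  proof -
    obtain j where "j \<in> I" "f x = c x j - v j" using f_attained by blast
    with assms[OF that, of j] show ?thesis by simp
  qed
  show "f x \<le> - v x" if "x \<in> I" for x
    using f_le[OF that, of x] c_refl by simp
qed

context
  fixes \<tau> :: real and p :: "'a \<times> 'a \<Rightarrow> real"
  assumes \<tau>: "0 < \<tau>" "\<tau> \<le> 1" and p_in_box: "p \<in> plan_box"
    and minimal: "\<And>p'. p' \<in> plan_box \<Longrightarrow> penalised \<tau> p \<le> penalised \<tau> p'"
begin

lemma minimiser_defect_le: "defect p \<le> 2 * \<tau>"
proof -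
  obtain p' where "p' \<in> plan_box" "defect p' = 0" "cost p' \<le> 1" using product_plan by blast
  then have "penalised \<tau> p \<le> 1" using minimal[of p'] by (simp add: penalised_def)
  then have "defect p / (2 * \<tau>) \<le> 1" using cost_nonneg[OF p_in_box] by (simp add: penalised_def)
  then show ?thesis using \<tau> by (simp add: field_simps)
qed

lemma minimiser_le_3:
  assumes "a \<in> I" "b \<in> I"
  shows "p (a, b) \<le> 3"
proof -
  have "p (a, b) \<le> row_sum p a"
    unfolding row_sum_def using assms finite p_in_box by (intro member_le_sum) (auto simp: plan_box_def)
  moreover have "row_sum p a - m a \<le> 2"
    using square_row_sum_le_defect[OF assms(1), of p] minimiser_defect_le \<tau>
    by (auto intro: power2_le_imp_le[of _ 2])
  ultimately show ?thesis using m_le_1[OF assms(1)] by simp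
qed

lemma minimiser_perturb:
  assumes "a \<in> I" "b \<in> I" "0 \<le> p (a, b) + e" "p (a, b) + e \<le> 4"
  shows "0 \<le> e * (c a b - row_potential \<tau> p a - col_potential \<tau> p b) + e\<^sup>2 * (1 / \<tau>)"
proof -
  have "p((a, b) := p (a, b) + e) \<in> plan_box" using assms p_in_box by (auto simp: plan_box_def)
  from minimal[OF this] show ?thesis
    unfolding penalised_perturb[OF assms(1,2) \<tau>(1)] by simp
qed

lemma minimiser_dual_feasible:
  assumes in_I: "a \<in> I" "b \<in> I"
  shows "row_potential \<tau> p a + col_potential \<tau> p b \<le> c a b"
proof -
  have "0 \<le> p (a, b)" "p (a, b) \<le> 3"
    using p_in_box minimiser_le_3[OF in_I] by (simp_all add: plan_box_def)
  then have "0 \<le> e * (c a b - row_potential \<tau> p a - col_potential \<tau> p b) + e\<^sup>2 * (1 / \<tau>)"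
    if "0 < e" "e \<le> 1" for e
    using that by (intro minimiser_perturb[OF in_I]) auto
  from linear_coefficient_nonneg[OF zero_less_one this] show ?thesis by simp
qed

lemma minimiser_complementary_slackness:
  assumes in_I: "a \<in> I" "b \<in> I"
  shows "p (a, b) * c a b = p (a, b) * (row_potential \<tau> p a + col_potential \<tau> p b)"
proof (cases "p (a, b) = 0")
  case False
  then have "0 < p (a, b)" using p_in_box by (simp add: plan_box_def less_le)
  moreover have "0 \<le> e * - (c a b - row_potential \<tau> p a - col_potential \<tau> p b) + e\<^sup>2 * (1 / \<tau>)"
    if "0 < e" "e \<le> p (a, b)" for e
    using minimiser_perturb[OF in_I, of "- e"] minimiser_le_3[OF in_I] that by (simp add: algebra_simps)
  ultimately have "0 \<le> - (c a b - row_potential \<tau> p a - col_potential \<tau> p b)"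
    by (rule linear_coefficient_nonneg)
  then show ?thesis using minimiser_dual_feasible[OF in_I] by simp
qed simp

lemma minimiser_cost_le:
  assumes dual: "\<And>f. (\<And>x y. f x - f y \<le> c x y) \<Longrightarrow> (\<Sum>x\<in>I. f x * (m x - k x)) \<le> D"
  shows "cost p \<le> D"
proof -
  let ?u = "row_potential \<tau> p" and ?v = "col_potential \<tau> p"
  obtain f where f_Lipschitz: "\<And>x y. f x - f y \<le> c x y"
    and f: "\<And>x. x \<in> I \<Longrightarrow> ?u x \<le> f x" "\<And>x. x \<in> I \<Longrightarrow> f x \<le> - ?v x"
    using dual_potential[of ?u ?v] minimiser_dual_feasible by blast
  have row_sum: "row_sum p x = m x - \<tau> * ?u x" and col_sum: "col_sum p x = k x - \<tau> * ?v x" for x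
    using \<tau> by (auto simp: row_potential_def col_potential_def)
  have "cost p = (\<Sum>x\<in>I. \<Sum>y\<in>I. p (x, y) * ?u x + p (x, y) * ?v y)"
    unfolding cost_def using minimiser_complementary_slackness by (intro sum.cong refl) (simp add: distrib_left)
  also have "\<dots> = (\<Sum>x\<in>I. row_sum p x * ?u x) + (\<Sum>y\<in>I. col_sum p y * ?v y)"
    unfolding sum.distrib row_sum_def col_sum_def sum_distrib_right by (subst (2) sum.swap) simp
  also have "\<dots> \<le> (\<Sum>x\<in>I. m x * ?u x) + (\<Sum>y\<in>I. k y * ?v y)"
    using \<tau> by (intro add_mono sum_mono) (auto simp: row_sum col_sum algebra_simps)
  also have "\<dots> \<le> (\<Sum>x\<in>I. m x * f x) + (\<Sum>y\<in>I. k y * (- f y))"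
    using f m_nonneg k_nonneg by (intro add_mono sum_mono mult_left_mono) (auto simp: le_minus_iff)
  also have "\<dots> = (\<Sum>x\<in>I. f x * (m x - k x))"
    by (simp add: algebra_simps sum_negf sum_subtractf)
  also have "\<dots> \<le> D" by (intro dual f_Lipschitz)
  finally show ?thesis .
qed

end

theorem finite_duality:
  assumes dual: "\<And>f. (\<And>x y. f x - f y \<le> c x y) \<Longrightarrow> (\<Sum>x\<in>I. f x * (m x - k x)) \<le> D"
  shows "\<exists>p. (\<forall>z. 0 \<le> p z) \<and> (\<forall>x\<in>I. row_sum p x = m x \<and> col_sum p x = k x) \<and> cost p \<le> D"
proof -
  define excess where "excess p = defect p + max 0 (cost p - D)" for p
  have continuous: "continuous_on plan_box excess"
    unfolding excess_def by (intro continuous_intros continuous_on_cost continuous_on_defect)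
  obtain p where p: "p \<in> plan_box" and minimal: "\<And>p'. p' \<in> plan_box \<Longrightarrow> excess p \<le> excess p'"
    using continuous_attains_inf_plan_box[OF continuous] by metis
  have "excess p \<le> 0 + e" if "0 < e" for e
  proof -
    define \<tau> where "\<tau> = min 1 (e / 2)"
    have \<tau>: "0 < \<tau>" "\<tau> \<le> 1" "2 * \<tau> \<le> e" using that by (auto simp: \<tau>_def)
    have "continuous_on plan_box (penalised \<tau>)"
      unfolding penalised_def[abs_def]
      using \<tau> by (intro continuous_intros continuous_on_cost continuous_on_defect) auto
    then obtain q where q: "q \<in> plan_box" "\<And>p'. p' \<in> plan_box \<Longrightarrow> penalised \<tau> q \<le> penalised \<tau> p'"
      using continuous_attains_inf_plan_box by metis
    have "excess q \<le> e"
      using minimiser_defect_le[OF \<tau>(1,2) q] minimiser_cost_le[OF \<tau>(1,2) q dual] \<tau>(3) by (simp add: excess_def)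
    then show ?thesis using minimal[OF q(1)] by simp
  qed
  then have "excess p \<le> 0" by (rule field_le_epsilon)
  then have "defect p = 0" "cost p \<le> D"
    using defect_nonneg[of p] by (auto simp: excess_def)
  then show ?thesis
    using p by (auto simp: defect_eq_0_iff plan_box_def intro!: exI[of _ p])
qed

end

section \<open>Probability kernels and couplings\<close>

abbreviation prob_measures :: "'a::topological_space measure set" where
  "prob_measures \<equiv> space (prob_algebra borel)"

lemma in_prob_measures_iff: "\<mu> \<in> prob_measures \<longleftrightarrow> prob_space \<mu> \<and> sets \<mu> = sets borel"
  by (auto simp: space_prob_algebra)

lemma prob_measuresD:
  assumes "\<mu> \<in> prob_measures"
  shows "prob_space \<mu>" "sets \<mu> = sets borel" "space \<mu> = UNIV"
  using assms sets_eq_imp_space_eq[of \<mu> borel] by (auto simp: in_prob_measures_iff)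

lemma pmf_in_prob_algebra: "measure_pmf p \<in> space (prob_algebra (count_space UNIV))"
  by (simp add: space_prob_algebra prob_space_measure_pmf)

lemma integrable_bounded_prob:
  fixes f :: "'a \<Rightarrow> real"
  assumes "\<mu> \<in> space (prob_algebra M)" "f \<in> borel_measurable M" "\<And>x. \<bar>f x\<bar> \<le> B"
  shows "integrable \<mu> f"
proof -
  interpret prob_space \<mu> using assms(1) by (simp add: space_prob_algebra)
  have "sets \<mu> = sets M" using assms(1) by (simp add: space_prob_algebra)
  then show ?thesis
    using assms by (intro integrable_const_bound[where B=B]) (auto cong: measurable_cong_sets)
qed

lemma bind_in_prob_algebra:
  assumes "\<mu> \<in> space (prob_algebra M)" "\<kappa> \<in> M \<rightarrow>\<^sub>M prob_algebra N"
  shows "\<mu> \<bind> \<kappa> \<in> space (prob_algebra N)"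
  using prob_space_bind'[OF assms] sets_bind'[OF assms] by (simp add: space_prob_algebra)

lemma kernel_measurable_subprob:
  assumes "\<mu> \<in> space (prob_algebra M)" "\<kappa> \<in> M \<rightarrow>\<^sub>M prob_algebra N"
  shows "\<kappa> \<in> \<mu> \<rightarrow>\<^sub>M subprob_algebra N"
  using measurable_prob_algebraD[OF assms(2)] assms(1)
  by (simp add: space_prob_algebra cong: measurable_cong_sets)

lemma nn_integral_bind_kernel:
  assumes "\<mu> \<in> space (prob_algebra M)" "\<kappa> \<in> M \<rightarrow>\<^sub>M prob_algebra N" "f \<in> borel_measurable N"
  shows "(\<integral>\<^sup>+y. f y \<partial>(\<mu> \<bind> \<kappa>)) = (\<integral>\<^sup>+x. \<integral>\<^sup>+y. f y \<partial>\<kappa> x \<partial>\<mu>)"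
  by (rule nn_integral_bind[OF assms(3) kernel_measurable_subprob[OF assms(1,2)]])

lemma integral_bind_kernel:
  fixes f :: "'a \<Rightarrow> real"
  assumes \<mu>: "\<mu> \<in> space (prob_algebra M)" and \<kappa>: "\<kappa> \<in> M \<rightarrow>\<^sub>M prob_algebra N"
    and f: "f \<in> borel_measurable N" "\<And>y. \<bar>f y\<bar> \<le> B"
  shows "(\<integral>y. f y \<partial>(\<mu> \<bind> \<kappa>)) = (\<integral>x. (\<integral>y. f y \<partial>\<kappa> x) \<partial>\<mu>)"
proof (rule integral_bind[where K=N and B=B and B'=1])
  show "\<kappa> \<in> \<mu> \<rightarrow>\<^sub>M subprob_algebra N" by (rule kernel_measurable_subprob[OF \<mu> \<kappa>])
  interpret prob_space \<mu> using \<mu> by (simp add: space_prob_algebra)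
  show "finite_measure \<mu>" by (rule finite_measure_axioms)
  have "prob_space (\<kappa> x)" if "x \<in> space M" for x
    using measurable_space[OF \<kappa> that] by (simp add: space_prob_algebra)
  moreover have "space \<mu> = space M"
    using \<mu> by (intro sets_eq_imp_space_eq) (simp add: space_prob_algebra)
  ultimately show "AE x in \<mu>. emeasure (\<kappa> x) (space (\<kappa> x)) \<le> ennreal 1"
    by (auto simp: prob_space.emeasure_space_1)
qed (use f in auto)

lemma integral_kernel_measurable:
  fixes f :: "'a \<Rightarrow> real"
  assumes "\<kappa> \<in> M \<rightarrow>\<^sub>M prob_algebra N" "f \<in> borel_measurable N"
  shows "(\<lambda>x. \<integral>y. f y \<partial>\<kappa> x) \<in> borel_measurable M"
  by (rule measurable_compose[OF measurable_prob_algebraD[OF assms(1)] integral_measurable_subprob_algebra[OF assms(2)]])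

lemma nn_integral_kernel_measurable:
  assumes "\<kappa> \<in> M \<rightarrow>\<^sub>M prob_algebra N" "f \<in> borel_measurable N"
  shows "(\<lambda>x. \<integral>\<^sup>+y. f y \<partial>\<kappa> x) \<in> borel_measurable M"
  by (rule measurable_compose[OF measurable_prob_algebraD[OF assms(1)] nn_integral_measurable_subprob_algebra[OF assms(2)]])

lemma integral_prob_bounded:
  fixes f :: "'a \<Rightarrow> real"
  assumes "\<mu> \<in> space (prob_algebra M)" "f \<in> borel_measurable M" "\<And>x. \<bar>f x\<bar> \<le> B"
  shows "\<bar>\<integral>x. f x \<partial>\<mu>\<bar> \<le> B"
proof -
  interpret prob_space \<mu> using assms(1) by (simp add: space_prob_algebra)
  have "\<bar>\<integral>x. f x \<partial>\<mu>\<bar> \<le> (\<integral>x. \<bar>f x\<bar> \<partial>\<mu>)" by (rule integral_abs_bound)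
  also have "\<dots> \<le> (\<integral>x. B \<partial>\<mu>)"
    using assms(3) integrable_bounded_prob[OF assms] by (intro integral_mono) auto
  finally show ?thesis by (simp add: prob_space)
qed

lemma couplingsD:
  assumes "c \<in> couplings \<mu> \<nu>"
  shows "c \<in> space (prob_algebra (borel \<Otimes>\<^sub>M borel))" "sets c = sets (borel \<Otimes>\<^sub>M borel)" "prob_space c"
    and "distr c borel fst = \<mu>" "distr c borel snd = \<nu>"
  using assms by (auto simp: couplings_def space_prob_algebra)

lemma coupling_marginals:
  assumes "c \<in> couplings \<mu> \<nu>"
  shows "\<mu> \<in> prob_measures" "\<nu> \<in> prob_measures"
proof -
  note marginals = couplingsD[OF assms]
  have "distr c borel fst \<in> prob_measures" "distr c borel snd \<in> prob_measures"
    using marginals(3) by (auto simp: in_prob_measures_iff measurable_cong_sets[OF marginals(2) refl]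
        intro!: prob_space.prob_space_distr)
  then show "\<mu> \<in> prob_measures" "\<nu> \<in> prob_measures" by (simp_all add: marginals)
qed

lemma coupling_nn_integral:
  assumes coupling: "c \<in> couplings \<mu> \<nu>" and f[measurable]: "f \<in> borel_measurable borel"
  shows "(\<integral>\<^sup>+z. f (fst z) \<partial>c) = (\<integral>\<^sup>+x. f x \<partial>\<mu>)" "(\<integral>\<^sup>+z. f (snd z) \<partial>c) = (\<integral>\<^sup>+x. f x \<partial>\<nu>)"
proof -
  note [measurable_cong] = couplingsD(2)[OF coupling]
  show "(\<integral>\<^sup>+z. f (fst z) \<partial>c) = (\<integral>\<^sup>+x. f x \<partial>\<mu>)"
    unfolding couplingsD(4)[OF coupling, symmetric] by (rule nn_integral_distr[symmetric]) measurable
  show "(\<integral>\<^sup>+z. f (snd z) \<partial>c) = (\<integral>\<^sup>+x. f x \<partial>\<nu>)"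
    unfolding couplingsD(5)[OF coupling, symmetric] by (rule nn_integral_distr[symmetric]) measurable
qed

lemma coupling_integral:
  fixes f :: "'a::topological_space \<Rightarrow> real"
  assumes coupling: "c \<in> couplings \<mu> \<nu>" and f[measurable]: "f \<in> borel_measurable borel"
  shows "(\<integral>z. f (fst z) \<partial>c) = (\<integral>x. f x \<partial>\<mu>)" "(\<integral>z. f (snd z) \<partial>c) = (\<integral>x. f x \<partial>\<nu>)"
    and "integrable c (\<lambda>z. f (fst z)) \<longleftrightarrow> integrable \<mu> f" "integrable c (\<lambda>z. f (snd z)) \<longleftrightarrow> integrable \<nu> f"
proof -
  note [measurable_cong] = couplingsD(2)[OF coupling]
  note marginals = couplingsD(4,5)[OF coupling, symmetric]
  show "(\<integral>z. f (fst z) \<partial>c) = (\<integral>x. f x \<partial>\<mu>)"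
    unfolding marginals(1) by (rule integral_distr[symmetric]) measurable
  show "(\<integral>z. f (snd z) \<partial>c) = (\<integral>x. f x \<partial>\<nu>)"
    unfolding marginals(2) by (rule integral_distr[symmetric]) measurable
  show "integrable c (\<lambda>z. f (fst z)) \<longleftrightarrow> integrable \<mu> f"
    unfolding marginals(1) by (rule integrable_distr_eq[symmetric]) measurable
  show "integrable c (\<lambda>z. f (snd z)) \<longleftrightarrow> integrable \<nu> f"
    unfolding marginals(2) by (rule integrable_distr_eq[symmetric]) measurable
qed

lemma product_coupling:
  assumes "\<mu> \<in> prob_measures" "\<nu> \<in> prob_measures"
  shows "\<mu> \<Otimes>\<^sub>M \<nu> \<in> couplings \<mu> \<nu>"
proof -
  have \<mu>: "prob_space \<mu>" "sets \<mu> = sets borel" and \<nu>: "prob_space \<nu>" "sets \<nu> = sets borel"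
    using assms by (auto simp: in_prob_measures_iff)
  have "sets (\<mu> \<Otimes>\<^sub>M \<nu>) = sets (borel \<Otimes>\<^sub>M borel)"
    using \<mu> \<nu> by (intro sets_pair_measure_cong) auto
  moreover have "distr (\<mu> \<Otimes>\<^sub>M \<nu>) borel fst = \<mu>"
    using prob_space.distr_pair_fst[OF \<nu>(1), of \<mu>] \<mu> \<nu> by (simp cong: distr_cong)
  moreover have "distr (\<mu> \<Otimes>\<^sub>M \<nu>) borel snd = \<nu>"
  proof -
    interpret pair_prob_space \<mu> \<nu>
      using \<mu> \<nu> by (simp add: pair_prob_space_def pair_sigma_finite_def prob_space_imp_sigma_finite)
    have "distr (\<mu> \<Otimes>\<^sub>M \<nu>) borel snd = distr (distr (\<nu> \<Otimes>\<^sub>M \<mu>) (\<mu> \<Otimes>\<^sub>M \<nu>) (\<lambda>(x, y). (y, x))) borel snd"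
      by (subst distr_pair_swap) simp
    also have "\<dots> = distr (\<nu> \<Otimes>\<^sub>M \<mu>) borel fst"
      using \<nu> by (subst distr_distr) (auto simp: comp_def case_prod_beta cong: measurable_cong_sets)
    also have "\<dots> = \<nu>"
      using prob_space.distr_pair_fst[OF \<mu>(1), of \<nu>] \<mu> \<nu> by (simp cong: distr_cong)
    finally show ?thesis .
  qed
  ultimately show ?thesis
    using \<mu> \<nu> by (simp add: couplings_def prob_space_pair)
qed

definition kernel_coupling ::
  "'w measure \<Rightarrow> ('w \<Rightarrow> 'a::topological_space) \<Rightarrow> ('w \<Rightarrow> 'b) \<Rightarrow> ('b \<Rightarrow> 'a measure) \<Rightarrow> ('a \<times> 'a) measure" where
  "kernel_coupling M X Y \<kappa> = M \<bind> (\<lambda>\<omega>. distr (\<kappa> (Y \<omega>)) (borel \<Otimes>\<^sub>M borel) (Pair (X \<omega>)))"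

context
  fixes M :: "'w measure" and X :: "'w \<Rightarrow> 'a::topological_space" and Y :: "'w \<Rightarrow> 'b::topological_space"
    and \<kappa> :: "'b \<Rightarrow> 'a measure"
  assumes M: "prob_space M" and X [measurable]: "X \<in> M \<rightarrow>\<^sub>M borel" and Y [measurable]: "Y \<in> M \<rightarrow>\<^sub>M borel"
    and \<kappa> [measurable]: "\<kappa> \<in> borel \<rightarrow>\<^sub>M prob_algebra borel"
begin

lemma kernel_Pair_measurable:
  "(\<lambda>\<omega>. distr (\<kappa> (Y \<omega>)) (borel \<Otimes>\<^sub>M borel) (Pair (X \<omega>))) \<in> M \<rightarrow>\<^sub>M prob_algebra (borel \<Otimes>\<^sub>M borel)"
  by (rule measurable_distr_prob_space2[where M=borel]) measurable

lemma M_in_prob_algebra: "M \<in> space (prob_algebra M)"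
  using M by (simp add: space_prob_algebra)

lemma kernel_in_prob_measures: "\<kappa> y \<in> prob_measures"
  using measurable_space[OF \<kappa>] by simp

lemma nn_integral_kernel_coupling:
  assumes "f \<in> borel_measurable (borel \<Otimes>\<^sub>M borel)"
  shows "(\<integral>\<^sup>+z. f z \<partial>kernel_coupling M X Y \<kappa>) = (\<integral>\<^sup>+\<omega>. \<integral>\<^sup>+y. f (X \<omega>, y) \<partial>\<kappa> (Y \<omega>) \<partial>M)"
proof -
  have "sets (\<kappa> y) = sets borel" for y using kernel_in_prob_measures by (simp add: in_prob_measures_iff)
  then have "(\<integral>\<^sup>+z. f z \<partial>distr (\<kappa> (Y \<omega>)) (borel \<Otimes>\<^sub>M borel) (Pair (X \<omega>))) = (\<integral>\<^sup>+y. f (X \<omega>, y) \<partial>\<kappa> (Y \<omega>))" for \<omega>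
    using assms by (subst nn_integral_distr) (auto cong: measurable_cong_sets)
  then show ?thesis
    unfolding kernel_coupling_def
    by (simp add: nn_integral_bind_kernel[OF M_in_prob_algebra kernel_Pair_measurable assms])
qed

lemma kernel_coupling: "kernel_coupling M X Y \<kappa> \<in> couplings (distr M borel X) (distr M borel Y \<bind> \<kappa>)"
proof -
  let ?k = "\<lambda>\<omega>. distr (\<kappa> (Y \<omega>)) (borel \<Otimes>\<^sub>M borel) (Pair (X \<omega>))"
  interpret prob_space M by (rule M)
  note kernel = measurable_prob_algebraD[OF kernel_Pair_measurable]
  have distr_marginal: "distr (kernel_coupling M X Y \<kappa>) borel f = M \<bind> (\<lambda>\<omega>. distr (\<kappa> (Y \<omega>)) borel (\<lambda>y. f (X \<omega>, y)))"
    if [measurable]: "f \<in> borel \<Otimes>\<^sub>M borel \<rightarrow>\<^sub>M borel" for f :: "'a \<times> 'a \<Rightarrow> 'a"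
  proof -
    have "distr (?k \<omega>) borel f = distr (\<kappa> (Y \<omega>)) borel (\<lambda>y. f (X \<omega>, y))" for \<omega>
      using kernel_in_prob_measures
      by (subst distr_distr) (auto simp: comp_def in_prob_measures_iff cong: measurable_cong_sets)
    then show ?thesis
      unfolding kernel_coupling_def using distr_bind[OF kernel not_empty that] by simp
  qed
  have distr_constant: "distr (\<kappa> y) borel (\<lambda>_. x) = return borel x" for x y
    using kernel_in_prob_measures by (intro prob_space.distr_const) (auto simp: in_prob_measures_iff)
  have "distr (kernel_coupling M X Y \<kappa>) borel fst = distr M borel X"
    by (simp add: distr_marginal distr_constant bind_return_distr'[OF not_empty X])
  moreover have "distr (kernel_coupling M X Y \<kappa>) borel snd = distr M borel Y \<bind> \<kappa>"
  proof -
    have "distr (\<kappa> y) borel (\<lambda>z. z) = \<kappa> y" for y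
      using kernel_in_prob_measures by (intro distr_id2) (auto simp: in_prob_measures_iff)
    then show ?thesis
      by (simp add: distr_marginal bind_distr[OF Y measurable_prob_algebraD[OF \<kappa>] not_empty])
  qed
  moreover have "kernel_coupling M X Y \<kappa> \<in> space (prob_algebra (borel \<Otimes>\<^sub>M borel))"
    unfolding kernel_coupling_def by (rule bind_in_prob_algebra[OF M_in_prob_algebra kernel_Pair_measurable])
  ultimately show ?thesis
    by (auto simp: couplings_def space_prob_algebra)
qed

end

section \<open>The Kantorovich distance for the truncated metric\<close>

definition bdist :: "'a::metric_space \<Rightarrow> 'a \<Rightarrow> real" where
  "bdist x y = min (dist x y) 1"

definition bLip :: "('a::metric_space \<Rightarrow> real) \<Rightarrow> bool" where
  "bLip f \<longleftrightarrow> (\<forall>x y. f x - f y \<le> bdist x y)"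

lemma bdist_nonneg [simp]: "0 \<le> bdist x y" and bdist_le_1 [simp]: "bdist x y \<le> 1"
  and bdist_self [simp]: "bdist x x = 0" and bdist_commute: "bdist x y = bdist y x"
  by (auto simp: bdist_def dist_commute)

lemma bdist_triangle: "bdist x z \<le> bdist x y + bdist y z"
  using dist_triangle[of x z y] zero_le_dist[of x y] zero_le_dist[of y z] unfolding bdist_def by linarith

lemma bdist_measurable [measurable]:
  "f \<in> M \<rightarrow>\<^sub>M borel \<Longrightarrow> g \<in> M \<rightarrow>\<^sub>M borel \<Longrightarrow>
    (\<lambda>x. bdist (f x) (g x :: 'a::{second_countable_topology, metric_space})) \<in> borel_measurable M"
  unfolding bdist_def by measurable

lemma bLipD: "bLip f \<Longrightarrow> \<bar>f x - f y\<bar> \<le> bdist x y"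
  unfolding bLip_def by (metis abs_le_iff bdist_commute minus_diff_eq)

lemma bLip_uminus: "bLip f \<Longrightarrow> bLip (\<lambda>x. - f x)"
  unfolding bLip_def[of "\<lambda>x. - f x"] using bLipD[of f] by (simp add: abs_le_iff)

lemma bLip_continuous: "bLip f \<Longrightarrow> continuous_on UNIV f"
proof -
  assume "bLip f"
  then have "1-lipschitz_on UNIV f"
    using bLipD[of f] by (intro lipschitz_onI) (force simp: dist_real_def bdist_def)+
  then show ?thesis by (rule lipschitz_on_continuous_on)
qed

lemma bLip_measurable [measurable_dest]: "bLip f \<Longrightarrow> f \<in> borel_measurable borel"
  by (intro borel_measurable_continuous_onI bLip_continuous)

lemma bLip_bounded: "bLip f \<Longrightarrow> \<bar>f x\<bar> \<le> \<bar>f undefined\<bar> + 1"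
  using bLipD[of f x undefined] bdist_le_1[of x undefined] by linarith

lemma bLip_cutoff:
  assumes "a \<le> 1"
  shows "bLip (\<lambda>x. max 0 (a - infdist x F))"
  unfolding bLip_def
proof (intro allI)
  fix x y
  show "max 0 (a - infdist x F) - max 0 (a - infdist y F) \<le> bdist x y"
    using infdist_triangle[of y F x] infdist_nonneg[of x F] assms
    unfolding bdist_def by (smt (verit) zero_le_dist dist_commute)
qed

definition kantorovich :: "'a::metric_space measure \<Rightarrow> 'a measure \<Rightarrow> real" where
  "kantorovich \<mu> \<nu> = (SUP f\<in>Collect bLip. (\<integral>x. f x \<partial>\<mu>) - (\<integral>x. f x \<partial>\<nu>))"

lemma kantorovich_leI:
  assumes "\<And>f. bLip f \<Longrightarrow> (\<integral>x. f x \<partial>\<mu>) - (\<integral>x. f x \<partial>\<nu>) \<le> E"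
  shows "kantorovich \<mu> \<nu> \<le> E"
proof -
  have "bLip (\<lambda>_. 0)" by (simp add: bLip_def)
  then show ?thesis unfolding kantorovich_def by (intro cSUP_least) (auto intro: assms)
qed

lemma coupling_integral_diff_le:
  fixes g :: "'a::topological_space \<Rightarrow> real"
  assumes coupling: "c \<in> couplings \<mu> \<nu>" and g [measurable]: "g \<in> borel_measurable borel" and "\<And>x. \<bar>g x\<bar> \<le> B"
    and \<Psi>: "integrable c \<Psi>" "\<And>x y. g x - g y \<le> \<Psi> (x, y)"
  shows "(\<integral>x. g x \<partial>\<mu>) - (\<integral>x. g x \<partial>\<nu>) \<le> (\<integral>z. \<Psi> z \<partial>c)"
proof -
  have "integrable \<mu> g" "integrable \<nu> g"
    using coupling_marginals[OF coupling] integrable_bounded_prob[OF _ assms(2,3)] by auto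
  then have integrable: "integrable c (\<lambda>z. g (fst z))" "integrable c (\<lambda>z. g (snd z))"
    by (simp_all add: coupling_integral[OF coupling])
  have "(\<integral>x. g x \<partial>\<mu>) - (\<integral>x. g x \<partial>\<nu>) = (\<integral>z. g (fst z) - g (snd z) \<partial>c)"
    using integrable by (simp add: coupling_integral[OF coupling])
  also have "\<dots> \<le> (\<integral>z. \<Psi> z \<partial>c)"
    using integrable \<Psi> by (intro integral_mono) (auto intro: order_trans)
  finally show ?thesis .
qed

lemma bLip_integral_diff_le_1:
  assumes "\<mu> \<in> prob_measures" "\<nu> \<in> prob_measures" "bLip f"
  shows "(\<integral>x. f x \<partial>\<mu>) - (\<integral>x. f x \<partial>\<nu>) \<le> 1"
proof -
  note coupling = product_coupling[OF assms(1,2)]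
  interpret prob_space "\<mu> \<Otimes>\<^sub>M \<nu>" by (rule couplingsD(3)[OF coupling])
  have "(\<integral>x. f x \<partial>\<mu>) - (\<integral>x. f x \<partial>\<nu>) \<le> (\<integral>z. 1 \<partial>(\<mu> \<Otimes>\<^sub>M \<nu>))"
  proof (rule coupling_integral_diff_le[OF coupling bLip_measurable[OF assms(3)] bLip_bounded[OF assms(3)]])
    show "f x - f y \<le> 1" for x y
      using bLipD[OF assms(3), of x y] bdist_le_1[of x y] by linarith
  qed simp
  then show ?thesis by (simp add: prob_space)
qed

lemma kantorovich_le_1: "\<mu> \<in> prob_measures \<Longrightarrow> \<nu> \<in> prob_measures \<Longrightarrow> kantorovich \<mu> \<nu> \<le> 1"
  by (rule kantorovich_leI) (rule bLip_integral_diff_le_1)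

lemma kantorovich_upper:
  assumes "\<mu> \<in> prob_measures" "\<nu> \<in> prob_measures" "bLip f"
  shows "\<bar>(\<integral>x. f x \<partial>\<mu>) - (\<integral>x. f x \<partial>\<nu>)\<bar> \<le> kantorovich \<mu> \<nu>"
proof -
  have "bdd_above ((\<lambda>f. (\<integral>x. f x \<partial>\<mu>) - (\<integral>x. f x \<partial>\<nu>)) ` Collect bLip)"
    using bLip_integral_diff_le_1[OF assms(1,2)] by (intro bdd_aboveI2[where M=1]) simp
  then have upper: "(\<integral>x. f x \<partial>\<mu>) - (\<integral>x. f x \<partial>\<nu>) \<le> kantorovich \<mu> \<nu>" if "bLip f" for f
    unfolding kantorovich_def using that by (intro cSUP_upper) auto
  show ?thesis
    using upper[OF assms(3)] upper[OF bLip_uminus[OF assms(3)]] by simp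
qed

lemma kantorovich_nonneg: "\<mu> \<in> prob_measures \<Longrightarrow> \<nu> \<in> prob_measures \<Longrightarrow> 0 \<le> kantorovich \<mu> \<nu>"
  using kantorovich_upper[of \<mu> \<nu> "\<lambda>_. 0"] by (simp add: bLip_def)

lemma kantorovich_self [simp]: "kantorovich \<mu> \<mu> = 0"
proof -
  have "Collect bLip \<noteq> ({} :: ('a \<Rightarrow> real) set)" by (auto simp: bLip_def intro: exI[of _ "\<lambda>_. 0"])
  then show ?thesis by (simp add: kantorovich_def)
qed

lemma kantorovich_commute:
  assumes "\<mu> \<in> prob_measures" "\<nu> \<in> prob_measures"
  shows "kantorovich \<mu> \<nu> = kantorovich \<nu> \<mu>"
proof (rule antisym)
  show "kantorovich \<mu> \<nu> \<le> kantorovich \<nu> \<mu>"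
    by (rule kantorovich_leI) (use kantorovich_upper[OF assms(2,1)] in \<open>force simp: abs_le_iff\<close>)
  show "kantorovich \<nu> \<mu> \<le> kantorovich \<mu> \<nu>"
    by (rule kantorovich_leI) (use kantorovich_upper[OF assms] in \<open>force simp: abs_le_iff\<close>)
qed

lemma kantorovich_triangle:
  assumes "\<mu> \<in> prob_measures" "\<nu> \<in> prob_measures" "\<xi> \<in> prob_measures"
  shows "kantorovich \<mu> \<xi> \<le> kantorovich \<mu> \<nu> + kantorovich \<nu> \<xi>"
proof (rule kantorovich_leI)
  fix f :: "'a \<Rightarrow> real" assume "bLip f"
  then show "(\<integral>x. f x \<partial>\<mu>) - (\<integral>x. f x \<partial>\<xi>) \<le> kantorovich \<mu> \<nu> + kantorovich \<nu> \<xi>"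
    using kantorovich_upper[OF assms(1,2), of f] kantorovich_upper[OF assms(2,3), of f] by linarith
qed

lemma kantorovich_bind_le:
  fixes \<kappa> :: "'b::topological_space \<Rightarrow> 'a::metric_space measure"
  assumes coupling: "c \<in> couplings \<mu> \<nu>" and \<kappa>: "\<kappa> \<in> borel \<rightarrow>\<^sub>M prob_algebra borel"
    and \<Psi>: "integrable c \<Psi>" "\<And>x y. kantorovich (\<kappa> x) (\<kappa> y) \<le> \<Psi> (x, y)"
  shows "kantorovich (\<mu> \<bind> \<kappa>) (\<nu> \<bind> \<kappa>) \<le> (\<integral>z. \<Psi> z \<partial>c)"
proof (rule kantorovich_leI)
  fix f :: "'a \<Rightarrow> real" assume f: "bLip f"
  note f_props = bLip_measurable[OF f] bLip_bounded[OF f]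
  have \<kappa>_in: "\<kappa> x \<in> prob_measures" for x using measurable_space[OF \<kappa>] by simp
  have "(\<integral>x. (\<integral>y. f y \<partial>\<kappa> x) \<partial>\<mu>) - (\<integral>x. (\<integral>y. f y \<partial>\<kappa> x) \<partial>\<nu>) \<le> (\<integral>z. \<Psi> z \<partial>c)"
  proof (rule coupling_integral_diff_le[OF coupling integral_kernel_measurable[OF \<kappa> f_props(1)] _ \<Psi>(1)])
    show "\<bar>\<integral>y. f y \<partial>\<kappa> x\<bar> \<le> \<bar>f undefined\<bar> + 1" for x
      by (rule integral_prob_bounded[OF \<kappa>_in f_props])
    show "(\<integral>z. f z \<partial>\<kappa> x) - (\<integral>z. f z \<partial>\<kappa> y) \<le> \<Psi> (x, y)" for x y
      using kantorovich_upper[OF \<kappa>_in \<kappa>_in f, of x y] \<Psi>(2)[of x y] by linarith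
  qed
  then show "(\<integral>x. f x \<partial>(\<mu> \<bind> \<kappa>)) - (\<integral>x. f x \<partial>(\<nu> \<bind> \<kappa>)) \<le> (\<integral>z. \<Psi> z \<partial>c)"
    by (simp add: integral_bind_kernel[OF coupling_marginals(1)[OF coupling] \<kappa> f_props]
        integral_bind_kernel[OF coupling_marginals(2)[OF coupling] \<kappa> f_props])
qed

lemma infdist_cutoff_tendsto_indicator:
  assumes "closed F" "F \<noteq> {}"
  shows "(\<lambda>k. real (Suc k) * max 0 (1 / real (Suc k) - infdist x F)) \<longlonglongrightarrow> indicator F x"
proof (cases "x \<in> F")
  case True
  then show ?thesis by simp
next
  case False
  then have "0 < infdist x F" using assms infdist_pos_not_in_closed by blast
  then have "\<forall>\<^sub>F k in sequentially. 1 / real (Suc k) < infdist x F"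
    using order_tendstoD(2)[OF LIMSEQ_Suc[OF lim_1_over_n]] by simp
  then have "\<forall>\<^sub>F k in sequentially. real (Suc k) * max 0 (1 / real (Suc k) - infdist x F) = 0"
    by eventually_elim simp
  then show ?thesis using False by (simp add: tendsto_eventually)
qed

lemma measure_closed_eq_if_bLip_integrals_eq:
  assumes "\<mu> \<in> prob_measures" "\<nu> \<in> prob_measures" "closed F" "F \<noteq> {}"
    and integrals_eq: "\<And>f. bLip f \<Longrightarrow> (\<integral>x. f x \<partial>\<mu>) = (\<integral>x. f x \<partial>\<nu>)"
  shows "measure \<mu> F = measure \<nu> F"
proof -
  define g where "g k x = real (Suc k) * max 0 (1 / real (Suc k) - infdist x F)" for k x
  have [measurable]: "g k \<in> borel_measurable borel" for k
    unfolding g_def by (intro borel_measurable_continuous_onI continuous_intros)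
  have g_bounded: "\<bar>g k x\<bar> \<le> 1" for k x
  proof -
    have "max 0 (1 / real (Suc k) - infdist x F) \<le> 1 / real (Suc k)" by (simp add: infdist_nonneg)
    then have "real (Suc k) * max 0 (1 / real (Suc k) - infdist x F) \<le> real (Suc k) * (1 / real (Suc k))"
      by (intro mult_left_mono) auto
    then show ?thesis by (simp add: g_def)
  qed
  have g_limit: "(\<lambda>k. g k x) \<longlonglongrightarrow> indicator F x" for x
    unfolding g_def by (rule infdist_cutoff_tendsto_indicator[OF assms(3,4)])
  have limit: "(\<lambda>k. \<integral>x. g k x \<partial>\<xi>) \<longlonglongrightarrow> measure \<xi> F" if \<xi>: "\<xi> \<in> prob_measures" for \<xi>
  proof -
    interpret prob_space \<xi> by (rule prob_measuresD(1)[OF \<xi>])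
    note [measurable_cong] = prob_measuresD(2)[OF \<xi>]
    have [measurable]: "F \<in> sets borel" using assms(3) by simp
    have "(\<lambda>k. \<integral>x. g k x \<partial>\<xi>) \<longlonglongrightarrow> (\<integral>x. indicator F x \<partial>\<xi>)"
      using g_limit g_bounded by (intro integral_dominated_convergence[where w="\<lambda>_. 1"]) auto
    then show ?thesis by simp
  qed
  have "(\<integral>x. g k x \<partial>\<mu>) = (\<integral>x. g k x \<partial>\<nu>)" for k
    using integrals_eq[OF bLip_cutoff, of "1 / real (Suc k)" F] by (simp add: g_def)
  then show ?thesis
    using limit[OF assms(1)] limit[OF assms(2)] by (simp add: LIMSEQ_unique)
qed

lemma measure_eqI_kantorovich:
  assumes "\<mu> \<in> prob_measures" "\<nu> \<in> prob_measures" "kantorovich \<mu> \<nu> \<le> 0"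
  shows "\<mu> = \<nu>"
proof (rule measure_eqI_generator_eq[where \<Omega>=UNIV and E="Collect closed" and A="\<lambda>_. UNIV"])
  have sets: "sets \<mu> = sets borel" "sets \<nu> = sets borel" and probs: "prob_space \<mu>" "prob_space \<nu>"
    using assms by (auto simp: in_prob_measures_iff)
  show "Int_stable (Collect closed :: 'a set set)" by (auto simp: Int_stable_def)
  have "sets (borel :: 'a measure) = sigma_sets UNIV (Collect closed)"
    by (subst borel_eq_closed) (simp add: sets_measure_of)
  then show "sets \<mu> = sigma_sets UNIV (Collect closed)" "sets \<nu> = sigma_sets UNIV (Collect closed)"
    using sets by auto
  show "emeasure \<mu> F = emeasure \<nu> F" if "F \<in> Collect closed" for F
  proof (cases "F = {}")
    case False
    have "(\<integral>x. f x \<partial>\<mu>) = (\<integral>x. f x \<partial>\<nu>)" if "bLip f" for f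
      using kantorovich_upper[OF assms(1,2) that] assms(3) by simp
    then have "measure \<mu> F = measure \<nu> F"
      using that False by (intro measure_closed_eq_if_bLip_integrals_eq assms(1,2)) auto
    then show ?thesis
      using probs by (simp add: finite_measure.emeasure_eq_measure prob_space.finite_measure)
  qed simp
  show "emeasure \<mu> UNIV \<noteq> \<infinity>"
    using prob_space.emeasure_space_1[OF probs(1)] prob_measuresD(3)[OF assms(1)] by simp
qed auto

section \<open>Kantorovich duality\<close>

lemma simple_function_borelD:
  assumes "simple_function borel T"
  shows "finite (range T)" "T -` {a} \<in> sets borel" "T \<in> borel \<rightarrow>\<^sub>M count_space (range T)"
proof -
  show fin: "finite (range T)" using simple_functionD(1)[OF assms] by simp
  show fibre: "T -` {a} \<in> sets borel" for a using simple_functionD(2)[OF assms, of "{a}"] by simp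
  show "T \<in> borel \<rightarrow>\<^sub>M count_space (range T)"
    using fin fibre by (simp add: measurable_count_space_eq2)
qed

lemma has_bochner_integral_simple_comp:
  fixes h :: "'b \<Rightarrow> real"
  assumes \<mu>: "\<mu> \<in> prob_measures" and T: "simple_function borel T"
  shows "has_bochner_integral \<mu> (\<lambda>x. h (T x)) (\<Sum>a\<in>range T. h a * measure \<mu> (T -` {a}))"
proof -
  interpret prob_space \<mu> by (rule prob_measuresD(1)[OF \<mu>])
  have "T -` {a} \<in> sets \<mu>" for a
    using simple_function_borelD(2)[OF T] \<mu> by (simp add: in_prob_measures_iff)
  then have "has_bochner_integral \<mu> (\<lambda>x. \<Sum>a\<in>range T. h a * indicator (T -` {a}) x)
      (\<Sum>a\<in>range T. h a * measure \<mu> (T -` {a}))"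
    by (intro has_bochner_integral_sum has_bochner_integral_mult_right has_bochner_integral_real_indicator)
       (auto simp: emeasure_eq_measure)
  moreover have "(\<Sum>a\<in>range T. h a * indicator (T -` {a}) x) = h (T x)" for x
  proof -
    have "(\<Sum>a\<in>range T. h a * indicator (T -` {a}) x) = (\<Sum>a\<in>range T. if T x = a then h a else 0)"
      by (intro sum.cong) auto
    then show ?thesis using simple_function_borelD(1)[OF T] by simp
  qed
  ultimately show ?thesis by simp
qed

lemma nn_integral_simple_comp:
  assumes \<mu>: "\<mu> \<in> prob_measures" and T: "simple_function borel T" and h: "\<And>a. 0 \<le> h a"
  shows "(\<integral>\<^sup>+x. ennreal (h (T x)) \<partial>\<mu>) = ennreal (\<Sum>a\<in>range T. h a * measure \<mu> (T -` {a}))"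
  using has_bochner_integral_simple_comp[OF \<mu> T, of h] h
  by (simp add: nn_integral_eq_integral has_bochner_integral_iff)

lemma sum_measure_fibres:
  assumes "\<mu> \<in> prob_measures" "simple_function borel T"
  shows "(\<Sum>a\<in>range T. measure \<mu> (T -` {a})) = 1"
proof -
  interpret prob_space \<mu> by (rule prob_measuresD(1)[OF assms(1)])
  show ?thesis
    using has_bochner_integral_simple_comp[OF assms, of "\<lambda>_. 1"]
    by (simp add: has_bochner_integral_iff prob_space)
qed

lemma AE_fibre_not_null:
  assumes \<mu>: "\<mu> \<in> prob_measures" and T: "simple_function borel T"
  shows "AE x in \<mu>. measure \<mu> (T -` {T x}) \<noteq> 0"
proof -
  interpret prob_space \<mu> by (rule prob_measuresD(1)[OF \<mu>])
  have "AE x in \<mu>. \<forall>a\<in>{a \<in> range T. measure \<mu> (T -` {a}) = 0}. x \<notin> T -` {a}"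
  proof (rule AE_finite_allI)
    show "AE x in \<mu>. x \<notin> T -` {a}" if "a \<in> {a \<in> range T. measure \<mu> (T -` {a}) = 0}" for a
      using that \<mu> simple_function_borelD(2)[OF T]
      by (intro AE_not_in null_setsI) (auto simp: emeasure_eq_measure in_prob_measures_iff)
  qed (simp add: simple_function_borelD(1)[OF T])
  then show ?thesis by eventually_elim auto
qed

lemma measurable_simple_pair:
  fixes h :: "'b \<Rightarrow> 'b \<Rightarrow> 'c::topological_space"
  assumes "simple_function borel T"
  shows "(\<lambda>z. h (T (fst z)) (T (snd z))) \<in> borel \<Otimes>\<^sub>M borel \<rightarrow>\<^sub>M borel"
proof -
  note fin = simple_function_borelD(1)[OF assms] and [measurable] = simple_function_borelD(3)[OF assms]
  have "(\<lambda>z. h a (T (snd z))) \<in> borel \<Otimes>\<^sub>M borel \<rightarrow>\<^sub>M borel" for a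
    by (rule measurable_compose_countable'[where I="range T" and g="\<lambda>z. T (snd z)" and f="\<lambda>b z. h a b"])
       (auto intro: countable_finite fin)
  then show ?thesis
    by (rule measurable_compose_countable'[where I="range T" and g="\<lambda>z. T (fst z)"])
       (auto intro: countable_finite fin)
qed

(* A transport plan p between the images of mu and nu under the quantizer T lifts to a kernel from mu to nu:
   given T x = a, the target is distributed over the fibre of b as nu is, with total mass proportional to p (a, b). *)
locale quantized_plan =
  fixes \<mu> \<nu> :: "'a::topological_space measure" and T :: "'a \<Rightarrow> 'b" and p :: "'b \<times> 'b \<Rightarrow> real"
  assumes \<mu>: "\<mu> \<in> prob_measures" and \<nu>: "\<nu> \<in> prob_measures" and T: "simple_function borel T"
    and p_nonneg: "\<And>z. 0 \<le> p z"
    and p_row: "\<And>a. a \<in> range T \<Longrightarrow> (\<Sum>b\<in>range T. p (a, b)) = measure \<mu> (T -` {a})"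
    and p_col: "\<And>b. b \<in> range T \<Longrightarrow> (\<Sum>a\<in>range T. p (a, b)) = measure \<nu> (T -` {b})"
begin

definition plan_density :: "'b \<Rightarrow> 'b \<Rightarrow> real" where
  "plan_density a b =
    (if measure \<mu> (T -` {a}) = 0 then 1 else p (a, b) / (measure \<mu> (T -` {a}) * measure \<nu> (T -` {b})))"

definition plan_kernel :: "'a \<Rightarrow> 'a measure" where
  "plan_kernel x = density \<nu> (\<lambda>y. ennreal (plan_density (T x) (T y)))"

lemma plan_density_nonneg: "0 \<le> plan_density a b"
  by (simp add: plan_density_def p_nonneg)

lemma plan_density_measurable [measurable]:
  "(\<lambda>z. plan_density (T (fst z)) (T (snd z))) \<in> borel_measurable (borel \<Otimes>\<^sub>M borel)"
  by (rule measurable_simple_pair[OF T])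

lemma p_eq_0:
  assumes "a \<in> range T" "b \<in> range T"
  shows "measure \<mu> (T -` {a}) = 0 \<Longrightarrow> p (a, b) = 0" "measure \<nu> (T -` {b}) = 0 \<Longrightarrow> p (a, b) = 0"
  using p_row[OF assms(1)] p_col[OF assms(2)] assms simple_function_borelD(1)[OF T] p_nonneg
  by (auto simp: sum_nonneg_eq_0_iff)

lemma sum_plan_density_row:
  assumes "a \<in> range T"
  shows "(\<Sum>b\<in>range T. plan_density a b * measure \<nu> (T -` {b})) = 1"
proof (cases "measure \<mu> (T -` {a}) = 0")
  case True
  then show ?thesis by (simp add: plan_density_def sum_measure_fibres[OF \<nu> T])
next
  case False
  have "(\<Sum>b\<in>range T. plan_density a b * measure \<nu> (T -` {b})) = (\<Sum>b\<in>range T. p (a, b) / measure \<mu> (T -` {a}))"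
    by (intro sum.cong refl) (use False p_eq_0(2)[OF assms] in \<open>auto simp: plan_density_def\<close>)
  also have "\<dots> = 1" using p_row[OF assms] False by (simp flip: sum_divide_distrib)
  finally show ?thesis .
qed

lemma sum_plan_density_col:
  assumes "b \<in> range T" "measure \<nu> (T -` {b}) \<noteq> 0"
  shows "(\<Sum>a\<in>range T. plan_density a b * measure \<mu> (T -` {a})) = 1"
proof -
  have "(\<Sum>a\<in>range T. plan_density a b * measure \<mu> (T -` {a})) = (\<Sum>a\<in>range T. p (a, b) / measure \<nu> (T -` {b}))"
    by (intro sum.cong refl) (use p_eq_0(1)[OF _ assms(1)] in \<open>auto simp: plan_density_def\<close>)
  also have "\<dots> = 1" using p_col[OF assms(1)] assms(2) by (simp flip: sum_divide_distrib)
  finally show ?thesis .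
qed

lemma nn_integral_plan_kernel:
  assumes [measurable]: "f \<in> borel_measurable borel"
  shows "(\<integral>\<^sup>+y. f y \<partial>plan_kernel x) = (\<integral>\<^sup>+y. ennreal (plan_density (T x) (T y)) * f y \<partial>\<nu>)"
proof -
  note [measurable_cong] = prob_measuresD(2)[OF \<nu>]
  have "(\<lambda>y. plan_density (T x) (T y)) \<in> borel_measurable borel"
    using measurable_compose[OF measurable_Pair1' plan_density_measurable] by simp
  then show ?thesis unfolding plan_kernel_def by (intro nn_integral_density) auto
qed

lemma plan_kernel_in_prob_measures: "plan_kernel x \<in> prob_measures"
proof -
  have sets: "sets (plan_kernel x) = sets borel"
    using \<nu> by (simp add: plan_kernel_def in_prob_measures_iff)
  have "(\<integral>\<^sup>+y. 1 \<partial>plan_kernel x) = (\<integral>\<^sup>+y. ennreal (plan_density (T x) (T y)) * 1 \<partial>\<nu>)"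
    by (rule nn_integral_plan_kernel) simp
  also have "\<dots> = 1"
    using nn_integral_simple_comp[OF \<nu> T, of "plan_density (T x)"] plan_density_nonneg sum_plan_density_row
    by simp
  finally show ?thesis
    using sets by (auto simp: in_prob_measures_iff intro: prob_spaceI)
qed

lemma plan_kernel_measurable: "plan_kernel \<in> borel \<rightarrow>\<^sub>M prob_algebra borel"
proof (rule measurable_prob_algebraI)
  show "plan_kernel \<in> borel \<rightarrow>\<^sub>M subprob_algebra borel"
  proof (rule measurable_subprob_algebra)
    fix A :: "'a set" assume [measurable]: "A \<in> sets borel"
    interpret prob_space \<nu> by (rule prob_measuresD(1)[OF \<nu>])
    note [measurable_cong] = prob_measuresD(2)[OF \<nu>]
    have "emeasure (plan_kernel x) A = (\<integral>\<^sup>+y. indicator A y \<partial>plan_kernel x)" for x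
      using plan_kernel_in_prob_measures[of x] by (simp add: in_prob_measures_iff)
    then have "emeasure (plan_kernel x) A = (\<integral>\<^sup>+y. ennreal (plan_density (T x) (T y)) * indicator A y \<partial>\<nu>)" for x
      by (simp add: nn_integral_plan_kernel)
    then show "(\<lambda>x. emeasure (plan_kernel x) A) \<in> borel_measurable borel" by simp
  qed (use plan_kernel_in_prob_measures in \<open>auto simp: in_prob_measures_iff intro: prob_space_imp_subprob_space\<close>)
qed (use plan_kernel_in_prob_measures in \<open>simp add: in_prob_measures_iff\<close>)

lemma bind_plan_kernel: "\<mu> \<bind> plan_kernel = \<nu>"
proof (rule measure_eqI)
  interpret \<mu>: prob_space \<mu> by (rule prob_measuresD(1)[OF \<mu>])
  interpret \<nu>: prob_space \<nu> by (rule prob_measuresD(1)[OF \<nu>])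
  interpret pair_prob_space \<mu> \<nu> ..
  have [measurable_cong]: "sets \<mu> = sets borel" "sets \<nu> = sets borel"
    using \<mu> \<nu> by (auto simp: in_prob_measures_iff)
  have "\<mu> \<bind> plan_kernel \<in> prob_measures" by (rule bind_in_prob_algebra[OF \<mu> plan_kernel_measurable])
  then have sets: "sets (\<mu> \<bind> plan_kernel) = sets borel" by (simp add: in_prob_measures_iff)
  then show "sets (\<mu> \<bind> plan_kernel) = sets \<nu>" using \<nu> by (simp add: in_prob_measures_iff)
  fix A assume "A \<in> sets (\<mu> \<bind> plan_kernel)"
  then have [measurable]: "A \<in> sets borel" using sets by simp
  have "emeasure (\<mu> \<bind> plan_kernel) A = (\<integral>\<^sup>+y. indicator A y \<partial>(\<mu> \<bind> plan_kernel))" using sets by simp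
  also have "\<dots> = (\<integral>\<^sup>+x. \<integral>\<^sup>+y. ennreal (plan_density (T x) (T y)) * indicator A y \<partial>\<nu> \<partial>\<mu>)"
    by (simp add: nn_integral_bind_kernel[OF \<mu> plan_kernel_measurable] nn_integral_plan_kernel)
  also have "\<dots> = (\<integral>\<^sup>+y. \<integral>\<^sup>+x. ennreal (plan_density (T x) (T y)) * indicator A y \<partial>\<mu> \<partial>\<nu>)"
    by (rule Fubini'[symmetric]) (simp add: split_beta')
  also have "\<dots> = (\<integral>\<^sup>+y. indicator A y \<partial>\<nu>)"
  proof (rule nn_integral_cong_AE, use AE_fibre_not_null[OF \<nu> T] in eventually_elim)
    fix y assume y: "measure \<nu> (T -` {T y}) \<noteq> 0"
    have "(\<integral>\<^sup>+x. ennreal (plan_density (T x) (T y)) \<partial>\<mu>) = 1"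
      using nn_integral_simple_comp[OF \<mu> T, of "\<lambda>a. plan_density a (T y)"] plan_density_nonneg
        sum_plan_density_col[OF _ y] by simp
    then show "(\<integral>\<^sup>+x. ennreal (plan_density (T x) (T y)) * indicator A y \<partial>\<mu>) = indicator A y"
      by (cases "y \<in> A") auto
  qed
  finally show "emeasure (\<mu> \<bind> plan_kernel) A = emeasure \<nu> A" by simp
qed

lemma nn_integral_plan_kernel_simple:
  assumes h: "\<And>a b. 0 \<le> h a b"
  shows "(\<integral>\<^sup>+x. \<integral>\<^sup>+y. ennreal (h (T x) (T y)) \<partial>plan_kernel x \<partial>\<mu>)
    = ennreal (\<Sum>a\<in>range T. \<Sum>b\<in>range T. p (a, b) * h a b)"
proof -
  have [measurable]: "(\<lambda>y. h a (T y)) \<in> borel_measurable borel" for a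
    using measurable_compose[OF measurable_Pair1' measurable_simple_pair[OF T], where h1="\<lambda>_. h a"] by simp
  have "(\<integral>\<^sup>+y. ennreal (h (T x) (T y)) \<partial>plan_kernel x)
      = ennreal (\<Sum>b\<in>range T. plan_density (T x) b * h (T x) b * measure \<nu> (T -` {b}))" for x
    using nn_integral_simple_comp[OF \<nu> T, of "\<lambda>b. plan_density (T x) b * h (T x) b"] h plan_density_nonneg
    by (simp add: nn_integral_plan_kernel ennreal_mult)
  then have "(\<integral>\<^sup>+x. \<integral>\<^sup>+y. ennreal (h (T x) (T y)) \<partial>plan_kernel x \<partial>\<mu>)
      = ennreal (\<Sum>a\<in>range T. (\<Sum>b\<in>range T. plan_density a b * h a b * measure \<nu> (T -` {b})) * measure \<mu> (T -` {a}))"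
    using nn_integral_simple_comp[OF \<mu> T, of "\<lambda>a. \<Sum>b\<in>range T. plan_density a b * h a b * measure \<nu> (T -` {b})"]
      h plan_density_nonneg by (simp add: sum_nonneg)
  also have "(\<Sum>a\<in>range T. (\<Sum>b\<in>range T. plan_density a b * h a b * measure \<nu> (T -` {b})) * measure \<mu> (T -` {a}))
      = (\<Sum>a\<in>range T. \<Sum>b\<in>range T. p (a, b) * h a b)"
    unfolding sum_distrib_right using p_eq_0 by (intro sum.cong refl) (auto simp: plan_density_def)
  finally show ?thesis .
qed

end

lemma distr_in_prob_measures:
  assumes "\<mu> \<in> prob_measures" "T \<in> borel \<rightarrow>\<^sub>M borel"
  shows "distr \<mu> borel T \<in> prob_measures"
  using assms by (auto simp: in_prob_measures_iff cong: measurable_cong_sets intro: prob_space.prob_space_distr)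

lemma integral_distr_simple:
  fixes f :: "'b::topological_space \<Rightarrow> real"
  assumes "\<mu> \<in> prob_measures" "simple_function borel T"
    and [measurable]: "T \<in> borel \<rightarrow>\<^sub>M borel" "f \<in> borel_measurable borel"
  shows "(\<integral>y. f y \<partial>distr \<mu> borel T) = (\<Sum>a\<in>range T. f a * measure \<mu> (T -` {a}))"
proof -
  note [measurable_cong] = prob_measuresD(2)[OF assms(1)]
  show ?thesis
    using has_bochner_integral_simple_comp[OF assms(1,2), of f]
    by (simp add: has_bochner_integral_iff integral_distr)
qed

lemma bdist_quantizer:
  fixes \<mu> \<nu> :: "'a::{second_countable_topology, metric_space} measure"
  assumes "\<mu> \<in> prob_measures" "\<nu> \<in> prob_measures" "0 < \<epsilon>"
  obtains T :: "'a \<Rightarrow> 'a" where "simple_function borel T"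
    "(\<integral>x. bdist x (T x) \<partial>\<mu>) \<le> \<epsilon>" "(\<integral>x. bdist x (T x) \<partial>\<nu>) \<le> \<epsilon>"
proof -
  obtain F :: "nat \<Rightarrow> 'a \<Rightarrow> 'a" where F: "\<And>i. simple_function borel (F i)" "\<And>x. (\<lambda>i. F i x) \<longlonglongrightarrow> x"
    using borel_measurable_implies_sequence_metric[of "\<lambda>x::'a. x" borel undefined] by auto
  have [measurable]: "F i \<in> borel \<rightarrow>\<^sub>M borel" for i by (rule borel_measurable_simple_function[OF F(1)])
  have limit: "(\<lambda>i. \<integral>x. bdist x (F i x) \<partial>\<xi>) \<longlonglongrightarrow> 0" if "\<xi> \<in> prob_measures" for \<xi>
  proof -
    interpret prob_space \<xi> by (rule prob_measuresD(1)[OF that])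
    note [measurable_cong] = prob_measuresD(2)[OF that]
    have "(\<lambda>i. \<integral>x. bdist x (F i x) \<partial>\<xi>) \<longlonglongrightarrow> (\<integral>x. 0 \<partial>\<xi>)"
    proof (rule integral_dominated_convergence[where w="\<lambda>_. 1"])
      have "(\<lambda>i. bdist x (F i x)) \<longlonglongrightarrow> min (dist x x) 1" for x
        unfolding bdist_def by (intro tendsto_intros F)
      then show "AE x in \<xi>. (\<lambda>i. bdist x (F i x)) \<longlonglongrightarrow> 0" by simp
    qed auto
    then show ?thesis by simp
  qed
  have "\<forall>\<^sub>F i in sequentially. (\<integral>x. bdist x (F i x) \<partial>\<mu>) < \<epsilon> \<and> (\<integral>x. bdist x (F i x) \<partial>\<nu>) < \<epsilon>"
    using assms by (intro eventually_conj order_tendstoD(2)[OF limit])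
  then obtain i where "(\<integral>x. bdist x (F i x) \<partial>\<mu>) < \<epsilon>" "(\<integral>x. bdist x (F i x) \<partial>\<nu>) < \<epsilon>"
    by (auto dest: eventually_happens)
  then show ?thesis using that[OF F(1)[of i]] by simp
qed

lemma bdist_integrable:
  fixes \<mu> :: "'a::{second_countable_topology, metric_space} measure"
  assumes "\<mu> \<in> prob_measures" "T \<in> borel \<rightarrow>\<^sub>M borel"
  shows "integrable \<mu> (\<lambda>x. bdist x (T x))"
  using assms by (intro integrable_bounded_prob[where B=1]) auto

lemma kantorovich_distr_le:
  fixes \<mu> :: "'a::{second_countable_topology, metric_space} measure"
  assumes \<mu>: "\<mu> \<in> prob_measures" and T: "T \<in> borel \<rightarrow>\<^sub>M borel"
  shows "kantorovich (distr \<mu> borel T) \<mu> \<le> (\<integral>x. bdist x (T x) \<partial>\<mu>)"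
proof (rule kantorovich_leI)
  fix f :: "'a \<Rightarrow> real" assume f: "bLip f"
  have [measurable]: "f \<in> borel_measurable borel" by (rule bLip_measurable[OF f])
  note [measurable_cong] = prob_measuresD(2)[OF \<mu>]
  note [measurable] = T
  have integrable: "integrable \<mu> f" "integrable \<mu> (\<lambda>x. f (T x))"
    using bLip_bounded[OF f] by (auto intro!: integrable_bounded_prob[OF \<mu>])
  have "(\<integral>x. f x \<partial>distr \<mu> borel T) - (\<integral>x. f x \<partial>\<mu>) = (\<integral>x. f (T x) - f x \<partial>\<mu>)"
    using integrable by (simp add: integral_distr)
  also have "\<dots> \<le> (\<integral>x. bdist x (T x) \<partial>\<mu>)"
    using integrable bdist_integrable[OF \<mu> T] bLipD[OF f] bdist_commute
    by (intro integral_mono) (auto simp: abs_le_iff)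
  finally show "(\<integral>x. f x \<partial>distr \<mu> borel T) - (\<integral>x. f x \<partial>\<mu>) \<le> (\<integral>x. bdist x (T x) \<partial>\<mu>)" .
qed

lemma identity_kernel_coupling:
  assumes "\<mu> \<in> prob_measures" "\<kappa> \<in> borel \<rightarrow>\<^sub>M prob_algebra borel"
  shows "kernel_coupling \<mu> (\<lambda>x. x) (\<lambda>x. x) \<kappa> \<in> couplings \<mu> (\<mu> \<bind> \<kappa>)"
    and "f \<in> borel_measurable (borel \<Otimes>\<^sub>M borel) \<Longrightarrow>
      (\<integral>\<^sup>+z. f z \<partial>kernel_coupling \<mu> (\<lambda>x. x) (\<lambda>x. x) \<kappa>) = (\<integral>\<^sup>+x. \<integral>\<^sup>+y. f (x, y) \<partial>\<kappa> x \<partial>\<mu>)"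
proof -
  have \<mu>: "prob_space \<mu>" "sets \<mu> = sets borel" using assms(1) by (auto simp: in_prob_measures_iff)
  have identity_measurable: "(\<lambda>x. x) \<in> \<mu> \<rightarrow>\<^sub>M borel" by (rule measurable_ident_sets[OF \<mu>(2)])
  have "distr \<mu> borel (\<lambda>x. x) = \<mu>" by (rule distr_id2[OF \<mu>(2)[symmetric]])
  then show "kernel_coupling \<mu> (\<lambda>x. x) (\<lambda>x. x) \<kappa> \<in> couplings \<mu> (\<mu> \<bind> \<kappa>)"
    using kernel_coupling[OF \<mu>(1) identity_measurable identity_measurable assms(2)] by simp
  show "(\<integral>\<^sup>+z. f z \<partial>kernel_coupling \<mu> (\<lambda>x. x) (\<lambda>x. x) \<kappa>) = (\<integral>\<^sup>+x. \<integral>\<^sup>+y. f (x, y) \<partial>\<kappa> x \<partial>\<mu>)"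
    if "f \<in> borel_measurable (borel \<Otimes>\<^sub>M borel)"
    by (rule nn_integral_kernel_coupling[OF \<mu>(1) identity_measurable identity_measurable assms(2) that])
qed

lemma nn_integral_bdist_quantized_le:
  fixes \<mu> \<nu> :: "'a::{second_countable_topology, metric_space} measure"
  assumes coupling: "c \<in> couplings \<mu> \<nu>" and T [measurable]: "T \<in> borel \<rightarrow>\<^sub>M borel"
  shows "(\<integral>\<^sup>+z. ennreal (bdist (fst z) (snd z)) \<partial>c)
    \<le> (\<integral>\<^sup>+z. ennreal (bdist (T (fst z)) (T (snd z))) \<partial>c)
      + ennreal ((\<integral>x. bdist x (T x) \<partial>\<mu>) + (\<integral>x. bdist x (T x) \<partial>\<nu>))"
proof -
  note [measurable_cong] = couplingsD(2)[OF coupling]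
  have "(\<integral>\<^sup>+z. ennreal (bdist (fst z) (snd z)) \<partial>c) \<le> (\<integral>\<^sup>+z. ennreal (bdist (T (fst z)) (T (snd z)))
      + (ennreal (bdist (fst z) (T (fst z))) + ennreal (bdist (snd z) (T (snd z)))) \<partial>c)"
  proof (rule nn_integral_mono)
    fix z
    have "bdist (fst z) (snd z) \<le> bdist (fst z) (T (fst z)) + (bdist (T (fst z)) (T (snd z)) + bdist (snd z) (T (snd z)))"
      using bdist_triangle[of "fst z" "snd z" "T (fst z)"] bdist_triangle[of "T (fst z)" "snd z" "T (snd z)"]
      by (simp add: bdist_commute)
    then show "ennreal (bdist (fst z) (snd z)) \<le> ennreal (bdist (T (fst z)) (T (snd z)))
      + (ennreal (bdist (fst z) (T (fst z))) + ennreal (bdist (snd z) (T (snd z))))"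
      by (simp add: ennreal_leI algebra_simps flip: ennreal_plus)
  qed
  also have "\<dots> = (\<integral>\<^sup>+z. ennreal (bdist (T (fst z)) (T (snd z))) \<partial>c)
      + ((\<integral>\<^sup>+z. ennreal (bdist (fst z) (T (fst z))) \<partial>c) + (\<integral>\<^sup>+z. ennreal (bdist (snd z) (T (snd z))) \<partial>c))"
    by (simp add: nn_integral_add)
  also have "(\<integral>\<^sup>+z. ennreal (bdist (fst z) (T (fst z))) \<partial>c) = ennreal (\<integral>x. bdist x (T x) \<partial>\<mu>)"
    using coupling_nn_integral(1)[OF coupling, of "\<lambda>x. ennreal (bdist x (T x))"]
      nn_integral_eq_integral[OF bdist_integrable[OF coupling_marginals(1)[OF coupling] T]] by simp
  also have "(\<integral>\<^sup>+z. ennreal (bdist (snd z) (T (snd z))) \<partial>c) = ennreal (\<integral>x. bdist x (T x) \<partial>\<nu>)"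
    using coupling_nn_integral(2)[OF coupling, of "\<lambda>x. ennreal (bdist x (T x))"]
      nn_integral_eq_integral[OF bdist_integrable[OF coupling_marginals(2)[OF coupling] T]] by simp
  also have "ennreal (\<integral>x. bdist x (T x) \<partial>\<mu>) + ennreal (\<integral>x. bdist x (T x) \<partial>\<nu>)
      = ennreal ((\<integral>x. bdist x (T x) \<partial>\<mu>) + (\<integral>x. bdist x (T x) \<partial>\<nu>))"
    by (simp add: integral_nonneg_AE)
  finally show ?thesis .
qed

lemma quantized_integral_diff_le:
  fixes \<mu> \<nu> :: "'a::{second_countable_topology, metric_space} measure"
  assumes \<mu>: "\<mu> \<in> prob_measures" and \<nu>: "\<nu> \<in> prob_measures"
    and T: "simple_function borel T" "T \<in> borel \<rightarrow>\<^sub>M borel" and f: "bLip f"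
  shows "(\<Sum>a\<in>range T. f a * (measure \<mu> (T -` {a}) - measure \<nu> (T -` {a})))
    \<le> kantorovich \<mu> \<nu> + ((\<integral>x. bdist x (T x) \<partial>\<mu>) + (\<integral>x. bdist x (T x) \<partial>\<nu>))"
proof -
  let ?T\<mu> = "distr \<mu> borel T" and ?T\<nu> = "distr \<nu> borel T"
  have T\<mu>: "?T\<mu> \<in> prob_measures" and T\<nu>: "?T\<nu> \<in> prob_measures"
    by (rule distr_in_prob_measures[OF _ T(2)], fact)+
  have "(\<Sum>a\<in>range T. f a * (measure \<mu> (T -` {a}) - measure \<nu> (T -` {a}))) = (\<integral>x. f x \<partial>?T\<mu>) - (\<integral>x. f x \<partial>?T\<nu>)"
    using bLip_measurable[OF f]
    by (simp add: integral_distr_simple \<mu> \<nu> T right_diff_distrib sum_subtractf)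
  also have "\<dots> \<le> kantorovich ?T\<mu> ?T\<nu>"
    using kantorovich_upper[OF T\<mu> T\<nu> f] by simp
  also have "\<dots> \<le> kantorovich ?T\<mu> \<mu> + (kantorovich \<mu> \<nu> + kantorovich ?T\<nu> \<nu>)"
    using kantorovich_triangle[OF T\<mu> \<mu> T\<nu>] kantorovich_triangle[OF \<mu> \<nu> T\<nu>] kantorovich_commute[OF \<nu> T\<nu>]
    by linarith
  also have "\<dots> \<le> kantorovich \<mu> \<nu> + ((\<integral>x. bdist x (T x) \<partial>\<mu>) + (\<integral>x. bdist x (T x) \<partial>\<nu>))"
    using kantorovich_distr_le[OF \<mu> T(2)] kantorovich_distr_le[OF \<nu> T(2)] by linarith
  finally show ?thesis .
qed

theorem kantorovich_kernel:
  fixes \<mu> \<nu> :: "'a::{second_countable_topology, metric_space} measure"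
  assumes \<mu>: "\<mu> \<in> prob_measures" and \<nu>: "\<nu> \<in> prob_measures" and "0 < \<epsilon>"
  shows "\<exists>\<kappa>. \<kappa> \<in> borel \<rightarrow>\<^sub>M prob_algebra borel \<and> \<mu> \<bind> \<kappa> = \<nu> \<and>
    (\<integral>\<^sup>+x. \<integral>\<^sup>+y. ennreal (bdist x y) \<partial>\<kappa> x \<partial>\<mu>) \<le> ennreal (kantorovich \<mu> \<nu> + \<epsilon>)"
proof -
  obtain T :: "'a \<Rightarrow> 'a" where T: "simple_function borel T"
    and T_close: "(\<integral>x. bdist x (T x) \<partial>\<mu>) \<le> \<epsilon> / 4" "(\<integral>x. bdist x (T x) \<partial>\<nu>) \<le> \<epsilon> / 4"
    using bdist_quantizer[OF \<mu> \<nu>, of "\<epsilon> / 4"] \<open>0 < \<epsilon>\<close> by auto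
  have T_borel [measurable]: "T \<in> borel \<rightarrow>\<^sub>M borel" by (rule borel_measurable_simple_function[OF T])
  interpret finite_transport "range T" "\<lambda>a. measure \<mu> (T -` {a})" "\<lambda>a. measure \<nu> (T -` {a})" bdist
    using simple_function_borelD(1)[OF T] sum_measure_fibres[OF \<mu> T] sum_measure_fibres[OF \<nu> T]
    by unfold_locales (auto intro: bdist_triangle)
  have "(\<Sum>a\<in>range T. f a * (measure \<mu> (T -` {a}) - measure \<nu> (T -` {a}))) \<le> kantorovich \<mu> \<nu> + \<epsilon> / 2"
    if "\<And>x y. f x - f y \<le> bdist x y" for f
    using quantized_integral_diff_le[OF \<mu> \<nu> T T_borel, of f] T_close that by (simp add: bLip_def)
  from finite_duality[OF this] obtain p where p: "\<And>z. 0 \<le> p z" "cost p \<le> kantorovich \<mu> \<nu> + \<epsilon> / 2"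
    "\<And>a. a \<in> range T \<Longrightarrow> row_sum p a = measure \<mu> (T -` {a}) \<and> col_sum p a = measure \<nu> (T -` {a})"
    by auto
  interpret quantized_plan \<mu> \<nu> T p
    using p by unfold_locales (auto simp: \<mu> \<nu> T row_sum_def col_sum_def)
  note coupling = identity_kernel_coupling[OF \<mu> plan_kernel_measurable]
  have quantized_cost: "(\<integral>\<^sup>+x. \<integral>\<^sup>+y. ennreal (bdist (T x) (T y)) \<partial>plan_kernel x \<partial>\<mu>) = ennreal (cost p)"
    unfolding cost_def by (rule nn_integral_plan_kernel_simple) simp
  have "(\<integral>\<^sup>+x. \<integral>\<^sup>+y. ennreal (bdist x y) \<partial>plan_kernel x \<partial>\<mu>)
      \<le> (\<integral>\<^sup>+x. \<integral>\<^sup>+y. ennreal (bdist (T x) (T y)) \<partial>plan_kernel x \<partial>\<mu>)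
        + ennreal ((\<integral>x. bdist x (T x) \<partial>\<mu>) + (\<integral>x. bdist x (T x) \<partial>\<nu>))"
    using nn_integral_bdist_quantized_le[OF coupling(1)[unfolded bind_plan_kernel] T_borel]
    by (simp add: coupling(2))
  also have "\<dots> \<le> ennreal (kantorovich \<mu> \<nu> + \<epsilon> / 2) + ennreal (\<epsilon> / 2)"
    unfolding quantized_cost using p(2) T_close by (intro add_mono ennreal_leI) simp_all
  also have "\<dots> = ennreal (kantorovich \<mu> \<nu> + \<epsilon>)"
    using kantorovich_nonneg[OF \<mu> \<nu>] \<open>0 < \<epsilon>\<close> by (simp flip: ennreal_plus)
  finally show ?thesis
    using plan_kernel_measurable bind_plan_kernel by blast
qed

theorem wasserstein_le_kantorovich:
  fixes \<mu> \<nu> :: "'a::{second_countable_topology, metric_space} measure"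
  assumes \<mu>: "\<mu> \<in> prob_measures" and \<nu>: "\<nu> \<in> prob_measures"
  shows "wasserstein bdist \<mu> \<nu> \<le> ennreal (kantorovich \<mu> \<nu>)"
proof (rule ennreal_le_epsilon)
  fix e :: real assume "0 < e"
  obtain \<kappa> where \<kappa>: "\<kappa> \<in> borel \<rightarrow>\<^sub>M prob_algebra borel" "\<mu> \<bind> \<kappa> = \<nu>"
    and cost: "(\<integral>\<^sup>+x. \<integral>\<^sup>+y. ennreal (bdist x y) \<partial>\<kappa> x \<partial>\<mu>) \<le> ennreal (kantorovich \<mu> \<nu> + e)"
    using kantorovich_kernel[OF \<mu> \<nu> \<open>0 < e\<close>] by blast
  note coupling = identity_kernel_coupling[OF \<mu> \<kappa>(1), unfolded \<kappa>(2)]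
  have "wasserstein bdist \<mu> \<nu> \<le> (\<integral>\<^sup>+z. ennreal (bdist (fst z) (snd z)) \<partial>kernel_coupling \<mu> (\<lambda>x. x) (\<lambda>x. x) \<kappa>)"
    unfolding wasserstein_def by (rule INF_lower[OF coupling(1)])
  also have "\<dots> \<le> ennreal (kantorovich \<mu> \<nu> + e)"
    using cost by (simp add: coupling(2))
  finally show "wasserstein bdist \<mu> \<nu> \<le> ennreal (kantorovich \<mu> \<nu>) + ennreal e"
    using kantorovich_nonneg[OF \<mu> \<nu>] \<open>0 < e\<close> by simp
qed

section \<open>Completeness of the Kantorovich distance\<close>

locale kernel_chain =
  fixes \<mu> :: "nat \<Rightarrow> 'a::topological_space measure" and \<kappa> :: "nat \<Rightarrow> 'a \<Rightarrow> 'a measure"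
  assumes marginals: "\<And>k. \<mu> k \<in> prob_measures"
    and kernels: "\<And>k. \<kappa> k \<in> borel \<rightarrow>\<^sub>M prob_algebra borel"
    and transport: "\<And>k. \<mu> k \<bind> \<kappa> k = \<mu> (Suc k)"
begin

definition transition :: "nat \<Rightarrow> (nat \<Rightarrow> 'a) \<Rightarrow> 'a measure" where
  "transition i \<omega> = (case i of 0 \<Rightarrow> \<mu> 0 | Suc j \<Rightarrow> \<kappa> j (\<omega> j))"

sublocale Ionescu_Tulcea transition "\<lambda>_. borel"
proof (rule Ionescu_Tulcea.intro)
  show "transition i \<in> PiM {0..<i} (\<lambda>_. borel) \<rightarrow>\<^sub>M subprob_algebra borel" for i
  proof (cases i)
    case 0
    then show ?thesis
      using marginals[of 0]
      by (simp add: transition_def[abs_def] in_prob_measures_iff space_subprob_algebra prob_space_imp_subprob_space)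
  next
    case (Suc j)
    have "(\<lambda>\<omega>. \<kappa> j (\<omega> j)) \<in> PiM {0..<i} (\<lambda>_. borel) \<rightarrow>\<^sub>M subprob_algebra borel"
      by (rule measurable_compose[OF _ measurable_prob_algebraD[OF kernels]]) (simp add: Suc)
    then show ?thesis by (simp add: transition_def[abs_def] Suc)
  qed
  show "prob_space (transition i \<omega>)" for i \<omega>
    using marginals measurable_space[OF kernels]
    by (cases i) (auto simp: transition_def in_prob_measures_iff space_prob_algebra)
qed

definition prefix_law :: "nat \<Rightarrow> (nat \<Rightarrow> 'a) measure" where
  "prefix_law n = C 0 n (\<lambda>_. undefined)"

lemma sets_prefix_law: "sets (prefix_law n) = sets (PiM {0..<n} (\<lambda>_. borel))"
  unfolding prefix_law_def by (subst sets_C) (auto simp: space_PiM)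

lemma nn_integral_prefix_law_Suc:
  assumes F: "F \<in> borel_measurable (PiM {0..<Suc n} (\<lambda>_. borel))"
  shows "(\<integral>\<^sup>+\<omega>. F \<omega> \<partial>prefix_law (Suc n)) = (\<integral>\<^sup>+\<omega>. \<integral>\<^sup>+y. F (fun_upd \<omega> n y) \<partial>transition n \<omega> \<partial>prefix_law n)"
proof -
  have "(\<integral>\<^sup>+\<omega>. F \<omega> \<partial>prefix_law (Suc n)) = (\<integral>\<^sup>+\<omega>. \<integral>\<^sup>+\<omega>'. F \<omega>' \<partial>eP n \<omega> \<partial>prefix_law n)"
    unfolding prefix_law_def C.simps add_0
    by (rule nn_integral_bind[OF F])
       (use measurable_eP[of n] in \<open>simp add: measurable_cong_sets[OF sets_prefix_law[unfolded prefix_law_def] refl]\<close>)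
  also have "\<dots> = (\<integral>\<^sup>+\<omega>. \<integral>\<^sup>+y. F (fun_upd \<omega> n y) \<partial>transition n \<omega> \<partial>prefix_law n)"
    by (intro nn_integral_cong nn_integral_eP F) (simp add: sets_eq_imp_space_eq[OF sets_prefix_law])
  finally show ?thesis .
qed

lemma nn_integral_prefix_law_last:
  assumes "f \<in> borel_measurable borel"
  shows "(\<integral>\<^sup>+\<omega>. f (\<omega> i) \<partial>prefix_law (Suc i)) = (\<integral>\<^sup>+x. f x \<partial>\<mu> i)"
  using assms
proof (induction i arbitrary: f)
  case 0
  note [measurable] = 0
  have "(\<integral>\<^sup>+\<omega>. f (\<omega> 0) \<partial>prefix_law (Suc 0)) = (\<integral>\<^sup>+\<omega>. \<integral>\<^sup>+y. f y \<partial>\<mu> 0 \<partial>prefix_law 0)"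
    by (subst nn_integral_prefix_law_Suc) (auto simp: transition_def)
  also have "\<dots> = (\<integral>\<^sup>+y. f y \<partial>\<mu> 0)"
    unfolding prefix_law_def C.simps by (subst nn_integral_return) (auto simp: space_PiM)
  finally show ?case .
next
  case (Suc i)
  note [measurable] = Suc.prems
  have "(\<integral>\<^sup>+\<omega>. f (\<omega> (Suc i)) \<partial>prefix_law (Suc (Suc i))) = (\<integral>\<^sup>+\<omega>. \<integral>\<^sup>+y. f y \<partial>\<kappa> i (\<omega> i) \<partial>prefix_law (Suc i))"
    by (subst nn_integral_prefix_law_Suc) (auto simp: transition_def)
  also have "\<dots> = (\<integral>\<^sup>+x. \<integral>\<^sup>+y. f y \<partial>\<kappa> i x \<partial>\<mu> i)"
    by (rule Suc.IH[OF nn_integral_kernel_measurable[OF kernels Suc.prems]])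
  also have "\<dots> = (\<integral>\<^sup>+y. f y \<partial>\<mu> (Suc i))"
    by (simp add: nn_integral_bind_kernel[OF marginals kernels Suc.prems, symmetric] transport)
  finally show ?case .
qed

definition path_law :: "(nat \<Rightarrow> 'a) measure" where
  "path_law = PF.lim"

lemma sets_path_law [measurable_cong]: "sets path_law = sets (PiM UNIV (\<lambda>_. borel))"
  by (simp add: path_law_def)

lemma CI_prefix_law:
  "CI {0..<n} = distr (prefix_law n) (PiM {0..<n} (\<lambda>_. borel)) (\<lambda>\<omega>. restrict \<omega> {0..<n})"
proof -
  have "up_to {0..<n} = n"
  proof (rule antisym)
    show "up_to {0..<n} \<le> n" by (simp add: up_to_iff)
    show "n \<le> up_to {0..<n}" using up_to_less[of "{0..<n}" "n - 1"] by (cases n) auto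
  qed
  then show ?thesis by (simp add: CI_def prefix_law_def)
qed

lemma nn_integral_path_law_restrict:
  assumes F [measurable]: "F \<in> borel_measurable (PiM {0..<n} (\<lambda>_. borel))"
  shows "(\<integral>\<^sup>+\<omega>. F (restrict \<omega> {0..<n}) \<partial>path_law) = (\<integral>\<^sup>+\<omega>. F (restrict \<omega> {0..<n}) \<partial>prefix_law n)"
proof -
  let ?R = "\<lambda>\<omega>. restrict \<omega> {0..<n}" and ?N = "PiM {0..<n} (\<lambda>_. borel :: 'a measure)"
  have "?R \<in> PiM UNIV (\<lambda>_. borel) \<rightarrow>\<^sub>M ?N" by (rule measurable_restrict_subset) auto
  then have path: "?R \<in> path_law \<rightarrow>\<^sub>M ?N" by (simp add: measurable_cong_sets[OF sets_path_law refl])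
  have "?R \<in> ?N \<rightarrow>\<^sub>M ?N" by (rule measurable_restrict_subset) auto
  then have law: "?R \<in> prefix_law n \<rightarrow>\<^sub>M ?N" by (simp add: measurable_cong_sets[OF sets_prefix_law refl])
  have "(\<integral>\<^sup>+\<omega>. F (?R \<omega>) \<partial>path_law) = (\<integral>\<^sup>+\<omega>. F \<omega> \<partial>distr path_law ?N ?R)"
    by (rule nn_integral_distr[OF path, symmetric]) simp
  also have "distr path_law ?N ?R = distr (prefix_law n) ?N ?R"
    by (simp add: path_law_def distr_lim CI_prefix_law)
  also have "(\<integral>\<^sup>+\<omega>. F \<omega> \<partial>distr (prefix_law n) ?N ?R) = (\<integral>\<^sup>+\<omega>. F (?R \<omega>) \<partial>prefix_law n)"
    by (rule nn_integral_distr[OF law]) simp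
  finally show ?thesis .
qed

lemma nn_integral_path_law:
  assumes F [measurable]: "F \<in> borel_measurable (borel \<Otimes>\<^sub>M borel)"
  shows "(\<integral>\<^sup>+\<omega>. F (\<omega> i, \<omega> (Suc i)) \<partial>path_law) = (\<integral>\<^sup>+x. \<integral>\<^sup>+y. F (x, y) \<partial>\<kappa> i x \<partial>\<mu> i)"
proof -
  note [measurable] = measurable_prob_algebraD[OF kernels]
  have "(\<integral>\<^sup>+\<omega>. F (\<omega> i, \<omega> (Suc i)) \<partial>path_law) = (\<integral>\<^sup>+\<omega>. F (\<omega> i, \<omega> (Suc i)) \<partial>prefix_law (Suc (Suc i)))"
    using nn_integral_path_law_restrict[of "\<lambda>\<omega>. F (\<omega> i, \<omega> (Suc i))" "Suc (Suc i)"] by simp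
  also have "\<dots> = (\<integral>\<^sup>+\<omega>. \<integral>\<^sup>+y. F (\<omega> i, y) \<partial>\<kappa> i (\<omega> i) \<partial>prefix_law (Suc i))"
    by (subst nn_integral_prefix_law_Suc) (auto simp: transition_def)
  also have "\<dots> = (\<integral>\<^sup>+x. \<integral>\<^sup>+y. F (x, y) \<partial>\<kappa> i x \<partial>\<mu> i)"
    by (rule nn_integral_prefix_law_last)
       (rule nn_integral_measurable_subprob_algebra2[where N=borel], measurable)
  finally show ?thesis .
qed

lemma distr_path_law: "distr path_law borel (\<lambda>\<omega>. \<omega> i) = \<mu> i"
proof (rule measure_eqI)
  show "sets (distr path_law borel (\<lambda>\<omega>. \<omega> i)) = sets (\<mu> i)"
    using marginals[of i] by (simp add: in_prob_measures_iff)
  fix A assume "A \<in> sets (distr path_law borel (\<lambda>\<omega>. \<omega> i))"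
  then have [measurable]: "A \<in> sets borel" by simp
  have "prob_space (\<kappa> i x)" for x
    using measurable_space[OF kernels, of x] by (simp add: space_prob_algebra)
  then have "(\<integral>\<^sup>+\<omega>. indicator A (\<omega> i) \<partial>path_law) = (\<integral>\<^sup>+x. indicator A x \<partial>\<mu> i)"
    using nn_integral_path_law[of "\<lambda>z. indicator A (fst z)" i] by (simp add: prob_space.emeasure_space_1)
  moreover have "(\<integral>\<^sup>+x. indicator A x \<partial>distr path_law borel (\<lambda>\<omega>. \<omega> i)) = (\<integral>\<^sup>+\<omega>. indicator A (\<omega> i) \<partial>path_law)"
    by (rule nn_integral_distr) measurable
  ultimately show "emeasure (distr path_law borel (\<lambda>\<omega>. \<omega> i)) A = emeasure (\<mu> i) A"
    using marginals[of i] by (simp add: in_prob_measures_iff)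
qed

lemma prob_space_path_law: "prob_space path_law"
proof -
  have "prob_space (distr path_law borel (\<lambda>\<omega>. \<omega> 0))"
    using marginals[of 0] by (simp add: distr_path_law in_prob_measures_iff)
  then show ?thesis by (rule prob_space_distrD[rotated]) simp
qed

end

lemma bdist_le_sum: "bdist (z m) (z (m + n)) \<le> (\<Sum>i<n. bdist (z (m + i)) (z (m + Suc i)))"
proof (induction n)
  case (Suc n)
  then show ?case using bdist_triangle[of "z m" "z (m + Suc n)" "z (m + n)"] by simp
qed simp

lemma summable_bdist_Cauchy:
  assumes "summable (\<lambda>i. bdist (z i) (z (Suc i)))"
  shows "Cauchy z"
proof (rule CauchyI')
  fix e :: real assume "0 < e"
  then have "0 < min e 1" by simp
  then obtain N where N: "\<And>m n. N \<le> m \<Longrightarrow> norm (\<Sum>i\<in>{m..<n}. bdist (z i) (z (Suc i))) < min e 1"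
    using assms unfolding summable_Cauchy by blast
  have "dist (z m) (z n) < e" if "N \<le> m" "m < n" for m n
  proof -
    obtain j where n: "n = m + j" using \<open>m < n\<close> less_imp_add_positive by blast
    have "bdist (z m) (z (m + j)) \<le> (\<Sum>i<j. bdist (z (m + i)) (z (m + Suc i)))" by (rule bdist_le_sum)
    also have "\<dots> = (\<Sum>i\<in>{m..<m+j}. bdist (z i) (z (Suc i)))"
      using sum.shift_bounds_nat_ivl[of "\<lambda>i. bdist (z i) (z (Suc i))" 0 m j]
      by (simp add: lessThan_atLeast0 add.commute)
    also have "\<dots> < min e 1" using N[OF \<open>N \<le> m\<close>, of "m + j"] unfolding real_norm_def by linarith
    finally show ?thesis by (auto simp: bdist_def n min_def split: if_splits)
  qed
  then show "\<exists>M. \<forall>m\<ge>M. \<forall>n>m. dist (z m) (z n) < e" by blast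
qed

lemma AE_Cauchy_imp_limit:
  fixes X :: "nat \<Rightarrow> 'w \<Rightarrow> 'a::polish_space"
  assumes X [measurable]: "\<And>i. X i \<in> M \<rightarrow>\<^sub>M borel" and Cauchy: "AE \<omega> in M. Cauchy (\<lambda>i. X i \<omega>)"
  obtains Z where "Z \<in> M \<rightarrow>\<^sub>M borel" "AE \<omega> in M. (\<lambda>i. X i \<omega>) \<longlonglongrightarrow> Z \<omega>"
proof
  define Y where "Y i \<omega> = (if Cauchy (\<lambda>i. X i \<omega>) then X i \<omega> else undefined)" for i \<omega>
  have "Cauchy (\<lambda>i. Y i \<omega>)" for \<omega>
    by (cases "Cauchy (\<lambda>i. X i \<omega>)") (simp_all add: Y_def LIMSEQ_imp_Cauchy[OF tendsto_const])
  then have limit: "(\<lambda>i. Y i \<omega>) \<longlonglongrightarrow> lim (\<lambda>i. Y i \<omega>)" for \<omega>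
    using Cauchy_convergent convergent_LIMSEQ_iff by blast
  have "Y i \<in> M \<rightarrow>\<^sub>M borel" for i unfolding Y_def by measurable
  then show "(\<lambda>\<omega>. lim (\<lambda>i. Y i \<omega>)) \<in> M \<rightarrow>\<^sub>M borel"
    by (rule borel_measurable_LIMSEQ_metric) (rule limit)
  show "AE \<omega> in M. (\<lambda>i. X i \<omega>) \<longlonglongrightarrow> lim (\<lambda>i. Y i \<omega>)"
    using Cauchy
  proof eventually_elim
    case (elim \<omega>)
    then have "Y i \<omega> = X i \<omega>" for i by (simp add: Y_def)
    then show ?case using limit[of \<omega>] by simp
  qed
qed

definition weakly_converges :: "(nat \<Rightarrow> 'a::topological_space measure) \<Rightarrow> 'a measure \<Rightarrow> bool" where
  "weakly_converges \<mu> \<pi> \<longleftrightarrow> (\<forall>g::'a \<Rightarrow> real. continuous_on UNIV g \<longrightarrow> bounded (range g) \<longrightarrow>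
     (\<lambda>k. \<integral>x. g x \<partial>\<mu> k) \<longlonglongrightarrow> (\<integral>x. g x \<partial>\<pi>))"

lemma weakly_converges_distr:
  fixes X :: "nat \<Rightarrow> 'w \<Rightarrow> 'a::metric_space"
  assumes "prob_space M" and X [measurable]: "\<And>i. X i \<in> M \<rightarrow>\<^sub>M borel" and Z [measurable]: "Z \<in> M \<rightarrow>\<^sub>M borel"
    and limit: "AE \<omega> in M. (\<lambda>i. X i \<omega>) \<longlonglongrightarrow> Z \<omega>"
  shows "weakly_converges (\<lambda>i. distr M borel (X i)) (distr M borel Z)"
  unfolding weakly_converges_def
proof (intro allI impI)
  fix g :: "'a \<Rightarrow> real" assume g: "continuous_on UNIV g" "bounded (range g)"
  interpret prob_space M by fact
  have [measurable]: "g \<in> borel_measurable borel" using g(1) by (rule borel_measurable_continuous_onI)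
  obtain B where B: "\<And>x. \<bar>g x\<bar> \<le> B" using g(2) by (auto simp: bounded_iff)
  have "(\<lambda>i. \<integral>\<omega>. g (X i \<omega>) \<partial>M) \<longlonglongrightarrow> (\<integral>\<omega>. g (Z \<omega>) \<partial>M)"
  proof (rule integral_dominated_convergence[where w="\<lambda>_. B"])
    show "AE \<omega> in M. (\<lambda>i. g (X i \<omega>)) \<longlonglongrightarrow> g (Z \<omega>)"
      using limit by eventually_elim (rule continuous_on_tendsto_compose[OF g(1)], auto)
  qed (auto simp: B)
  then show "(\<lambda>i. \<integral>x. g x \<partial>distr M borel (X i)) \<longlonglongrightarrow> (\<integral>x. g x \<partial>distr M borel Z)"
    by (simp add: integral_distr)
qed

theorem kantorovich_complete:
  fixes \<mu> :: "nat \<Rightarrow> 'a::polish_space measure"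
  assumes \<mu>: "\<And>k. \<mu> k \<in> prob_measures" and summable: "summable (\<lambda>k. kantorovich (\<mu> k) (\<mu> (Suc k)))"
  obtains \<pi> where "\<pi> \<in> prob_measures" "weakly_converges \<mu> \<pi>"
proof -
  have "\<exists>\<kappa>. \<kappa> \<in> borel \<rightarrow>\<^sub>M prob_algebra borel \<and> \<mu> k \<bind> \<kappa> = \<mu> (Suc k) \<and>
    (\<integral>\<^sup>+x. \<integral>\<^sup>+y. ennreal (bdist x y) \<partial>\<kappa> x \<partial>\<mu> k) \<le> ennreal (kantorovich (\<mu> k) (\<mu> (Suc k)) + (1 / 2) ^ k)" for k
    by (rule kantorovich_kernel[OF \<mu> \<mu>]) simp
  then obtain \<kappa> where \<kappa>: "\<And>k. \<kappa> k \<in> borel \<rightarrow>\<^sub>M prob_algebra borel" "\<And>k. \<mu> k \<bind> \<kappa> k = \<mu> (Suc k)"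
    and cost: "\<And>k. (\<integral>\<^sup>+x. \<integral>\<^sup>+y. ennreal (bdist x y) \<partial>\<kappa> k x \<partial>\<mu> k)
      \<le> ennreal (kantorovich (\<mu> k) (\<mu> (Suc k)) + (1 / 2) ^ k)"
    by metis
  interpret kernel_chain \<mu> \<kappa> by unfold_locales (fact \<mu> \<kappa>)+
  have bound_nonneg: "0 \<le> kantorovich (\<mu> k) (\<mu> (Suc k)) + (1 / 2) ^ k" for k
    using kantorovich_nonneg[OF \<mu> \<mu>] by simp
  have "(\<integral>\<^sup>+\<omega>. (\<Sum>i. ennreal (bdist (\<omega> i) (\<omega> (Suc i)))) \<partial>path_law)
      = (\<Sum>i. \<integral>\<^sup>+\<omega>. ennreal (bdist (\<omega> i) (\<omega> (Suc i))) \<partial>path_law)"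
    by (rule nn_integral_suminf) measurable
  also have "\<dots> \<le> (\<Sum>i. ennreal (kantorovich (\<mu> i) (\<mu> (Suc i)) + (1 / 2) ^ i))"
    using nn_integral_path_law[of "\<lambda>z. ennreal (bdist (fst z) (snd z))"] cost by (intro suminf_le) auto
  also have "\<dots> < \<infinity>"
    using bound_nonneg by (subst suminf_ennreal2) (auto intro!: summable_add summable summable_geometric)
  finally have "AE \<omega> in path_law. (\<Sum>i. ennreal (bdist (\<omega> i) (\<omega> (Suc i)))) \<noteq> \<infinity>"
    by (intro nn_integral_PInf_AE) auto
  then have "AE \<omega> in path_law. Cauchy \<omega>"
    by eventually_elim (auto intro!: summable_bdist_Cauchy summable_suminf_not_top)
  then obtain Z where Z: "Z \<in> path_law \<rightarrow>\<^sub>M borel" "AE \<omega> in path_law. \<omega> \<longlonglongrightarrow> Z \<omega>"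
    using AE_Cauchy_imp_limit[of "\<lambda>i \<omega>. \<omega> i" path_law] by auto
  have "weakly_converges \<mu> (distr path_law borel Z)"
    using weakly_converges_distr[OF prob_space_path_law, of "\<lambda>i \<omega>. \<omega> i" Z] Z by (simp add: distr_path_law)
  moreover have "distr path_law borel Z \<in> prob_measures"
    using prob_space.prob_space_distr[OF prob_space_path_law Z(1)] by (simp add: in_prob_measures_iff)
  ultimately show ?thesis using that by blast
qed

section \<open>Contraction of the Kantorovich distance along couplings\<close>

lemma Youngs_inequality_powr:
  fixes a b q :: real
  assumes "0 \<le> a" "0 \<le> b" "0 < q" "q < 1"
  shows "a powr (1 - q) * b powr q \<le> (1 - q) * a + q * b"
proof (cases "a = 0 \<or> b = 0")
  case False
  then show ?thesis using assms by (intro Youngs_inequality_0) auto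
qed (use assms in auto)

context
  fixes f g :: "'a \<Rightarrow> real" and M :: "'a measure" and q :: real
  assumes f: "integrable M f" "\<And>x. 0 \<le> f x" and g: "integrable M g" "\<And>x. 0 \<le> g x" and q: "0 < q" "q < 1"
begin

lemma integrable_powr_mult: "integrable M (\<lambda>x. f x powr (1 - q) * g x powr q)"
proof (rule Bochner_Integration.integrable_bound)
  show "integrable M (\<lambda>x. (1 - q) * f x + q * g x)" using f g by simp
  have [measurable]: "f \<in> borel_measurable M" "g \<in> borel_measurable M" using f g by auto
  show "(\<lambda>x. f x powr (1 - q) * g x powr q) \<in> borel_measurable M" by measurable
  have "norm (f x powr (1 - q) * g x powr q) \<le> norm ((1 - q) * f x + q * g x)" for x
  proof -
    have "0 \<le> f x powr (1 - q) * g x powr q" by simp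
    with Youngs_inequality_powr[OF f(2) g(2) q, of x x] show ?thesis
      unfolding real_norm_def by linarith
  qed
  then show "AE x in M. norm (f x powr (1 - q) * g x powr q) \<le> norm ((1 - q) * f x + q * g x)" by simp
qed

lemma Hoelder_powr:
  "(\<integral>x. f x powr (1 - q) * g x powr q \<partial>M) \<le> (\<integral>x. f x \<partial>M) powr (1 - q) * (\<integral>x. g x \<partial>M) powr q"
proof (cases "(\<integral>x. f x \<partial>M) = 0 \<or> (\<integral>x. g x \<partial>M) = 0")
  case True
  then have "AE x in M. f x powr (1 - q) * g x powr q = 0"
    using f g integral_nonneg_eq_0_iff_AE[of M f] integral_nonneg_eq_0_iff_AE[of M g] by auto
  then have "(\<integral>x. f x powr (1 - q) * g x powr q \<partial>M) = 0" by (rule integral_eq_zero_AE)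
  then show ?thesis by simp
next
  case False
  define A B where "A = (\<integral>x. f x \<partial>M)" and "B = (\<integral>x. g x \<partial>M)"
  have pos: "0 < A" "0 < B"
    using False f(2) g(2) by (auto simp: A_def B_def less_le integral_nonneg_AE)
  have "f x powr (1 - q) * g x powr q \<le> A powr (1 - q) * B powr q * ((1 - q) * (f x / A) + q * (g x / B))" for x
  proof -
    have "A powr (1 - q) * B powr q * ((f x / A) powr (1 - q) * (g x / B) powr q) = f x powr (1 - q) * g x powr q"
      using pos f(2) g(2) by (simp add: powr_divide)
    moreover have "(f x / A) powr (1 - q) * (g x / B) powr q \<le> (1 - q) * (f x / A) + q * (g x / B)"
      using pos f(2) g(2) q by (intro Youngs_inequality_powr) auto
    ultimately show ?thesis by (metis mult_left_mono mult_nonneg_nonneg powr_ge_zero)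
  qed
  then have "(\<integral>x. f x powr (1 - q) * g x powr q \<partial>M)
      \<le> (\<integral>x. A powr (1 - q) * B powr q * ((1 - q) * (f x / A) + q * (g x / B)) \<partial>M)"
    using integrable_powr_mult f g by (intro integral_mono) auto
  also have "\<dots> = A powr (1 - q) * B powr q"
    using f g pos by (simp add: A_def[symmetric] B_def[symmetric])
  finally show ?thesis by (simp add: A_def B_def)
qed

end

lemma kantorovich_bind_Hoelder:
  fixes \<kappa> :: "'b::topological_space \<Rightarrow> 'a::metric_space measure" and d :: "'b \<Rightarrow> 'b \<Rightarrow> real"
  assumes coupling: "c \<in> couplings \<mu> \<nu>" and \<kappa>: "\<kappa> \<in> borel \<rightarrow>\<^sub>M prob_algebra borel"
    and d: "integrable c (\<lambda>z. d (fst z) (snd z))" "\<And>x y. 0 \<le> d x y"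
    and J: "J \<in> borel_measurable borel" "integrable \<mu> J" "integrable \<nu> J" "\<And>x. 0 \<le> J x"
    and bound: "\<And>x y. kantorovich (\<kappa> x) (\<kappa> y) \<le> C * (d x y powr (1 - q) * (J x + J y) powr q)"
    and "0 \<le> C" and q: "0 < q" "q < 1"
  shows "kantorovich (\<mu> \<bind> \<kappa>) (\<nu> \<bind> \<kappa>)
    \<le> C * ((\<integral>z. d (fst z) (snd z) \<partial>c) powr (1 - q) * ((\<integral>x. J x \<partial>\<mu>) + (\<integral>x. J x \<partial>\<nu>)) powr q)"
proof -
  note [measurable_cong] = couplingsD(2)[OF coupling]
  have J_sum: "integrable c (\<lambda>z. J (fst z) + J (snd z))"
    "(\<integral>z. J (fst z) + J (snd z) \<partial>c) = (\<integral>x. J x \<partial>\<mu>) + (\<integral>x. J x \<partial>\<nu>)"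
    using J by (simp_all add: coupling_integral[OF coupling])
  have J_sum_nonneg: "0 \<le> J (fst z) + J (snd z)" for z using J(4) by simp
  note Hoelder = integrable_powr_mult[OF d(1) d(2) J_sum(1) J_sum_nonneg q]
    Hoelder_powr[OF d(1) d(2) J_sum(1) J_sum_nonneg q, unfolded J_sum(2)]
  have "kantorovich (\<mu> \<bind> \<kappa>) (\<nu> \<bind> \<kappa>) \<le> (\<integral>z. C * (d (fst z) (snd z) powr (1 - q) * (J (fst z) + J (snd z)) powr q) \<partial>c)"
    using Hoelder(1) bound by (intro kantorovich_bind_le[OF coupling \<kappa>]) auto
  also have "\<dots> \<le> C * ((\<integral>z. d (fst z) (snd z) \<partial>c) powr (1 - q) * ((\<integral>x. J x \<partial>\<mu>) + (\<integral>x. J x \<partial>\<nu>)) powr q)"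
    using Hoelder(2) \<open>0 \<le> C\<close> by (simp add: mult_left_mono)
  finally show ?thesis .
qed

lemma kantorovich_bind_powr_le:
  fixes \<kappa> :: "'b::topological_space \<Rightarrow> 'a::metric_space measure"
  assumes \<mu>: "\<mu> \<in> prob_measures" and \<nu>: "\<nu> \<in> prob_measures" and \<kappa>: "\<kappa> \<in> borel \<rightarrow>\<^sub>M prob_algebra borel"
    and J: "J \<in> borel_measurable borel" "integrable \<mu> J" "integrable \<nu> J" "\<And>x. 0 \<le> J x"
    and bound: "\<And>x y. kantorovich (\<kappa> x) (\<kappa> y) \<le> C * (J x + J y) powr q"
    and C: "0 \<le> C" and q: "0 < q" "q < 1"
  shows "kantorovich (\<mu> \<bind> \<kappa>) (\<nu> \<bind> \<kappa>) \<le> C * ((\<integral>x. J x \<partial>\<mu>) + (\<integral>x. J x \<partial>\<nu>)) powr q"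
proof -
  note coupling = product_coupling[OF \<mu> \<nu>]
  interpret prob_space "\<mu> \<Otimes>\<^sub>M \<nu>" by (rule couplingsD(3)[OF coupling])
  show ?thesis
    using kantorovich_bind_Hoelder[OF coupling \<kappa> _ _ J, of "\<lambda>_ _. 1" C q] bound C q by (simp add: prob_space)
qed

lemma kantorovich_bind_wasserstein_le:
  fixes \<kappa> :: "'b::topological_space \<Rightarrow> 'a::metric_space measure" and d :: "'b \<Rightarrow> 'b \<Rightarrow> real"
  assumes W: "wasserstein d \<mu> \<nu> \<le> ennreal A" and "0 \<le> A" and \<kappa>: "\<kappa> \<in> borel \<rightarrow>\<^sub>M prob_algebra borel"
    and d: "(\<lambda>z. d (fst z) (snd z)) \<in> borel_measurable (borel \<Otimes>\<^sub>M borel)" "\<And>x y. 0 \<le> d x y"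
    and J: "J \<in> borel_measurable borel" "integrable \<mu> J" "integrable \<nu> J" "\<And>x. 0 \<le> J x"
    and J_le: "(\<integral>x. J x \<partial>\<mu>) + (\<integral>x. J x \<partial>\<nu>) \<le> B"
    and bound: "\<And>x y. kantorovich (\<kappa> x) (\<kappa> y) \<le> d x y powr (1 - q) * (J x + J y) powr q"
    and q: "0 < q" "q < 1"
  shows "kantorovich (\<mu> \<bind> \<kappa>) (\<nu> \<bind> \<kappa>) \<le> A powr (1 - q) * B powr q"
proof (rule tendsto_lowerbound)
  show "((\<lambda>e. (A + e) powr (1 - q) * B powr q) \<longlongrightarrow> A powr (1 - q) * B powr q) (at_right 0)"
    using \<open>0 \<le> A\<close> q eventually_at_right_less[of "0::real"]
    by (auto intro!: tendsto_eq_intros elim!: eventually_mono)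
  show "\<forall>\<^sub>F e in at_right 0. kantorovich (\<mu> \<bind> \<kappa>) (\<nu> \<bind> \<kappa>) \<le> (A + e) powr (1 - q) * B powr q"
    using eventually_at_right_less
  proof eventually_elim
    case (elim e)
    have "ennreal A < ennreal (A + e)" using elim \<open>0 \<le> A\<close> by (simp add: ennreal_less_iff)
    then have "wasserstein d \<mu> \<nu> < ennreal (A + e)" by (rule le_less_trans[OF W])
    then obtain c where coupling: "c \<in> couplings \<mu> \<nu>" "(\<integral>\<^sup>+z. ennreal (d (fst z) (snd z)) \<partial>c) < ennreal (A + e)"
      unfolding wasserstein_def INF_less_iff by blast
    note [measurable_cong] = couplingsD(2)[OF coupling(1)] and [measurable] = d(1)
    have d_integrable: "integrable c (\<lambda>z. d (fst z) (snd z))"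
      using coupling(2) d(2) by (intro integrableI_bounded) (auto intro: less_trans)
    have "ennreal (\<integral>z. d (fst z) (snd z) \<partial>c) < ennreal (A + e)"
      using coupling(2) nn_integral_eq_integral[OF d_integrable] d(2) by simp
    then have d_le: "(\<integral>z. d (fst z) (snd z) \<partial>c) \<le> A + e"
      using d(2) by (simp add: ennreal_less_iff integral_nonneg_AE)
    have "kantorovich (\<mu> \<bind> \<kappa>) (\<nu> \<bind> \<kappa>)
        \<le> (\<integral>z. d (fst z) (snd z) \<partial>c) powr (1 - q) * ((\<integral>x. J x \<partial>\<mu>) + (\<integral>x. J x \<partial>\<nu>)) powr q"
      using kantorovich_bind_Hoelder[OF coupling(1) \<kappa> d_integrable d(2) J, of 1 q] bound q by simp
    also have "\<dots> \<le> (A + e) powr (1 - q) * B powr q"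
      using d_le J_le q d(2) J(4) by (intro mult_mono powr_mono2) (auto simp: integral_nonneg_AE add_nonneg_nonneg)
    finally show ?case .
  qed
qed simp

section \<open>Couplings realising the total variation distance\<close>

definition mixture :: "real \<Rightarrow> 'a measure \<Rightarrow> 'a measure \<Rightarrow> 'a measure" where
  "mixture r \<mu> \<nu> = measure_pmf (bernoulli_pmf r) \<bind> (\<lambda>b. if b then \<mu> else \<nu>)"

context
  fixes M :: "'a measure" and \<mu> \<nu>
  assumes \<mu>: "\<mu> \<in> space (prob_algebra M)" and \<nu>: "\<nu> \<in> space (prob_algebra M)"
begin

lemma mixture_kernel: "(\<lambda>b. if b then \<mu> else \<nu>) \<in> count_space UNIV \<rightarrow>\<^sub>M prob_algebra M"
  using \<mu> \<nu> by simp

lemma mixture_in_prob_algebra: "mixture r \<mu> \<nu> \<in> space (prob_algebra M)"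
  unfolding mixture_def by (rule bind_in_prob_algebra[OF pmf_in_prob_algebra mixture_kernel])

lemma nn_integral_mixture:
  assumes "f \<in> borel_measurable M" "0 \<le> r" "r \<le> 1"
  shows "(\<integral>\<^sup>+x. f x \<partial>mixture r \<mu> \<nu>) = ennreal r * (\<integral>\<^sup>+x. f x \<partial>\<mu>) + ennreal (1 - r) * (\<integral>\<^sup>+x. f x \<partial>\<nu>)"
  unfolding mixture_def nn_integral_bind_kernel[OF pmf_in_prob_algebra mixture_kernel assms(1)]
  using assms(2,3) by (simp add: mult.commute)

lemma emeasure_mixture:
  assumes "A \<in> sets M" "0 \<le> r" "r \<le> 1"
  shows "emeasure (mixture r \<mu> \<nu>) A = ennreal r * emeasure \<mu> A + ennreal (1 - r) * emeasure \<nu> A"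
proof -
  have "A \<in> sets (mixture r \<mu> \<nu>)" "A \<in> sets \<mu>" "A \<in> sets \<nu>"
    using mixture_in_prob_algebra \<mu> \<nu> assms(1) by (auto simp: space_prob_algebra)
  then show ?thesis
    using nn_integral_mixture[of "indicator A" r] assms by simp
qed

end

lemma absolutely_continuous_density:
  assumes "\<sigma> \<in> space (prob_algebra M)" "\<mu> \<in> space (prob_algebra M)" "absolutely_continuous \<sigma> \<mu>"
  shows "\<exists>f. f \<in> borel_measurable M \<and> (\<forall>x. 0 \<le> (f x :: real)) \<and> density \<sigma> (\<lambda>x. ennreal (f x)) = \<mu>"
proof -
  interpret \<sigma>: prob_space \<sigma> using assms(1) by (simp add: space_prob_algebra)
  interpret \<mu>: prob_space \<mu> using assms(2) by (simp add: space_prob_algebra)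
  have sets: "sets \<mu> = sets \<sigma>" "sets \<sigma> = sets M" using assms(1,2) by (auto simp: space_prob_algebra)
  obtain f where f: "f \<in> borel_measurable \<sigma>" "AE x in \<sigma>. RN_deriv \<sigma> \<mu> x = ennreal (f x)" "\<And>x. 0 \<le> f x"
    using \<sigma>.real_RN_deriv[OF \<mu>.finite_measure_axioms assms(3) sets(1)] by metis
  have "density \<sigma> (\<lambda>x. ennreal (f x)) = density \<sigma> (RN_deriv \<sigma> \<mu>)"
    using f by (intro density_cong) auto
  also have "\<dots> = \<mu>" by (rule \<sigma>.density_RN_deriv[OF assms(3) sets(1)])
  finally show ?thesis
    using f(1,3) by (auto simp: measurable_cong_sets[OF sets(2) refl])
qed

lemma common_density:
  assumes \<mu>: "\<mu> \<in> space (prob_algebra M)" and \<nu>: "\<nu> \<in> space (prob_algebra M)"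
  obtains \<sigma> a b where "sets \<sigma> = sets M" "a \<in> borel_measurable M" "b \<in> borel_measurable M"
    "\<And>x. 0 \<le> (a x :: real)" "\<And>x. 0 \<le> (b x :: real)"
    "density \<sigma> (\<lambda>x. ennreal (a x)) = \<mu>" "density \<sigma> (\<lambda>x. ennreal (b x)) = \<nu>"
proof -
  let ?\<sigma> = "mixture (1 / 2) \<mu> \<nu>"
  note \<sigma> = mixture_in_prob_algebra[OF \<mu> \<nu>, of "1 / 2"]
  have "absolutely_continuous ?\<sigma> \<mu>" "absolutely_continuous ?\<sigma> \<nu>"
    using \<sigma> \<mu> \<nu> by (auto simp: absolutely_continuous_def null_sets_def space_prob_algebra emeasure_mixture[OF \<mu> \<nu>])
  from absolutely_continuous_density[OF \<sigma> \<mu> this(1)] absolutely_continuous_density[OF \<sigma> \<nu> this(2)]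
  obtain a b where "a \<in> borel_measurable M" "b \<in> borel_measurable M"
    "\<And>x. 0 \<le> (a x :: real)" "\<And>x. 0 \<le> (b x :: real)"
    "density ?\<sigma> (\<lambda>x. ennreal (a x)) = \<mu>" "density ?\<sigma> (\<lambda>x. ennreal (b x)) = \<nu>"
    by blast
  moreover have "sets ?\<sigma> = sets M" using \<sigma> by (simp add: space_prob_algebra)
  ultimately show ?thesis by (rule that[rotated])
qed

lemma measure_diff_le_dTV:
  assumes "prob_space \<mu>" "prob_space \<nu>" "A \<in> sets \<mu>"
  shows "measure \<mu> A - measure \<nu> A \<le> dTV \<mu> \<nu>"
proof -
  have "bdd_above ((\<lambda>A. \<bar>measure \<mu> A - measure \<nu> A\<bar>) ` sets \<mu>)"
  proof (rule bdd_aboveI2)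
    show "\<bar>measure \<mu> B - measure \<nu> B\<bar> \<le> 1" for B
      using prob_space.prob_le_1[OF assms(1), of B] prob_space.prob_le_1[OF assms(2), of B]
        measure_nonneg[of \<mu> B] measure_nonneg[of \<nu> B] by linarith
  qed
  then have "\<bar>measure \<mu> A - measure \<nu> A\<bar> \<le> dTV \<mu> \<nu>"
    unfolding dTV_def by (intro cSUP_upper assms(3))
  then show ?thesis by linarith
qed

(* Keeping a point x drawn from density a with probability acceptance x, and redrawing it from the residual
   measure otherwise, produces density b; the probability of redrawing is the total variation distance. *)
locale density_pair =
  fixes \<sigma> :: "'a measure" and a b :: "'a \<Rightarrow> real"
  assumes a_measurable [measurable]: "a \<in> borel_measurable \<sigma>" and a_nonneg: "\<And>x. 0 \<le> a x"
    and b_measurable [measurable]: "b \<in> borel_measurable \<sigma>" and b_nonneg: "\<And>x. 0 \<le> b x"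
    and prob_a: "prob_space (density \<sigma> (\<lambda>x. ennreal (a x)))"
    and prob_b: "prob_space (density \<sigma> (\<lambda>x. ennreal (b x)))"
begin

definition overlap :: "'a \<Rightarrow> real" where
  "overlap x = min (a x) (b x)"

definition acceptance :: "'a \<Rightarrow> real" where
  "acceptance x = (if a x \<le> b x then 1 else b x / a x)"

definition deficit :: ennreal where
  "deficit = (\<integral>\<^sup>+x. ennreal (b x - overlap x) \<partial>\<sigma>)"

definition residual :: "'a measure" where
  "residual = (if deficit = 0 then density \<sigma> (\<lambda>x. ennreal (b x))
    else density \<sigma> (\<lambda>x. ennreal (b x - overlap x) / deficit))"

lemma overlap_measurable [measurable]: "overlap \<in> borel_measurable \<sigma>"
  unfolding overlap_def by measurable

lemma acceptance_measurable [measurable]: "acceptance \<in> borel_measurable \<sigma>"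
  unfolding acceptance_def by measurable

lemma overlap_bounds: "0 \<le> overlap x" "overlap x \<le> a x" "overlap x \<le> b x"
  using a_nonneg b_nonneg by (auto simp: overlap_def)

lemma acceptance_bounds: "0 \<le> acceptance x" "acceptance x \<le> 1"
  using a_nonneg[of x] b_nonneg[of x] by (auto simp: acceptance_def divide_simps)

lemma a_mult_acceptance: "a x * acceptance x = overlap x"
  using a_nonneg[of x] b_nonneg[of x] by (auto simp: acceptance_def overlap_def)

lemma total_mass: "(\<integral>\<^sup>+x. ennreal (a x) \<partial>\<sigma>) = 1" "(\<integral>\<^sup>+x. ennreal (b x) \<partial>\<sigma>) = 1"
  using prob_space.emeasure_space_1[OF prob_a] prob_space.emeasure_space_1[OF prob_b]
  by (simp_all add: emeasure_density)

lemma nn_integral_minus_overlap: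
  assumes [measurable]: "f \<in> borel_measurable \<sigma>" and "\<And>x. overlap x \<le> f x"
  shows "(\<integral>\<^sup>+x. ennreal (f x) \<partial>\<sigma>) = (\<integral>\<^sup>+x. ennreal (overlap x) \<partial>\<sigma>) + (\<integral>\<^sup>+x. ennreal (f x - overlap x) \<partial>\<sigma>)"
  using assms(2) overlap_bounds(1) by (subst nn_integral_add[symmetric]) (auto simp flip: ennreal_plus)

lemma deficit_le_1: "deficit \<le> 1"
  unfolding deficit_def total_mass(2)[symmetric] using overlap_bounds(1)
  by (intro nn_integral_mono ennreal_leI) simp

lemma deficit_swap: "(\<integral>\<^sup>+x. ennreal (a x - overlap x) \<partial>\<sigma>) = deficit"
proof -
  have "(\<integral>\<^sup>+x. ennreal (overlap x) \<partial>\<sigma>) \<le> 1"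
    unfolding total_mass(1)[symmetric] by (intro nn_integral_mono ennreal_leI overlap_bounds)
  then show ?thesis
    using nn_integral_minus_overlap[of a] nn_integral_minus_overlap[of b] overlap_bounds total_mass
    unfolding deficit_def
    by (metis a_measurable b_measurable ennreal_add_left_cancel ennreal_one_less_top infinity_ennreal_def leD)
qed

lemma nn_integral_rejection: "(\<integral>\<^sup>+x. ennreal (1 - acceptance x) \<partial>density \<sigma> (\<lambda>x. ennreal (a x))) = deficit"
proof -
  have "(\<integral>\<^sup>+x. ennreal (1 - acceptance x) \<partial>density \<sigma> (\<lambda>x. ennreal (a x)))
      = (\<integral>\<^sup>+x. ennreal (a x) * ennreal (1 - acceptance x) \<partial>\<sigma>)"
    by (rule nn_integral_density) measurable
  also have "\<dots> = (\<integral>\<^sup>+x. ennreal (a x - overlap x) \<partial>\<sigma>)"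
    using a_nonneg acceptance_bounds
    by (intro nn_integral_cong) (simp add: right_diff_distrib a_mult_acceptance flip: ennreal_mult)
  finally show ?thesis by (simp add: deficit_swap)
qed

lemma deficit_le_dTV:
  "deficit \<le> ennreal (dTV (density \<sigma> (\<lambda>x. ennreal (a x))) (density \<sigma> (\<lambda>x. ennreal (b x))))"
proof -
  interpret a: prob_space "density \<sigma> (\<lambda>x. ennreal (a x))" by (rule prob_a)
  interpret b: prob_space "density \<sigma> (\<lambda>x. ennreal (b x))" by (rule prob_b)
  define S where "S = {x \<in> space \<sigma>. b x < a x}"
  have S [measurable]: "S \<in> sets \<sigma>" unfolding S_def by measurable
  have "a.prob S = (\<integral>\<^sup>+x. ennreal (a x) * indicator S x \<partial>\<sigma>)"
    by (simp add: emeasure_density flip: a.emeasure_eq_measure)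
  also have "\<dots> = (\<integral>\<^sup>+x. ennreal (b x) * indicator S x + ennreal (a x - overlap x) \<partial>\<sigma>)"
    using b_nonneg by (intro nn_integral_cong)
      (auto simp: S_def overlap_def min_def split: split_indicator simp flip: ennreal_plus)
  also have "\<dots> = (\<integral>\<^sup>+x. ennreal (b x) * indicator S x \<partial>\<sigma>) + deficit"
    by (subst nn_integral_add) (auto simp: deficit_swap)
  also have "(\<integral>\<^sup>+x. ennreal (b x) * indicator S x \<partial>\<sigma>) = b.prob S"
    by (simp add: emeasure_density flip: b.emeasure_eq_measure)
  finally have split: "ennreal (a.prob S) = ennreal (b.prob S) + deficit" .
  obtain t where t: "deficit = ennreal t" "0 \<le> t"
    using deficit_le_1 by (cases deficit) (auto simp: top_unique)
  have "t = a.prob S - b.prob S"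
    using split t by (simp flip: ennreal_plus)
  also have "\<dots> \<le> dTV (density \<sigma> (\<lambda>x. ennreal (a x))) (density \<sigma> (\<lambda>x. ennreal (b x)))"
    by (rule measure_diff_le_dTV[OF prob_a prob_b]) simp
  finally show ?thesis by (simp add: t ennreal_leI)
qed

lemma sets_residual [measurable_cong]: "sets residual = sets \<sigma>"
  by (simp add: residual_def)

lemma deficit_mult_residual:
  assumes [measurable]: "A \<in> sets \<sigma>"
  shows "deficit * emeasure residual A = (\<integral>\<^sup>+x. ennreal (b x - overlap x) * indicator A x \<partial>\<sigma>)"
proof (cases "deficit = 0")
  case True
  have "(\<integral>\<^sup>+x. ennreal (b x - overlap x) * indicator A x \<partial>\<sigma>) \<le> deficit"
    unfolding deficit_def by (intro nn_integral_mono) (auto split: split_indicator)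
  then show ?thesis using True by simp
next
  case False
  have "emeasure residual A = (\<integral>\<^sup>+x. ennreal (b x - overlap x) * indicator A x / deficit \<partial>\<sigma>)"
    using False by (simp add: residual_def emeasure_density divide_ennreal_def ac_simps)
  also have "\<dots> = (\<integral>\<^sup>+x. ennreal (b x - overlap x) * indicator A x \<partial>\<sigma>) / deficit"
    by (rule nn_integral_divide) measurable
  finally have "deficit * emeasure residual A
      = (\<integral>\<^sup>+x. ennreal (b x - overlap x) * indicator A x \<partial>\<sigma>) * deficit / deficit"
    by (simp only: ennreal_times_divide mult.commute)
  moreover have "deficit \<noteq> top" using deficit_le_1 by (auto simp: top_unique)
  ultimately show ?thesis using False by (metis ennreal_mult_divide_eq)
qed

lemma prob_space_residual: "prob_space residual"
proof (cases "deficit = 0")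
  case True
  then show ?thesis by (simp add: residual_def prob_b)
next
  case False
  have "deficit * emeasure residual (space \<sigma>) = deficit * 1"
    using deficit_mult_residual[of "space \<sigma>"] by (simp add: deficit_def cong: nn_integral_cong)
  then have "emeasure residual (space residual) = 1"
    using False deficit_le_1 sets_eq_imp_space_eq[OF sets_residual]
    by (metis ennreal_mult_cancel_left ennreal_one_less_top leD)
  then show ?thesis by (rule prob_spaceI)
qed

lemma emeasure_acceptance_residual:
  assumes [measurable]: "A \<in> sets \<sigma>"
  shows "emeasure (density \<sigma> (\<lambda>x. ennreal (b x))) A
    = (\<integral>\<^sup>+x. ennreal (acceptance x) * indicator A x \<partial>density \<sigma> (\<lambda>x. ennreal (a x))) + deficit * emeasure residual A"
proof -
  have "(\<integral>\<^sup>+x. ennreal (acceptance x) * indicator A x \<partial>density \<sigma> (\<lambda>x. ennreal (a x)))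
      = (\<integral>\<^sup>+x. ennreal (a x) * (ennreal (acceptance x) * indicator A x) \<partial>\<sigma>)"
    by (rule nn_integral_density) measurable
  also have "\<dots> = (\<integral>\<^sup>+x. ennreal (overlap x) * indicator A x \<partial>\<sigma>)"
    using a_nonneg acceptance_bounds
    by (intro nn_integral_cong) (simp add: a_mult_acceptance flip: ennreal_mult mult.assoc)
  finally have "(\<integral>\<^sup>+x. ennreal (acceptance x) * indicator A x \<partial>density \<sigma> (\<lambda>x. ennreal (a x))) + deficit * emeasure residual A
      = (\<integral>\<^sup>+x. ennreal (overlap x) * indicator A x + ennreal (b x - overlap x) * indicator A x \<partial>\<sigma>)"
    by (simp add: deficit_mult_residual nn_integral_add)
  also have "\<dots> = (\<integral>\<^sup>+x. ennreal (b x) * indicator A x \<partial>\<sigma>)"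
    using overlap_bounds by (intro nn_integral_cong) (auto split: split_indicator simp flip: ennreal_plus)
  also have "\<dots> = emeasure (density \<sigma> (\<lambda>x. ennreal (b x))) A"
    by (rule emeasure_density[symmetric]) measurable
  finally show ?thesis by simp
qed

definition redraw :: "'a \<Rightarrow> 'a measure" where
  "redraw x = mixture (acceptance x) (return \<sigma> x) residual"

lemma residual_in_prob_algebra: "residual \<in> space (prob_algebra \<sigma>)"
  using prob_space_residual sets_residual by (simp add: space_prob_algebra)

lemma return_in_prob_algebra: "x \<in> space \<sigma> \<Longrightarrow> return \<sigma> x \<in> space (prob_algebra \<sigma>)"
  by (simp add: space_prob_algebra prob_space_return)

lemma redraw_in_prob_algebra: "x \<in> space \<sigma> \<Longrightarrow> redraw x \<in> space (prob_algebra \<sigma>)"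
  unfolding redraw_def by (rule mixture_in_prob_algebra[OF return_in_prob_algebra residual_in_prob_algebra])

lemma nn_integral_redraw:
  assumes "x \<in> space \<sigma>" "f \<in> borel_measurable \<sigma>"
  shows "(\<integral>\<^sup>+y. f y \<partial>redraw x) = ennreal (acceptance x) * f x + ennreal (1 - acceptance x) * (\<integral>\<^sup>+y. f y \<partial>residual)"
  unfolding redraw_def using assms acceptance_bounds
  by (simp add: nn_integral_mixture[OF return_in_prob_algebra residual_in_prob_algebra] nn_integral_return)

lemma emeasure_redraw:
  assumes "x \<in> space \<sigma>" "A \<in> sets \<sigma>"
  shows "emeasure (redraw x) A
    = ennreal (acceptance x) * indicator A x + ennreal (1 - acceptance x) * emeasure residual A"
  unfolding redraw_def using assms acceptance_bounds
  by (simp add: emeasure_mixture[OF return_in_prob_algebra residual_in_prob_algebra])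

lemma redraw_kernel: "redraw \<in> \<sigma> \<rightarrow>\<^sub>M prob_algebra \<sigma>"
proof (intro measurable_prob_algebraI measurable_subprob_algebra)
  show "(\<lambda>x. emeasure (redraw x) A) \<in> borel_measurable \<sigma>" if [measurable]: "A \<in> sets \<sigma>" for A
    by (simp add: emeasure_redraw cong: measurable_cong)
qed (use redraw_in_prob_algebra in \<open>auto simp: space_prob_algebra prob_space_imp_subprob_space\<close>)

lemma bind_redraw: "density \<sigma> (\<lambda>x. ennreal (a x)) \<bind> redraw = density \<sigma> (\<lambda>x. ennreal (b x))"
proof (rule measure_eqI)
  have density: "density \<sigma> (\<lambda>x. ennreal (a x)) \<in> space (prob_algebra \<sigma>)"
    using prob_a by (simp add: space_prob_algebra)
  have sets: "sets (density \<sigma> (\<lambda>x. ennreal (a x)) \<bind> redraw) = sets \<sigma>"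
    using bind_in_prob_algebra[OF density redraw_kernel] by (simp add: space_prob_algebra)
  then show "sets (density \<sigma> (\<lambda>x. ennreal (a x)) \<bind> redraw) = sets (density \<sigma> (\<lambda>x. ennreal (b x)))" by simp
  fix A assume "A \<in> sets (density \<sigma> (\<lambda>x. ennreal (a x)) \<bind> redraw)"
  then have [measurable]: "A \<in> sets \<sigma>" using sets by simp
  have "emeasure (density \<sigma> (\<lambda>x. ennreal (a x)) \<bind> redraw) A
      = (\<integral>\<^sup>+x. ennreal (acceptance x) * indicator A x + ennreal (1 - acceptance x) * emeasure residual A
          \<partial>density \<sigma> (\<lambda>x. ennreal (a x)))"
    unfolding emeasure_bind_prob_algebra[OF density redraw_kernel \<open>A \<in> sets \<sigma>\<close>]
    by (rule nn_integral_cong) (simp add: emeasure_redraw)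
  also have "\<dots> = emeasure (density \<sigma> (\<lambda>x. ennreal (b x))) A"
    by (simp add: emeasure_acceptance_residual nn_integral_add nn_integral_multc nn_integral_rejection)
  finally show "emeasure (density \<sigma> (\<lambda>x. ennreal (a x)) \<bind> redraw) A = emeasure (density \<sigma> (\<lambda>x. ennreal (b x))) A" .
qed

lemma nn_integral_redraw_le:
  assumes "x \<in> space \<sigma>" "f \<in> borel_measurable \<sigma>" "\<And>y. f y \<le> 1"
  shows "(\<integral>\<^sup>+y. f y \<partial>redraw x) \<le> f x + ennreal (1 - acceptance x)"
proof -
  interpret prob_space residual by (rule prob_space_residual)
  have "(\<integral>\<^sup>+y. f y \<partial>residual) \<le> (\<integral>\<^sup>+y. 1 \<partial>residual)" by (intro nn_integral_mono assms(3))
  then have "ennreal (1 - acceptance x) * (\<integral>\<^sup>+y. f y \<partial>residual) \<le> ennreal (1 - acceptance x) * 1"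
    by (intro mult_left_mono) (simp_all add: emeasure_space_1)
  moreover have "ennreal (acceptance x) * f x \<le> 1 * f x"
    using acceptance_bounds by (intro mult_right_mono) simp_all
  ultimately show ?thesis
    unfolding nn_integral_redraw[OF assms(1,2)] by (simp add: add_mono)
qed

end

lemma prob_algebra_cong: "sets M = sets N \<Longrightarrow> prob_algebra M = prob_algebra N"
  by (simp add: prob_algebra_def cong: subprob_algebra_cong)

lemma total_variation_kernel:
  assumes \<mu>: "\<mu> \<in> space (prob_algebra M)" and \<nu>: "\<nu> \<in> space (prob_algebra M)"
  shows "\<exists>\<kappa> r. \<kappa> \<in> M \<rightarrow>\<^sub>M prob_algebra M \<and> \<mu> \<bind> \<kappa> = \<nu> \<and> r \<in> borel_measurable M \<and>
    (\<integral>\<^sup>+x. ennreal (r x) \<partial>\<mu>) \<le> ennreal (dTV \<mu> \<nu>) \<and>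
    (\<forall>x\<in>space M. \<forall>f\<in>borel_measurable M. (\<forall>y. f y \<le> 1) \<longrightarrow> (\<integral>\<^sup>+y. f y \<partial>\<kappa> x) \<le> f x + ennreal (r x))"
proof -
  obtain \<sigma> a b where \<sigma>: "sets \<sigma> = sets M" and a: "a \<in> borel_measurable M" "\<And>x. 0 \<le> a x"
    and b: "b \<in> borel_measurable M" "\<And>x. 0 \<le> b x"
    and densities: "density \<sigma> (\<lambda>x. ennreal (a x)) = \<mu>" "density \<sigma> (\<lambda>x. ennreal (b x)) = \<nu>"
    using common_density[OF \<mu> \<nu>] by metis
  interpret density_pair \<sigma> a b
    by (rule density_pair.intro)
      (use a b \<mu> \<nu> in \<open>simp_all add: densities space_prob_algebra measurable_cong_sets[OF \<sigma> refl]\<close>)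
  note cong = measurable_cong_sets[OF \<sigma> refl] prob_algebra_cong[OF \<sigma>] sets_eq_imp_space_eq[OF \<sigma>]
  show ?thesis
  proof (intro exI[of _ redraw] exI[of _ "\<lambda>x. 1 - acceptance x"] conjI ballI impI)
    show "redraw \<in> M \<rightarrow>\<^sub>M prob_algebra M" using redraw_kernel by (simp add: cong)
    show "(\<lambda>x. 1 - acceptance x) \<in> borel_measurable M" by (simp flip: cong)
    show "\<mu> \<bind> redraw = \<nu>" using bind_redraw by (simp add: densities)
    show "(\<integral>\<^sup>+x. ennreal (1 - acceptance x) \<partial>\<mu>) \<le> ennreal (dTV \<mu> \<nu>)"
      using deficit_le_dTV nn_integral_rejection by (simp add: densities)
    show "(\<integral>\<^sup>+y. f y \<partial>redraw x) \<le> f x + ennreal (1 - acceptance x)"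
      if "x \<in> space M" "f \<in> borel_measurable M" "\<forall>y. f y \<le> 1" for x f
      using that by (intro nn_integral_redraw_le) (simp_all add: cong)
  qed
qed

theorem total_variation_coupling:
  fixes X Y :: "'w \<Rightarrow> 'a::topological_space" and \<nu> :: "'a measure"
  assumes M: "prob_space M" and X [measurable]: "X \<in> M \<rightarrow>\<^sub>M borel" and Y [measurable]: "Y \<in> M \<rightarrow>\<^sub>M borel"
    and \<nu>: "\<nu> \<in> prob_measures"
  shows "\<exists>c\<in>couplings (distr M borel X) \<nu>. \<forall>g\<in>borel_measurable (borel \<Otimes>\<^sub>M borel). (\<forall>z. g z \<le> 1) \<longrightarrow>
    (\<integral>\<^sup>+z. g z \<partial>c) \<le> (\<integral>\<^sup>+\<omega>. g (X \<omega>, Y \<omega>) \<partial>M) + ennreal (dTV (distr M borel Y) \<nu>)"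
proof -
  interpret prob_space M by (rule M)
  have "distr M borel Y \<in> prob_measures"
    by (simp add: in_prob_measures_iff prob_space_distr)
  from total_variation_kernel[OF this \<nu>]
  obtain \<kappa> r where \<kappa>: "\<kappa> \<in> borel \<rightarrow>\<^sub>M prob_algebra borel" "distr M borel Y \<bind> \<kappa> = \<nu>"
    and r [measurable]: "r \<in> borel_measurable borel"
      "(\<integral>\<^sup>+y. ennreal (r y) \<partial>distr M borel Y) \<le> ennreal (dTV (distr M borel Y) \<nu>)"
    and \<kappa>_le: "\<forall>x\<in>space borel. \<forall>f\<in>borel_measurable borel. (\<forall>y. f y \<le> 1) \<longrightarrow>
      (\<integral>\<^sup>+y. f y \<partial>\<kappa> x) \<le> f x + ennreal (r x)"
    by (elim exE conjE) (rule that)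
  show ?thesis
  proof (intro bexI ballI impI)
    show "kernel_coupling M X Y \<kappa> \<in> couplings (distr M borel X) \<nu>"
      using kernel_coupling[OF M X Y \<kappa>(1)] by (simp add: \<kappa>(2))
    fix g :: "'a \<times> 'a \<Rightarrow> ennreal"
    assume g [measurable]: "g \<in> borel_measurable (borel \<Otimes>\<^sub>M borel)" and g_le: "\<forall>z. g z \<le> 1"
    have "(\<integral>\<^sup>+z. g z \<partial>kernel_coupling M X Y \<kappa>) = (\<integral>\<^sup>+\<omega>. \<integral>\<^sup>+y. g (X \<omega>, y) \<partial>\<kappa> (Y \<omega>) \<partial>M)"
      by (rule nn_integral_kernel_coupling[OF M X Y \<kappa>(1) g])
    also have "\<dots> \<le> (\<integral>\<^sup>+\<omega>. g (X \<omega>, Y \<omega>) + ennreal (r (Y \<omega>)) \<partial>M)"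
      using g_le by (intro nn_integral_mono \<kappa>_le[rule_format] measurable_compose[OF measurable_Pair1' g]) simp_all
    also have "\<dots> = (\<integral>\<^sup>+\<omega>. g (X \<omega>, Y \<omega>) \<partial>M) + (\<integral>\<^sup>+y. ennreal (r y) \<partial>distr M borel Y)"
      by (simp add: nn_integral_add nn_integral_distr)
    also have "\<dots> \<le> (\<integral>\<^sup>+\<omega>. g (X \<omega>, Y \<omega>) \<partial>M) + ennreal (dTV (distr M borel Y) \<nu>)"
      by (intro add_left_mono r(2))
    finally show "(\<integral>\<^sup>+z. g z \<partial>kernel_coupling M X Y \<kappa>) \<le> (\<integral>\<^sup>+\<omega>. g (X \<omega>, Y \<omega>) \<partial>M) + ennreal (dTV (distr M borel Y) \<nu>)" .
  qed
qed

section \<open>Concave rate functions\<close>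

locale concave_rate =
  fixes \<phi> :: "real \<Rightarrow> real"
  assumes concave: "concave_on {0..} \<phi>"
    and differentiable: "\<And>s. 0 \<le> s \<Longrightarrow> \<phi> differentiable (at s within {0..})"
    and nonneg: "\<And>s. 0 \<le> s \<Longrightarrow> 0 \<le> \<phi> s"
    and mono_on: "mono_on {0..} \<phi>"
    and at_top: "filterlim \<phi> at_top at_top"
    and zero: "\<phi> 0 = 0"
begin

definition \<phi>' :: "real \<Rightarrow> real" where
  "\<phi>' = deriv \<phi>"

definition slope :: real where
  "slope = (SUP z\<in>{0<..}. \<phi> z / z)"

abbreviation H :: "real \<Rightarrow> real" where
  "H \<equiv> H_phi \<phi>"

lemma mono: "0 \<le> x \<Longrightarrow> x \<le> y \<Longrightarrow> \<phi> x \<le> \<phi> y"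
  using mono_onD[OF mono_on, of x y] by auto

lemma unbounded: "\<exists>z>x. y < \<phi> z"
proof -
  have "\<forall>\<^sub>F z in at_top. x < z \<and> y < \<phi> z"
    using at_top by (intro eventually_conj eventually_gt_at_top) (simp add: filterlim_at_top_dense)
  then show ?thesis by (auto dest: eventually_happens)
qed

lemma scale_le:
  assumes "0 \<le> x" "x \<le> y"
  shows "x * \<phi> y \<le> y * \<phi> x"
proof (cases "y = 0")
  case False
  with assms have "0 < y" by simp
  have "(1 - x / y) * \<phi> 0 + (x / y) * \<phi> y \<le> \<phi> ((1 - x / y) *\<^sub>R 0 + (x / y) *\<^sub>R y)"
    using assms \<open>0 < y\<close> by (intro concave_onD[OF concave]) auto
  then have "x / y * \<phi> y \<le> \<phi> x" using \<open>0 < y\<close> by (simp add: zero)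
  then show ?thesis using \<open>0 < y\<close> by (simp add: field_simps)
qed (use assms in simp)

lemma pos: "0 < x \<Longrightarrow> 0 < \<phi> x"
proof -
  assume "0 < x"
  obtain z where "x < z" "0 < \<phi> z" using unbounded by blast
  then have "0 < x * \<phi> z" "x * \<phi> z \<le> z * \<phi> x" using \<open>0 < x\<close> by (auto intro: scale_le)
  then have "0 < z * \<phi> x" by linarith
  then show ?thesis using \<open>0 < x\<close> \<open>x < z\<close> by (simp add: zero_less_mult_iff)
qed

lemma subadditive:
  assumes "0 \<le> a" "0 \<le> b"
  shows "\<phi> (a + b) \<le> \<phi> a + \<phi> b"
proof (cases "a + b = 0")
  case False
  then have "0 < a + b" using assms by simp
  have "a * \<phi> (a + b) \<le> (a + b) * \<phi> a" "b * \<phi> (a + b) \<le> (a + b) * \<phi> b"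
    using assms by (auto intro: scale_le)
  then have "(a + b) * \<phi> (a + b) \<le> (a + b) * (\<phi> a + \<phi> b)" by (simp add: algebra_simps)
  then show ?thesis using \<open>0 < a + b\<close> by simp
qed (use assms in \<open>auto simp: zero add_nonneg_eq_0_iff\<close>)

lemma has_derivative: "0 < u \<Longrightarrow> (\<phi> has_real_derivative \<phi>' u) (at u)"
proof -
  assume "0 < u"
  then have "at u within {0..} = at u" by (intro at_within_interior) auto
  then have "\<phi> differentiable at u" using differentiable[of u] \<open>0 < u\<close> by simp
  then show ?thesis unfolding \<phi>'_def by (simp add: DERIV_deriv_iff_real_differentiable)
qed

lemma tangent:
  assumes "0 \<le> z" "0 < u"
  shows "\<phi> z \<le> \<phi> u + \<phi>' u * (z - u)"
proof -
  have "- \<phi>' u * (z - u) \<le> - \<phi> z - - \<phi> u"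
  proof (rule convex_on_imp_above_tangent)
    show "convex_on {0..} (\<lambda>x. - \<phi> x)" using concave by (simp add: concave_on_def)
    show "((\<lambda>x. - \<phi> x) has_field_derivative - \<phi>' u) (at u within {0..})"
      by (rule has_field_derivative_at_within) (intro DERIV_minus has_derivative assms)
  qed (use assms in auto)
  then show ?thesis by (simp add: algebra_simps)
qed

lemma derivative_antimono:
  assumes "0 < u" "u \<le> v"
  shows "\<phi>' v \<le> \<phi>' u"
proof (cases "u = v")
  case False
  have "\<phi> v \<le> \<phi> u + \<phi>' u * (v - u)" "\<phi> u \<le> \<phi> v + \<phi>' v * (u - v)" using assms by (auto intro: tangent)
  then have "0 \<le> (\<phi>' u - \<phi>' v) * (v - u)" by (simp add: algebra_simps)
  then show ?thesis using assms False by (simp add: zero_le_mult_iff)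
qed simp

lemma derivative_pos:
  assumes "0 < u"
  shows "0 < \<phi>' u"
proof -
  obtain z where z: "u < z" "\<phi> u < \<phi> z" using unbounded by blast
  then have "0 < \<phi>' u * (z - u)" using tangent[of z u] assms by simp
  then show ?thesis using z by (simp add: zero_less_mult_iff)
qed

lemma bdd_above_slopes: "bdd_above ((\<lambda>z. \<phi> z / z) ` {0<..})"
proof -
  obtain l where "(\<phi> has_real_derivative l) (at 0 within {0..})"
    using differentiable[of 0] by (auto simp: real_differentiable_def)
  then have limit: "((\<lambda>h. \<phi> h / h) \<longlongrightarrow> l) (at_right 0)"
    by (simp add: has_field_derivative_iff zero at_within_Ici_at_right)
  have "\<phi> z / z \<le> l" if "0 < z" for z
  proof (rule tendsto_lowerbound[OF limit])
    show "\<forall>\<^sub>F h in at_right 0. \<phi> z / z \<le> \<phi> h / h"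
      using eventually_at_right_real[OF that]
    proof eventually_elim
      case (elim h)
      then show ?case using scale_le[of h z] by (simp add: field_simps)
    qed
  qed simp
  then show ?thesis by (intro bdd_aboveI2) auto
qed

lemma le_slope:
  assumes "0 \<le> z"
  shows "\<phi> z \<le> slope * z"
proof (cases "z = 0")
  case False
  then have "\<phi> z / z \<le> slope"
    unfolding slope_def using assms by (intro cSUP_upper bdd_above_slopes) auto
  then show ?thesis using False assms by (simp add: field_simps)
qed (simp add: zero)

lemma slope_pos: "0 < slope"
  using le_slope[of 1] pos[of 1] by simp

lemma continuous: "0 < a \<Longrightarrow> continuous_on {a..b} \<phi>"
  by (rule DERIV_continuous_on, rule has_field_derivative_at_within, rule has_derivative) auto

lemma comp_measurable [measurable]:
  assumes "f \<in> borel_measurable M" "\<And>x. 0 \<le> f x"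
  shows "(\<lambda>x. \<phi> (f x)) \<in> borel_measurable M"
proof -
  have "(\<lambda>u. \<phi> (max 0 u)) \<in> borel_measurable borel"
    by (intro borel_measurable_mono monoI mono) auto
  from measurable_compose[OF assms(1) this] show ?thesis
    using assms(2) by (simp add: max_def)
qed

lemma Jensen:
  assumes "prob_space M" and f: "integrable M f" "\<And>x. 0 \<le> f x"
  shows "integrable M (\<lambda>x. \<phi> (f x))" "(\<integral>x. \<phi> (f x) \<partial>M) \<le> \<phi> (\<integral>x. f x \<partial>M)"
proof -
  interpret prob_space M by fact
  have [measurable]: "f \<in> borel_measurable M" using f by auto
  show integrable: "integrable M (\<lambda>x. \<phi> (f x))"
  proof (rule Bochner_Integration.integrable_bound)
    show "integrable M (\<lambda>x. slope * f x)" using f by simp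
    have "norm (\<phi> (f x)) \<le> norm (slope * f x)" for x
      using le_slope[OF f(2), of x] nonneg[OF f(2), of x] unfolding real_norm_def by linarith
    then show "AE x in M. norm (\<phi> (f x)) \<le> norm (slope * f x)" by simp
  qed (use f in measurable)
  show "(\<integral>x. \<phi> (f x) \<partial>M) \<le> \<phi> (\<integral>x. f x \<partial>M)"
  proof (cases "(\<integral>x. f x \<partial>M) = 0")
    case True
    then have "AE x in M. \<phi> (f x) = 0"
      using f integral_nonneg_eq_0_iff_AE[of M f] by (auto simp: zero)
    then show ?thesis using True by (simp add: integral_eq_zero_AE zero)
  next
    case False
    define m where "m = (\<integral>x. f x \<partial>M)"
    have m: "0 < m" using False f by (simp add: m_def less_le integral_nonneg_AE)
    have "(\<integral>x. \<phi> (f x) \<partial>M) \<le> (\<integral>x. \<phi> m + \<phi>' m * (f x - m) \<partial>M)"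
      using integrable f tangent[OF _ m] by (intro integral_mono) auto
    also have "\<dots> = \<phi> m" using f by (simp add: prob_space m_def)
    finally show ?thesis by (simp add: m_def)
  qed
qed

lemma inverse_continuous: "0 < a \<Longrightarrow> continuous_on {a..b} (\<lambda>u. 1 / \<phi> u)"
  using pos by (intro continuous_intros continuous) (auto simp: less_le)

lemma H_1 [simp]: "H 1 = 0"
  by (simp add: H_phi_def)

lemma H_continuous: "continuous_on {1..b} H"
  unfolding H_phi_def[abs_def]
  by (intro indefinite_integral_continuous_1 integrable_continuous_real inverse_continuous) auto

lemma H_has_derivative:
  assumes "1 < u"
  shows "(H has_real_derivative 1 / \<phi> u) (at u)"
proof -
  have "((\<lambda>u. integral {1..u} (\<lambda>u. 1 / \<phi> u)) has_real_derivative 1 / \<phi> u) (at u within {1..u+1})"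
    using assms by (intro integral_has_real_derivative inverse_continuous) auto
  moreover have "at u within {1..u+1} = at u" using assms by (intro at_within_interior) auto
  ultimately show ?thesis by (simp add: H_phi_def[abs_def])
qed

lemma H_strict_mono:
  assumes "1 \<le> x" "x < y"
  shows "H x < H y"
proof (rule DERIV_pos_imp_increasing_open[OF assms(2)])
  show "\<exists>d. DERIV H u :> d \<and> 0 < d" if "x < u" "u < y" for u
    using that assms H_has_derivative[of u] pos[of u] by (intro exI[of _ "1 / \<phi> u"]) auto
  show "continuous_on {x..y} H" using assms by (intro continuous_on_subset[OF H_continuous[of y]]) auto
qed

lemma H_mono: "1 \<le> x \<Longrightarrow> x \<le> y \<Longrightarrow> H x \<le> H y"
  using H_strict_mono[of x y] by (cases "x = y") auto

lemma H_nonneg: "1 \<le> x \<Longrightarrow> 0 \<le> H x"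
  using H_mono[of 1 x] by simp

lemma ln_le_H:
  assumes "1 \<le> x"
  shows "ln x / slope \<le> H x"
proof -
  have "H 1 - ln 1 / slope \<le> H x - ln x / slope"
  proof (rule DERIV_nonneg_imp_increasing_open[OF assms])
    fix u :: real assume u: "1 < u" "u < x"
    have "((\<lambda>u. H u - ln u / slope) has_real_derivative 1 / \<phi> u - 1 / u / slope) (at u)"
      using u slope_pos by (auto intro!: derivative_eq_intros H_has_derivative)
    moreover have "1 / u / slope \<le> 1 / \<phi> u"
      using u le_slope[of u] slope_pos pos[of u] by (simp add: field_simps)
    ultimately show "\<exists>y. ((\<lambda>u. H u - ln u / slope) has_real_derivative y) (at u) \<and> 0 \<le> y" by force
  qed (use slope_pos in \<open>auto intro!: continuous_intros H_continuous\<close>)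
  then show ?thesis by simp
qed

lemma H_unbounded: "\<exists>x\<ge>1. y \<le> H x"
proof -
  have "y \<le> H (exp (slope * \<bar>y\<bar>))"
    using ln_le_H[of "exp (slope * \<bar>y\<bar>)"] slope_pos by simp
  then show ?thesis using slope_pos by (intro exI[of _ "exp (slope * \<bar>y\<bar>)"]) auto
qed

lemma H_phi_inv:
  assumes "0 \<le> t"
  shows "1 \<le> H_phi_inv \<phi> t" "H (H_phi_inv \<phi> t) = t"
proof -
  obtain x where x: "1 \<le> x" "t \<le> H x" using H_unbounded by blast
  obtain y where y: "1 \<le> y" "H y = t"
    using IVT'[of H 1 t x] x assms H_continuous[of x] by auto
  have "H_phi_inv \<phi> t = y"
    unfolding H_phi_inv_def
  proof (rule the_equality)
    show "z = y" if "1 \<le> z \<and> H z = t" for z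
      using H_strict_mono[of z y] H_strict_mono[of y z] that y by (cases z y rule: linorder_cases) auto
  qed (use y in auto)
  then show "1 \<le> H_phi_inv \<phi> t" "H (H_phi_inv \<phi> t) = t" using y by auto
qed

lemma H_phi_inv_ge:
  assumes "1 \<le> x" "H x \<le> t"
  shows "x \<le> H_phi_inv \<phi> t"
proof -
  have "0 \<le> t" using assms H_nonneg[of x] by linarith
  then show ?thesis
    using H_strict_mono[of "H_phi_inv \<phi> t" x] H_phi_inv[of t] assms by fastforce
qed

lemma H_phi_inv_mono: "0 \<le> s \<Longrightarrow> s \<le> t \<Longrightarrow> H_phi_inv \<phi> s \<le> H_phi_inv \<phi> t"
  using H_phi_inv[of s] by (intro H_phi_inv_ge) auto

lemma phi_H_phi_inv_pos: "0 \<le> t \<Longrightarrow> 0 < \<phi> (H_phi_inv \<phi> t)"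
  using H_phi_inv(1)[of t] by (intro pos) simp

lemma phi_H_phi_inv_at_top: "filterlim (\<lambda>t. \<phi> (H_phi_inv \<phi> t)) at_top at_top"
  unfolding filterlim_at_top
proof
  fix Z
  obtain z where z: "1 < z" "Z < \<phi> z" using unbounded by blast
  show "\<forall>\<^sub>F t in at_top. Z \<le> \<phi> (H_phi_inv \<phi> t)"
    using eventually_ge_at_top[of "H z"]
  proof eventually_elim
    case (elim t)
    then show ?case using mono[OF _ H_phi_inv_ge[of z t]] z by simp
  qed
qed

lemma H_minus_ln_has_derivative:
  "1 < u \<Longrightarrow> ((\<lambda>u. l * H u - ln (\<phi> u)) has_real_derivative (l - \<phi>' u) / \<phi> u) (at u)"
  using pos[of u] by (auto intro!: derivative_eq_intros H_has_derivative has_derivative simp: diff_divide_distrib)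

lemma H_minus_ln_continuous: "1 \<le> a \<Longrightarrow> continuous_on {a..b} (\<lambda>u. l * H u - ln (\<phi> u))"
  using pos by (intro continuous_intros continuous continuous_on_subset[OF H_continuous[of b]]) (auto simp: less_le)

lemma ln_ratio_le_derivative_mult_H:
  assumes "1 \<le> s" "s \<le> R"
  shows "ln (\<phi> R / \<phi> s) \<le> \<phi>' s * (H R - H s)"
proof -
  have "\<phi>' s * H s - ln (\<phi> s) \<le> \<phi>' s * H R - ln (\<phi> R)"
  proof (rule DERIV_nonneg_imp_increasing_open[OF assms(2)])
    show "\<exists>y. ((\<lambda>u. \<phi>' s * H u - ln (\<phi> u)) has_real_derivative y) (at u) \<and> 0 \<le> y" if "s < u" "u < R" for u
      using H_minus_ln_has_derivative[of u "\<phi>' s"] derivative_antimono[of s u] pos[of u] assms that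
      by (intro exI[of _ "(\<phi>' s - \<phi>' u) / \<phi> u"]) auto
  qed (rule H_minus_ln_continuous[OF assms(1)])
  then show ?thesis
    using pos[of s] pos[of R] assms by (simp add: ln_div algebra_simps)
qed

lemma exp_H_over_phi_antimono:
  assumes "1 \<le> u" "u \<le> v" "v \<le> s" "l \<le> \<phi>' s"
  shows "exp (l * H v) / \<phi> v \<le> exp (l * H u) / \<phi> u"
proof -
  have "l * H v - ln (\<phi> v) \<le> l * H u - ln (\<phi> u)"
  proof (rule DERIV_nonpos_imp_decreasing_open[OF assms(2)])
    show "\<exists>y. ((\<lambda>u. l * H u - ln (\<phi> u)) has_real_derivative y) (at x) \<and> y \<le> 0" if "u < x" "x < v" for x
      using H_minus_ln_has_derivative[of x l] derivative_antimono[of x s] pos[of x] assms that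
      by (intro exI[of _ "(l - \<phi>' x) / \<phi> x"]) (auto simp: divide_nonpos_nonneg)
  qed (rule H_minus_ln_continuous[OF assms(1)])
  then have "exp (l * H v - ln (\<phi> v)) \<le> exp (l * H u - ln (\<phi> u))" by simp
  then show ?thesis using assms pos[of u] pos[of v] by (simp add: exp_diff)
qed

lemma exp_H_tangent:
  assumes u: "1 \<le> u" "u \<le> s" and z: "1 \<le> z" "z \<le> s" and l: "0 \<le> l" "l \<le> \<phi>' s"
  shows "exp (l * H z) \<le> exp (l * H u) + l * (exp (l * H u) / \<phi> u) * (z - u)"
proof -
  define gap where "gap x = exp (l * H x) - l * (exp (l * H u) / \<phi> u) * x" for x
  have gap_derivative: "(gap has_real_derivative l * (exp (l * H x) / \<phi> x - exp (l * H u) / \<phi> u)) (at x)"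
    if "1 < x" for x
    unfolding gap_def[abs_def] using that pos[of u] u(1)
    by (auto intro!: derivative_eq_intros H_has_derivative simp: algebra_simps)
  have gap_continuous: "continuous_on {a..b} gap" if "1 \<le> a" for a b
    unfolding gap_def[abs_def] using that by (intro continuous_intros continuous_on_subset[OF H_continuous[of b]]) auto
  have "gap z \<le> gap u"
  proof (cases "z \<le> u")
    case True
    then show ?thesis
    proof (rule DERIV_nonneg_imp_increasing_open)
      show "\<exists>y. (gap has_real_derivative y) (at x) \<and> 0 \<le> y" if "z < x" "x < u" for x
        using gap_derivative[of x] exp_H_over_phi_antimono[of x u s l] that u z l by fastforce
    qed (rule gap_continuous[OF z(1)])
  next
    case False
    then have "u \<le> z" by simp
    then show ?thesis
    proof (rule DERIV_nonpos_imp_decreasing_open)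
      show "\<exists>y. (gap has_real_derivative y) (at x) \<and> y \<le> 0" if "u < x" "x < z" for x
        using gap_derivative[of x] exp_H_over_phi_antimono[of u x s l] that u z l
        by (fastforce intro: mult_nonneg_nonpos)
    qed (rule gap_continuous[OF u(1)])
  qed
  then show ?thesis by (simp add: gap_def right_diff_distrib)
qed

definition exp_weight :: "real \<Rightarrow> real \<Rightarrow> real \<Rightarrow> real" where
  "exp_weight l s u = exp (l * H (min u s))"

lemma exp_weight_ge_1: "0 \<le> l \<Longrightarrow> 1 \<le> s \<Longrightarrow> 1 \<le> u \<Longrightarrow> 1 \<le> exp_weight l s u"
  unfolding exp_weight_def by (simp add: H_nonneg)

lemma exp_weight_mono: "0 \<le> l \<Longrightarrow> 1 \<le> s \<Longrightarrow> 1 \<le> u \<Longrightarrow> u \<le> v \<Longrightarrow> exp_weight l s u \<le> exp_weight l s v"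
  unfolding exp_weight_def by (auto intro!: mult_left_mono H_mono)

lemma exp_weight_tangent:
  assumes "1 \<le> u" "u \<le> s" "1 \<le> z" "0 \<le> l" "l \<le> \<phi>' s"
  shows "exp_weight l s z \<le> exp_weight l s u + l * (exp_weight l s u / \<phi> u) * (z - u)"
proof -
  have "exp_weight l s z \<le> exp_weight l s u + l * (exp_weight l s u / \<phi> u) * (min z s - u)"
    using exp_H_tangent[of u s "min z s" l] assms by (simp add: exp_weight_def)
  also have "\<dots> \<le> exp_weight l s u + l * (exp_weight l s u / \<phi> u) * (z - u)"
    using assms pos[of u] by (intro add_left_mono mult_left_mono) (auto simp: exp_weight_def)
  finally show ?thesis .
qed

lemma exp_weight_comp_measurable:
  assumes "0 \<le> l" "1 \<le> s" "f \<in> borel_measurable M" "\<And>x. 1 \<le> f x"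
  shows "(\<lambda>x. exp_weight l s (f x)) \<in> borel_measurable M"
proof -
  have "(\<lambda>u. exp_weight l s (max 1 u)) \<in> borel_measurable borel"
    using assms by (intro borel_measurable_mono monoI exp_weight_mono) auto
  from measurable_compose[OF assms(3) this] show ?thesis
    using assms(4) by (simp add: max_def)
qed

lemma intermediate_level:
  assumes "0 < a" "a \<le> R" and q: "0 < q" "q < 1"
  obtains s where "a \<le> s" "s \<le> R" "\<phi> a / \<phi> s = (\<phi> a / \<phi> R) powr q" "\<phi> R / \<phi> s = (\<phi> R / \<phi> a) powr (1 - q)"
proof -
  define p where "p = \<phi> a powr (1 - q) * \<phi> R powr q"
  have \<phi>: "0 < \<phi> a" "0 < \<phi> R" "\<phi> a \<le> \<phi> R" using assms by (auto intro!: pos mono)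
  have "\<phi> a = \<phi> a powr (1 - q) * \<phi> a powr q" using \<phi> by (simp flip: powr_add)
  also have "\<dots> \<le> p" unfolding p_def using \<phi> q by (intro mult_left_mono powr_mono2) auto
  finally have "\<phi> a \<le> p" .
  have "p \<le> \<phi> R powr (1 - q) * \<phi> R powr q" unfolding p_def using \<phi> q by (intro mult_right_mono powr_mono2) auto
  also have "\<dots> = \<phi> R" using \<phi> by (simp flip: powr_add)
  finally have "p \<le> \<phi> R" .
  with \<open>\<phi> a \<le> p\<close> obtain s where s: "a \<le> s" "s \<le> R" "\<phi> s = p"
    using IVT'[of \<phi> a p R] assms continuous[of a R] by auto
  have "\<phi> a / p = \<phi> a powr 1 / (\<phi> a powr (1 - q) * \<phi> R powr q)" using \<phi> by (simp add: p_def)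
  also have "\<dots> = \<phi> a powr (1 - (1 - q)) / \<phi> R powr q" by (subst powr_diff) simp
  also have "\<dots> = (\<phi> a / \<phi> R) powr q" using \<phi> by (simp add: powr_divide)
  finally have "\<phi> a / \<phi> s = (\<phi> a / \<phi> R) powr q" by (simp add: s)
  have "\<phi> R / p = \<phi> R powr 1 / (\<phi> a powr (1 - q) * \<phi> R powr q)" using \<phi> by (simp add: p_def)
  also have "\<dots> = \<phi> R powr (1 - q) / \<phi> a powr (1 - q)" by (subst powr_diff) simp
  also have "\<dots> = (\<phi> R / \<phi> a) powr (1 - q)" using \<phi> by (simp add: powr_divide)
  finally have "\<phi> R / \<phi> s = (\<phi> R / \<phi> a) powr (1 - q)" by (simp add: s)
  then show ?thesis using that s \<open>\<phi> a / \<phi> s = (\<phi> a / \<phi> R) powr q\<close> by blast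
qed

end

section \<open>Markov kernels with a drift condition\<close>

locale markov_kernel =
  fixes Q :: "'a::polish_space \<Rightarrow> 'a measure"
  assumes kernel: "Q \<in> borel \<rightarrow>\<^sub>M prob_algebra borel"
begin

primrec iter :: "nat \<Rightarrow> 'a \<Rightarrow> 'a measure" where
  "iter 0 x = return borel x"
| "iter (Suc n) x = Q x \<bind> iter n"

lemma iter_kernel: "iter n \<in> borel \<rightarrow>\<^sub>M prob_algebra borel"
proof (induction n)
  case 0
  then show ?case by (simp add: iter.simps(1)[abs_def] measurable_return_prob_space)
next
  case (Suc n)
  show ?case
    unfolding iter.simps(2)[abs_def] by (rule measurable_bind_prob_space[OF kernel Suc])
qed

lemma kernel_in_prob_measures: "Q x \<in> prob_measures"
  using measurable_space[OF kernel] by simp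

lemma iter_in_prob_measures: "iter n x \<in> prob_measures"
  using measurable_space[OF iter_kernel] by simp

lemma bind_iter_0:
  assumes "\<mu> \<in> prob_measures"
  shows "\<mu> \<bind> iter 0 = \<mu>"
  using assms by (simp add: iter.simps(1)[abs_def] bind_return'' in_prob_measures_iff)

lemma bind_kernel_iter:
  assumes "\<mu> \<in> prob_measures"
  shows "(\<mu> \<bind> Q) \<bind> iter n = \<mu> \<bind> iter (Suc n)"
  unfolding iter.simps(2)[abs_def]
  by (rule bind_assoc[OF kernel_measurable_subprob[OF assms kernel] measurable_prob_algebraD[OF iter_kernel]])

lemma iter_Suc_0: "iter (Suc 0) x = Q x"
  using bind_iter_0[OF kernel_in_prob_measures] by simp

lemma iter_add: "iter (m + n) x = iter m x \<bind> iter n"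
proof (induction m arbitrary: x)
  case 0
  have "return borel x \<bind> iter n = iter n x"
    using bind_return[OF measurable_prob_algebraD[OF iter_kernel], of x] by simp
  then show ?case by simp
next
  case (Suc m)
  then have "iter (Suc m + n) x = Q x \<bind> (\<lambda>y. iter m y \<bind> iter n)"
    by (simp add: Suc[abs_def])
  also have "\<dots> = (Q x \<bind> iter m) \<bind> iter n"
    by (rule bind_assoc[symmetric, OF kernel_measurable_subprob[OF kernel_in_prob_measures iter_kernel]
        measurable_prob_algebraD[OF iter_kernel]])
  finally show ?case by simp
qed

lemma iter_Suc': "iter (Suc n) x = iter n x \<bind> Q"
  using iter_add[of n "Suc 0" x] iter_Suc_0[abs_def] by simp

lemma invariant_iter:
  assumes "\<pi> \<in> prob_measures" "\<pi> \<bind> Q = \<pi>"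
  shows "\<pi> \<bind> iter n = \<pi>"
proof (induction n)
  case 0
  show ?case by (rule bind_iter_0[OF assms(1)])
next
  case (Suc n)
  show ?case
    unfolding bind_kernel_iter[OF assms(1), symmetric] assms(2) by (rule Suc)
qed

definition cesaro :: "'a \<Rightarrow> nat \<Rightarrow> 'a measure" where
  "cesaro x m = measure_pmf (pmf_of_set {..<m}) \<bind> (\<lambda>k. iter k x)"

lemma iter_index_kernel: "(\<lambda>k. iter k x) \<in> count_space UNIV \<rightarrow>\<^sub>M prob_algebra borel"
  by (simp add: iter_in_prob_measures)

lemma cesaro_in_prob_measures: "cesaro x m \<in> prob_measures"
  unfolding cesaro_def by (rule bind_in_prob_algebra[OF pmf_in_prob_algebra iter_index_kernel])

lemma nn_integral_cesaro:
  assumes "0 < m" "f \<in> borel_measurable borel"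
  shows "(\<integral>\<^sup>+y. f y \<partial>cesaro x m) = (\<Sum>k<m. \<integral>\<^sup>+y. f y \<partial>iter k x) / of_nat m"
  unfolding cesaro_def nn_integral_bind_kernel[OF pmf_in_prob_algebra iter_index_kernel assms(2)]
  using assms(1) by (subst nn_integral_pmf_of_set) auto

lemma integral_cesaro:
  fixes f :: "'a \<Rightarrow> real"
  assumes "0 < m" "f \<in> borel_measurable borel" "\<And>y. \<bar>f y\<bar> \<le> B"
  shows "(\<integral>y. f y \<partial>cesaro x m) = (\<Sum>k<m. \<integral>y. f y \<partial>iter k x) / real m"
  unfolding cesaro_def integral_bind_kernel[OF pmf_in_prob_algebra iter_index_kernel assms(2,3)]
  using assms(1) by (subst integral_pmf_of_set) auto

lemma sum_shift_diff:
  fixes F :: "nat \<Rightarrow> real"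
  shows "(\<Sum>k<m. F (k + n)) - (\<Sum>k<m. F k) = (\<Sum>j<n. F (m + j) - F j)"
proof (induction n)
  case (Suc n)
  have "(\<Sum>k<m. F (k + Suc n)) - (\<Sum>k<m. F (k + n)) = F (m + n) - F n"
    using sum_lessThan_telescope[of "\<lambda>k. F (k + n)" m] by (simp add: sum_subtractf)
  then show ?case using Suc by simp
qed simp

lemma kantorovich_cesaro_shift:
  assumes "0 < m"
  shows "kantorovich (cesaro x m \<bind> iter n) (cesaro x m) \<le> real n / real m"
proof (rule kantorovich_leI)
  fix f :: "'a \<Rightarrow> real" assume f: "bLip f"
  note f_props = bLip_measurable[OF f] bLip_bounded[OF f]
  define F where "F k = (\<integral>y. f y \<partial>iter k x)" for k
  have F_shift: "(\<integral>y. (\<integral>z. f z \<partial>iter n y) \<partial>iter k x) = F (k + n)" for k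
    unfolding F_def iter_add by (rule integral_bind_kernel[OF iter_in_prob_measures iter_kernel f_props, symmetric])
  have "(\<integral>y. f y \<partial>(cesaro x m \<bind> iter n)) = (\<integral>y. (\<integral>z. f z \<partial>iter n y) \<partial>cesaro x m)"
    by (rule integral_bind_kernel[OF cesaro_in_prob_measures iter_kernel f_props])
  also have "\<dots> = (\<Sum>k<m. F (k + n)) / real m"
    by (simp add: F_shift integral_cesaro[OF assms integral_kernel_measurable[OF iter_kernel f_props(1)]
          integral_prob_bounded[OF iter_in_prob_measures f_props]])
  finally have "(\<integral>y. f y \<partial>(cesaro x m \<bind> iter n)) - (\<integral>y. f y \<partial>cesaro x m)
      = (\<Sum>j<n. F (m + j) - F j) / real m"
    by (simp add: integral_cesaro[OF assms f_props] F_def[symmetric] sum_shift_diff flip: diff_divide_distrib)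
  also have "\<dots> \<le> (\<Sum>j<n. 1) / real m"
    unfolding F_def
    by (intro divide_right_mono sum_mono bLip_integral_diff_le_1[OF iter_in_prob_measures iter_in_prob_measures f]) simp
  finally show "(\<integral>y. f y \<partial>(cesaro x m \<bind> iter n)) - (\<integral>y. f y \<partial>cesaro x m) \<le> real n / real m" by simp
qed

lemma cesaro_almost_invariant:
  assumes "0 < m" and f: "bLip f"
  shows "(\<integral>y. (\<integral>z. f z \<partial>Q y) \<partial>cesaro x m) - (\<integral>y. f y \<partial>cesaro x m) \<le> 1 / real m"
proof -
  note f_props = bLip_measurable[OF f] bLip_bounded[OF f]
  let ?\<nu> = "cesaro x m \<bind> iter (Suc 0)"
  have "?\<nu> \<in> prob_measures" by (rule bind_in_prob_algebra[OF cesaro_in_prob_measures iter_kernel])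
  then have "(\<integral>y. f y \<partial>?\<nu>) - (\<integral>y. f y \<partial>cesaro x m) \<le> kantorovich ?\<nu> (cesaro x m)"
    by (intro order_trans[OF abs_ge_self kantorovich_upper] cesaro_in_prob_measures f)
  also have "\<dots> \<le> 1 / real m" using kantorovich_cesaro_shift[OF assms(1), of x "Suc 0"] by simp
  also have "(\<integral>y. f y \<partial>?\<nu>) = (\<integral>y. (\<integral>z. f z \<partial>Q y) \<partial>cesaro x m)"
    unfolding integral_bind_kernel[OF cesaro_in_prob_measures iter_kernel f_props] iter_Suc_0 ..
  finally show ?thesis .
qed

end

locale drift_kernel = markov_kernel Q for Q :: "'a::polish_space \<Rightarrow> 'a measure" +
  fixes v W :: "'a \<Rightarrow> real" and \<eta> K :: real
  assumes v_measurable [measurable]: "v \<in> borel_measurable borel" and v_nonneg: "\<And>x. 0 \<le> v x"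
    and W_measurable [measurable]: "W \<in> borel_measurable borel" and W_nonneg: "\<And>x. 0 \<le> W x"
    and \<eta>_pos: "0 < \<eta>" and K_nonneg: "0 \<le> K"
    and v_integrable: "\<And>x. integrable (Q x) v"
    and drift: "\<And>x. (\<integral>y. v y \<partial>Q x) + \<eta> * W x \<le> v x + K"
begin

lemma nn_integral_drift: "(\<integral>\<^sup>+y. ennreal (v y) \<partial>Q x) + ennreal (\<eta> * W x) \<le> ennreal (v x + K)"
  using drift[of x] v_integrable v_nonneg W_nonneg \<eta>_pos
  by (simp add: nn_integral_eq_integral integral_nonneg_AE ennreal_leI flip: ennreal_plus)

lemma nn_integral_iter_drift:
  "(\<integral>\<^sup>+y. ennreal (v y) \<partial>iter n x) + ennreal \<eta> * (\<Sum>k<n. \<integral>\<^sup>+y. ennreal (W y) \<partial>iter k x) \<le> ennreal (v x + real n * K)"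
proof (induction n)
  case 0
  then show ?case by (simp add: nn_integral_return)
next
  case (Suc n)
  interpret prob_space "iter n x" by (rule prob_measuresD(1)[OF iter_in_prob_measures])
  note [measurable_cong] = prob_measuresD(2)[OF iter_in_prob_measures]
  note [measurable] = nn_integral_kernel_measurable[OF kernel]
  let ?v = "\<lambda>n. \<integral>\<^sup>+y. ennreal (v y) \<partial>iter n x" and ?W = "\<lambda>k. \<integral>\<^sup>+y. ennreal (W y) \<partial>iter k x"
  have "?v (Suc n) + ennreal \<eta> * ?W n = (\<integral>\<^sup>+y. (\<integral>\<^sup>+z. ennreal (v z) \<partial>Q y) + ennreal (\<eta> * W y) \<partial>iter n x)"
    using \<eta>_pos W_nonneg
    by (simp add: iter_Suc' nn_integral_bind_kernel[OF iter_in_prob_measures kernel] nn_integral_add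
        nn_integral_cmult ennreal_mult del: iter.simps)
  also have "\<dots> \<le> (\<integral>\<^sup>+y. ennreal (v y) + ennreal K \<partial>iter n x)"
    using nn_integral_drift v_nonneg K_nonneg by (intro nn_integral_mono) simp
  also have "\<dots> = ?v n + ennreal K"
    by (simp add: nn_integral_add emeasure_space_1)
  finally have drift_step: "?v (Suc n) + ennreal \<eta> * ?W n \<le> ?v n + ennreal K" .
  have "?v (Suc n) + ennreal \<eta> * (\<Sum>k<Suc n. ?W k) = (?v (Suc n) + ennreal \<eta> * ?W n) + ennreal \<eta> * (\<Sum>k<n. ?W k)"
    by (simp add: distrib_left ac_simps del: iter.simps)
  also have "\<dots> \<le> (?v n + ennreal K) + ennreal \<eta> * (\<Sum>k<n. ?W k)"
    by (intro add_right_mono drift_step)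
  also have "\<dots> = (?v n + ennreal \<eta> * (\<Sum>k<n. ?W k)) + ennreal K"
    by (simp add: ac_simps)
  also have "\<dots> \<le> ennreal (v x + real n * K) + ennreal K" by (intro add_right_mono Suc.IH)
  also have "\<dots> = ennreal (v x + real (Suc n) * K)"
    using K_nonneg v_nonneg[of x] by (simp add: algebra_simps flip: ennreal_plus)
  finally show ?case .
qed

lemma nn_integral_cesaro_drift:
  assumes "0 < m"
  shows "(\<integral>\<^sup>+y. ennreal (W y) \<partial>cesaro x m) \<le> ennreal ((v x + K) / \<eta>)"
proof -
  let ?S = "\<Sum>k<m. \<integral>\<^sup>+y. ennreal (W y) \<partial>iter k x"
  have "ennreal \<eta> * ?S \<le> ennreal (v x + real m * K)"
    by (rule order_trans[OF _ nn_integral_iter_drift]) simp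
  also have "\<dots> \<le> ennreal (\<eta> * ((v x + K) / \<eta> * real m))"
  proof (rule ennreal_leI)
    have "v x \<le> real m * v x" using assms v_nonneg[of x] by (simp add: mult_le_cancel_right1)
    moreover have "\<eta> * ((v x + K) / \<eta> * real m) = (v x + K) * real m" using \<eta>_pos by simp
    ultimately show "v x + real m * K \<le> \<eta> * ((v x + K) / \<eta> * real m)" by (simp add: algebra_simps)
  qed
  also have "\<dots> = ennreal \<eta> * ennreal ((v x + K) / \<eta> * real m)" using \<eta>_pos by (intro ennreal_mult') simp
  finally have "?S \<le> ennreal ((v x + K) / \<eta> * real m)"
    using \<eta>_pos by (simp add: ennreal_mult_le_mult_iff)
  then have "?S / of_nat m \<le> ennreal ((v x + K) / \<eta> * real m) / of_nat m"
    by (rule divide_right_mono_ennreal)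
  also have "\<dots> = ennreal ((v x + K) / \<eta>)"
    using assms v_nonneg[of x] K_nonneg \<eta>_pos by (simp add: divide_ennreal ennreal_of_nat_eq_real_of_nat)
  finally show ?thesis by (simp add: nn_integral_cesaro[OF assms])
qed

lemma drift_target_nonneg: "0 \<le> v x + K - \<eta> * W x"
proof -
  have "0 \<le> (\<integral>y. v y \<partial>Q x)" by (intro integral_nonneg_AE) (simp add: v_nonneg)
  then show ?thesis using drift[of x] by simp
qed

lemma integral_min_le:
  "(\<integral>y. min (v y) k \<partial>Q x) \<le> min (v x + K - \<eta> * W x) k"
proof (rule min.boundedI)
  interpret prob_space "Q x" by (rule prob_measuresD(1)[OF kernel_in_prob_measures])
  note [measurable_cong] = prob_measuresD(2)[OF kernel_in_prob_measures]
  have min_integrable: "integrable (Q x) (\<lambda>y. min (v y) k)"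
    using v_integrable by (intro Bochner_Integration.integrable_min) simp_all
  have "(\<integral>y. min (v y) k \<partial>Q x) \<le> (\<integral>y. v y \<partial>Q x)"
    using min_integrable v_integrable by (intro integral_mono) auto
  also have "\<dots> \<le> v x + K - \<eta> * W x" using drift[of x] by simp
  finally show "(\<integral>y. min (v y) k \<partial>Q x) \<le> v x + K - \<eta> * W x" .
  have "(\<integral>y. min (v y) k \<partial>Q x) \<le> (\<integral>y. k \<partial>Q x)"
    using min_integrable by (intro integral_mono) auto
  then show "(\<integral>y. min (v y) k \<partial>Q x) \<le> k" by (simp add: prob_space)
qed

(* As v need not be integrable under an invariant measure, the drift inequality is integrated for its truncations. *)
definition truncated_gap :: "nat \<Rightarrow> 'a \<Rightarrow> real" where
  "truncated_gap k x = min (v x) (real k) + K - min (v x + K - \<eta> * W x) (real k)"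

lemma truncated_gap_measurable [measurable]: "truncated_gap k \<in> borel_measurable borel"
  unfolding truncated_gap_def[abs_def] by measurable

lemma truncated_gap_nonneg: "0 \<le> truncated_gap k x"
proof -
  have "0 \<le> \<eta> * W x" using \<eta>_pos W_nonneg by simp
  then show ?thesis using K_nonneg unfolding truncated_gap_def by (smt (verit))
qed

lemma truncated_gap_eventually: "\<forall>\<^sub>F k in sequentially. truncated_gap k x = \<eta> * W x"
  using eventually_ge_at_top[of "nat \<lceil>v x + K\<rceil>"]
proof eventually_elim
  case (elim k)
  then have "v x + K \<le> real k" by linarith
  moreover have "0 \<le> \<eta> * W x" using \<eta>_pos W_nonneg by simp
  ultimately show ?case using K_nonneg by (simp add: truncated_gap_def min_absorb1)
qed

context
  fixes \<pi> :: "'a measure"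
  assumes \<pi>: "\<pi> \<in> prob_measures" "\<pi> \<bind> Q = \<pi>"
begin

lemma invariant_nn_integral_truncated_gap_le: "(\<integral>\<^sup>+x. ennreal (truncated_gap k x) \<partial>\<pi>) \<le> ennreal K"
proof -
  interpret prob_space \<pi> by (rule prob_measuresD(1)[OF \<pi>(1)])
  note [measurable_cong] = prob_measuresD(2)[OF \<pi>(1)]
  have integrable: "integrable \<pi> (\<lambda>x. min (v x) (real k))" "integrable \<pi> (\<lambda>x. min (v x + K - \<eta> * W x) (real k))"
    using v_nonneg drift_target_nonneg by (auto intro!: integrable_const_bound[where B="real k"])
  have min_bounded: "\<bar>min (v x) (real k)\<bar> \<le> real k" for x using v_nonneg[of x] by auto
  have "(\<integral>x. min (v x) (real k) \<partial>\<pi>) = (\<integral>x. (\<integral>y. min (v y) (real k) \<partial>Q x) \<partial>\<pi>)"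
    using integral_bind_kernel[OF \<pi>(1) kernel _ min_bounded] by (simp add: \<pi>(2))
  also have "\<dots> \<le> (\<integral>x. min (v x + K - \<eta> * W x) (real k) \<partial>\<pi>)"
  proof (rule integral_mono)
    show "integrable \<pi> (\<lambda>x. \<integral>y. min (v y) (real k) \<partial>Q x)"
      by (rule integrable_bounded_prob[OF \<pi>(1) integral_kernel_measurable[OF kernel]
            integral_prob_bounded[OF kernel_in_prob_measures _ min_bounded]]) simp_all
  qed (rule integrable, rule integral_min_le)
  finally have "(\<integral>x. truncated_gap k x \<partial>\<pi>) \<le> K" using integrable by (simp add: truncated_gap_def prob_space)
  moreover have "integrable \<pi> (truncated_gap k)" unfolding truncated_gap_def[abs_def] using integrable by simp
  ultimately show ?thesis by (simp add: nn_integral_eq_integral truncated_gap_nonneg ennreal_leI)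
qed

lemma invariant_nn_integral_le: "(\<integral>\<^sup>+x. ennreal (W x) \<partial>\<pi>) \<le> ennreal (K / \<eta>)"
proof -
  note [measurable_cong] = prob_measuresD(2)[OF \<pi>(1)]
  have "(\<lambda>k. ennreal (truncated_gap k x)) \<longlonglongrightarrow> ennreal (\<eta> * W x)" for x
    using truncated_gap_eventually[of x] by (intro tendsto_eventually) (auto elim: eventually_mono)
  then have "liminf (\<lambda>k. ennreal (truncated_gap k x)) = ennreal (\<eta> * W x)" for x
    by (intro lim_imp_Liminf) simp_all
  then have "(\<integral>\<^sup>+x. ennreal (\<eta> * W x) \<partial>\<pi>) = (\<integral>\<^sup>+x. liminf (\<lambda>k. ennreal (truncated_gap k x)) \<partial>\<pi>)"
    by simp
  also have "\<dots> \<le> liminf (\<lambda>k. \<integral>\<^sup>+x. ennreal (truncated_gap k x) \<partial>\<pi>)"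
    by (rule nn_integral_liminf) measurable
  also have "\<dots> \<le> ennreal K"
    using Liminf_mono[of "\<lambda>k. \<integral>\<^sup>+x. ennreal (truncated_gap k x) \<partial>\<pi>" "\<lambda>_. ennreal K" sequentially]
      invariant_nn_integral_truncated_gap_le by (simp add: Liminf_const)
  finally have "(\<integral>\<^sup>+x. ennreal (\<eta> * W x) \<partial>\<pi>) \<le> ennreal K" .
  then have "ennreal \<eta> * (\<integral>\<^sup>+x. ennreal (W x) \<partial>\<pi>) \<le> ennreal K"
    using \<eta>_pos W_nonneg by (simp add: ennreal_mult nn_integral_cmult)
  also have "ennreal K = ennreal \<eta> * ennreal (K / \<eta>)"
    using \<eta>_pos K_nonneg by (simp flip: ennreal_mult)
  finally have "ennreal \<eta> * (\<integral>\<^sup>+x. ennreal (W x) \<partial>\<pi>) \<le> ennreal \<eta> * ennreal (K / \<eta>)" .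
  then show ?thesis using \<eta>_pos by (simp add: ennreal_mult_le_mult_iff)
qed

end

end

locale contracting_drift_kernel = drift_kernel Q v W \<eta> K
  for Q :: "'a::polish_space \<Rightarrow> 'a measure" and v W \<eta> K +
  fixes a :: "nat \<Rightarrow> real"
  assumes a_tendsto: "a \<longlonglongrightarrow> 0"
    and contraction: "\<And>n x y. kantorovich (iter n x) (iter n y) \<le> a n * (1 + W x + W y)"
begin

lemma a_nonneg: "0 \<le> a n"
proof (rule ccontr)
  assume "\<not> 0 \<le> a n"
  then have "a n * (1 + W x + W x) < 0" for x using W_nonneg[of x] by (simp add: mult_neg_pos)
  then show False using contraction[of n undefined undefined] by (metis kantorovich_self not_le)
qed

lemma kantorovich_bind_iter_le:
  assumes \<mu>: "\<mu> \<in> prob_measures" "(\<integral>\<^sup>+x. ennreal (W x) \<partial>\<mu>) \<le> ennreal B"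
    and \<nu>: "\<nu> \<in> prob_measures" "(\<integral>\<^sup>+x. ennreal (W x) \<partial>\<nu>) \<le> ennreal B" and "0 \<le> B"
  shows "kantorovich (\<mu> \<bind> iter n) (\<nu> \<bind> iter n) \<le> a n * (1 + 2 * B)"
proof -
  have W: "integrable \<xi> W \<and> (\<integral>x. W x \<partial>\<xi>) \<le> B"
    if "\<xi> \<in> prob_measures" "(\<integral>\<^sup>+x. ennreal (W x) \<partial>\<xi>) \<le> ennreal B" for \<xi>
  proof
    have "W \<in> borel_measurable \<xi>" using that(1) by (simp add: in_prob_measures_iff cong: measurable_cong_sets)
    then show integrable: "integrable \<xi> W"
      using that(2) W_nonneg by (intro integrableI_bounded) (auto intro: le_less_trans)
    show "(\<integral>x. W x \<partial>\<xi>) \<le> B"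
      using that(2) \<open>0 \<le> B\<close> nn_integral_eq_integral[OF integrable] W_nonneg by simp
  qed
  note coupling = product_coupling[OF \<mu>(1) \<nu>(1)]
  interpret prob_space "\<mu> \<Otimes>\<^sub>M \<nu>" by (rule couplingsD(3)[OF coupling])
  have W_integrable: "integrable (\<mu> \<Otimes>\<^sub>M \<nu>) (\<lambda>z. W (fst z))" "integrable (\<mu> \<Otimes>\<^sub>M \<nu>) (\<lambda>z. W (snd z))"
    using W[OF \<mu>] W[OF \<nu>] by (simp_all add: coupling_integral[OF coupling])
  have "kantorovich (\<mu> \<bind> iter n) (\<nu> \<bind> iter n) \<le> (\<integral>z. a n * (1 + W (fst z) + W (snd z)) \<partial>(\<mu> \<Otimes>\<^sub>M \<nu>))"
    using W_integrable contraction by (intro kantorovich_bind_le[OF coupling iter_kernel]) auto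
  also have "\<dots> = a n * (1 + (\<integral>x. W x \<partial>\<mu>) + (\<integral>x. W x \<partial>\<nu>))"
    using W_integrable by (simp add: coupling_integral[OF coupling] prob_space)
  also have "\<dots> \<le> a n * (1 + 2 * B)"
    using W[OF \<mu>] W[OF \<nu>] a_nonneg by (intro mult_left_mono) auto
  finally show ?thesis .
qed

lemma invariant_unique:
  assumes \<pi>: "\<pi> \<in> prob_measures" "\<pi> \<bind> Q = \<pi>" and \<pi>': "\<pi>' \<in> prob_measures" "\<pi>' \<bind> Q = \<pi>'"
  shows "\<pi> = \<pi>'"
proof (rule measure_eqI_kantorovich[OF \<pi>(1) \<pi>'(1)])
  have "kantorovich \<pi> \<pi>' \<le> a n * (1 + 2 * (K / \<eta>))" for n
    using kantorovich_bind_iter_le[OF \<pi>(1) invariant_nn_integral_le[OF \<pi>] \<pi>'(1) invariant_nn_integral_le[OF \<pi>'], of n]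
      K_nonneg \<eta>_pos by (simp add: invariant_iter[OF \<pi>] invariant_iter[OF \<pi>'])
  moreover have "(\<lambda>n. a n * (1 + 2 * (K / \<eta>))) \<longlonglongrightarrow> 0"
    using tendsto_mult_left_zero[OF a_tendsto] .
  ultimately show "kantorovich \<pi> \<pi>' \<le> 0" by (intro LIMSEQ_le_const) auto
qed

lemma cesaro_Cauchy:
  assumes "0 < \<epsilon>"
  obtains N where "\<And>m m'. N \<le> m \<Longrightarrow> N \<le> m' \<Longrightarrow> kantorovich (cesaro x m) (cesaro x m') \<le> \<epsilon>"
proof -
  define B where "B = (v x + K) / \<eta>"
  have B: "0 \<le> B" using v_nonneg[of x] K_nonneg \<eta>_pos by (simp add: B_def)
  have "(\<lambda>n. a n * (1 + 2 * B)) \<longlonglongrightarrow> 0" using tendsto_mult_left_zero[OF a_tendsto] .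
  then have "\<forall>\<^sub>F n in sequentially. a n * (1 + 2 * B) < \<epsilon> / 3" using assms by (intro order_tendstoD) auto
  then obtain n where n: "a n * (1 + 2 * B) < \<epsilon> / 3" by (auto dest: eventually_happens)
  define N where "N = Suc (nat \<lceil>3 * real n / \<epsilon>\<rceil>)"
  have shift: "kantorovich (cesaro x m \<bind> iter n) (cesaro x m) \<le> \<epsilon> / 3" if "N \<le> m" for m
  proof -
    have "3 * real n / \<epsilon> \<le> real m" "0 < m" using that unfolding N_def by linarith+
    then have "real n / real m \<le> \<epsilon> / 3" using assms by (simp add: field_simps)
    then show ?thesis using kantorovich_cesaro_shift[OF \<open>0 < m\<close>, of x n] by linarith
  qed
  have "kantorovich (cesaro x m) (cesaro x m') \<le> \<epsilon>" if "N \<le> m" "N \<le> m'" for m m'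
  proof -
    let ?\<mu> = "cesaro x m" and ?\<nu> = "cesaro x m'"
    have in_prob: "?\<mu> \<in> prob_measures" "?\<nu> \<in> prob_measures" "?\<mu> \<bind> iter n \<in> prob_measures" "?\<nu> \<bind> iter n \<in> prob_measures"
      by (intro cesaro_in_prob_measures bind_in_prob_algebra[OF _ iter_kernel])+
    have "0 < m" "0 < m'" using that by (auto simp: N_def)
    then have "kantorovich (?\<mu> \<bind> iter n) (?\<nu> \<bind> iter n) \<le> a n * (1 + 2 * B)"
      unfolding B_def
      by (intro kantorovich_bind_iter_le cesaro_in_prob_measures nn_integral_cesaro_drift) (use B in \<open>simp_all add: B_def\<close>)
    then show ?thesis
      using kantorovich_triangle[OF in_prob(1,3,2)] kantorovich_triangle[OF in_prob(3,4,2)]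
        kantorovich_commute[OF in_prob(1,3)] shift[OF that(1)] shift[OF that(2)] n by linarith
  qed
  then show ?thesis using that by blast
qed

lemma cesaro_weakly_convergent_subsequence:
  obtains m \<pi> where "\<And>k. k < m k" "\<pi> \<in> prob_measures" "weakly_converges (\<lambda>k. cesaro x (m k)) \<pi>"
proof -
  have "\<exists>N. \<forall>m m'. N \<le> m \<longrightarrow> N \<le> m' \<longrightarrow> kantorovich (cesaro x m) (cesaro x m') \<le> (1 / 2) ^ k" for k
    using cesaro_Cauchy[of "(1 / 2) ^ k" x] by (metis zero_less_divide_1_iff zero_less_numeral zero_less_power)
  then obtain N where N: "\<And>k m m'. N k \<le> m \<Longrightarrow> N k \<le> m' \<Longrightarrow> kantorovich (cesaro x m) (cesaro x m') \<le> (1 / 2) ^ k"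
    by metis
  define m where "m k = Suc (k + (\<Sum>i\<le>k. N i))" for k
  have N_le: "N k \<le> m k" "N k \<le> m (Suc k)" for k
    using member_le_sum[of k "{..k}" N] by (auto simp: m_def)
  have "summable (\<lambda>k. kantorovich (cesaro x (m k)) (cesaro x (m (Suc k))))"
  proof (rule summable_comparison_test')
    show "norm (kantorovich (cesaro x (m k)) (cesaro x (m (Suc k)))) \<le> (1 / 2) ^ k" for k
      using N[OF N_le] kantorovich_nonneg[OF cesaro_in_prob_measures cesaro_in_prob_measures] by simp
  qed (simp add: summable_geometric)
  then obtain \<pi> where "\<pi> \<in> prob_measures" "weakly_converges (\<lambda>k. cesaro x (m k)) \<pi>"
    using kantorovich_complete[of "\<lambda>k. cesaro x (m k)"] cesaro_in_prob_measures by blast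
  then show ?thesis using that[of m \<pi>] by (simp add: m_def)
qed

lemma invariant_exists:
  assumes feller: "\<And>f :: 'a \<Rightarrow> real. continuous_on UNIV f \<Longrightarrow> bounded (range f) \<Longrightarrow> continuous_on UNIV (\<lambda>x. \<integral>y. f y \<partial>Q x)"
  obtains \<pi> where "\<pi> \<in> prob_measures" "\<pi> \<bind> Q = \<pi>"
proof -
  obtain m \<pi> where m: "\<And>k. k < m k" and \<pi>: "\<pi> \<in> prob_measures"
    and limit: "weakly_converges (\<lambda>k. cesaro undefined (m k)) \<pi>"
    using cesaro_weakly_convergent_subsequence by blast
  let ?\<mu> = "\<lambda>k. cesaro undefined (m k)"
  have \<pi>Q: "\<pi> \<bind> Q \<in> prob_measures" by (rule bind_in_prob_algebra[OF \<pi> kernel])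
  have "\<pi> \<bind> Q = \<pi>"
  proof (rule measure_eqI_kantorovich[OF \<pi>Q \<pi>], rule kantorovich_leI)
    fix f :: "'a \<Rightarrow> real" assume f: "bLip f"
    note f_props = bLip_measurable[OF f] bLip_bounded[OF f]
    define g where "g y = (\<integral>z. f z \<partial>Q y)" for y
    have "bounded (range f)" "bounded (range g)"
      using f_props(2) integral_prob_bounded[OF kernel_in_prob_measures f_props] by (auto simp: bounded_iff g_def)
    then have limits: "(\<lambda>k. \<integral>y. f y \<partial>?\<mu> k) \<longlonglongrightarrow> (\<integral>y. f y \<partial>\<pi>)" "(\<lambda>k. \<integral>y. g y \<partial>?\<mu> k) \<longlonglongrightarrow> (\<integral>y. g y \<partial>\<pi>)"
      using limit bLip_continuous[OF f] feller[of f] unfolding weakly_converges_def g_def by blast+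
    have "(\<integral>y. g y \<partial>?\<mu> k) - (\<integral>y. f y \<partial>?\<mu> k) \<le> 1 / real k" if "0 < k" for k
    proof -
      have "(\<integral>y. g y \<partial>?\<mu> k) - (\<integral>y. f y \<partial>?\<mu> k) \<le> 1 / real (m k)"
        unfolding g_def using m[of k] by (intro cesaro_almost_invariant f) simp
      also have "\<dots> \<le> 1 / real k" using m[of k] that by (simp add: frac_le)
      finally show ?thesis .
    qed
    then have "\<exists>N. \<forall>k\<ge>N. (\<integral>y. g y \<partial>?\<mu> k) - (\<integral>y. f y \<partial>?\<mu> k) \<le> 1 / real k"
      by (intro exI[of _ 1]) simp
    then have "(\<integral>y. g y \<partial>\<pi>) - (\<integral>y. f y \<partial>\<pi>) \<le> 0"
      by (rule LIMSEQ_le[OF tendsto_diff[OF limits(2,1)] lim_1_over_n])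
    then show "(\<integral>y. f y \<partial>(\<pi> \<bind> Q)) - (\<integral>y. f y \<partial>\<pi>) \<le> 0"
      unfolding g_def by (simp add: integral_bind_kernel[OF \<pi> kernel f_props])
  qed
  then show ?thesis using that \<pi> by blast
qed

end

section \<open>Subgeometric contraction of Harris chains\<close>

lemma wasserstein_le_if_small_on:
  assumes \<mu>: "\<mu> \<in> prob_measures" and \<nu>: "\<nu> \<in> prob_measures" and D: "D \<in> sets borel"
    and d: "\<And>x y. d x y \<le> 1" "\<And>x y. x \<in> D \<Longrightarrow> y \<in> D \<Longrightarrow> d x y \<le> 1 / 2"
  shows "wasserstein d \<mu> \<nu> \<le> ennreal (1 - 1 / 2 * (measure \<mu> D * measure \<nu> D))"
proof -
  note coupling = product_coupling[OF \<mu> \<nu>]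
  interpret \<nu>: prob_space \<nu> by (rule prob_measuresD(1)[OF \<nu>])
  interpret pair: prob_space "\<mu> \<Otimes>\<^sub>M \<nu>" by (rule couplingsD(3)[OF coupling])
  have square_measurable: "D \<times> D \<in> sets (\<mu> \<Otimes>\<^sub>M \<nu>)" unfolding couplingsD(2)[OF coupling] by (intro pair_measureI D)
  then have indicator_integrable: "integrable (\<mu> \<Otimes>\<^sub>M \<nu>) (indicat_real (D \<times> D))"
    by (rule integrable_real_indicator) (simp add: less_top[symmetric])
  have "wasserstein d \<mu> \<nu> \<le> (\<integral>\<^sup>+z. ennreal (d (fst z) (snd z)) \<partial>(\<mu> \<Otimes>\<^sub>M \<nu>))"
    unfolding wasserstein_def by (rule INF_lower[OF coupling])
  also have "\<dots> \<le> (\<integral>\<^sup>+z. ennreal (1 - 1 / 2 * indicator (D \<times> D) z) \<partial>(\<mu> \<Otimes>\<^sub>M \<nu>))"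
    using d by (intro nn_integral_mono ennreal_leI) (auto split: split_indicator)
  also have "\<dots> = ennreal (\<integral>z. 1 - 1 / 2 * indicator (D \<times> D) z \<partial>(\<mu> \<Otimes>\<^sub>M \<nu>))"
    using square_measurable by (intro nn_integral_eq_integral pair.integrable_const_bound[where B=1]) (auto split: split_indicator)
  also have "(\<integral>z. 1 - 1 / 2 * indicator (D \<times> D) z \<partial>(\<mu> \<Otimes>\<^sub>M \<nu>)) = 1 - 1 / 2 * pair.prob (D \<times> D)"
    using indicator_integrable square_measurable by (simp add: pair.prob_space)
  also have "pair.prob (D \<times> D) = measure \<mu> D * measure \<nu> D"
    using prob_measuresD(2)[OF \<mu>] prob_measuresD(2)[OF \<nu>] D
    by (simp add: measure_def \<nu>.emeasure_pair_measure_Times enn2real_mult)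
  finally show ?thesis .
qed

lemma wasserstein_le_1:
  assumes "\<mu> \<in> prob_measures" "\<nu> \<in> prob_measures" "\<And>x y. d x y \<le> 1"
  shows "wasserstein d \<mu> \<nu> \<le> 1"
  using wasserstein_le_if_small_on[OF assms(1,2), of "{}" d] assms(3) by simp

lemma kantorovich_return_le: "kantorovich (return borel x) (return borel y) \<le> bdist x y"
proof (rule kantorovich_leI)
  fix f :: "'a \<Rightarrow> real" assume f: "bLip f"
  have [measurable]: "f \<in> borel_measurable borel" by (rule bLip_measurable[OF f])
  show "(\<integral>x. f x \<partial>return borel x) - (\<integral>x. f x \<partial>return borel y) \<le> bdist x y"
    using f by (simp add: integral_return bLip_def)
qed

(* The extra lower bound 4 * K <= eta * phi (v x) is arranged by adding a constant to the Lyapunov function. *)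
locale harris_kernel = markov_kernel Q + concave_rate \<phi>
  for Q :: "'a::polish_space \<Rightarrow> 'a measure" and \<phi> :: "real \<Rightarrow> real" +
  fixes d :: "'a \<Rightarrow> 'a \<Rightarrow> real" and v :: "'a \<Rightarrow> real" and \<gamma> M \<eta> K :: real
  assumes d_measurable: "(\<lambda>z. d (fst z) (snd z)) \<in> borel_measurable (borel \<Otimes>\<^sub>M borel)"
    and bdist_le_d: "\<And>x y. bdist x y \<le> d x y" and d_le_1: "\<And>x y. d x y \<le> 1"
    and \<gamma>: "0 < \<gamma>" "\<gamma> < 1"
    and contracting: "\<And>x y. d x y < 1 \<Longrightarrow> wasserstein d (Q x) (Q y) \<le> ennreal (\<gamma> * d x y)"
    and small: "\<And>x y. v x \<le> M \<Longrightarrow> v y \<le> M \<Longrightarrow> wasserstein d (Q x) (Q y) \<le> ennreal \<gamma>"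
    and v_measurable [measurable]: "v \<in> borel_measurable borel" and v_ge_1: "\<And>x. 1 \<le> v x"
    and v_integrable: "\<And>x. integrable (Q x) v"
    and \<eta>_pos: "0 < \<eta>" and K_pos: "0 < K" and K_le: "\<And>x. 4 * K \<le> \<eta> * \<phi> (v x)"
    and growth: "\<And>x. (\<integral>y. v y \<partial>Q x) \<le> v x + K"
    and decay: "\<And>x. M < v x \<Longrightarrow> (\<integral>y. v y \<partial>Q x) \<le> v x - \<eta> * \<phi> (v x)"
begin

lemma d_nonneg: "0 \<le> d x y"
  using bdist_le_d[of x y] bdist_nonneg[of x y] by linarith

lemma v_nonneg: "0 \<le> v x"
  using v_ge_1[of x] by simp

lemma phi_v_pos: "0 < \<phi> (v x)"
  using v_ge_1[of x] by (intro pos) simp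

definition weight :: "real \<Rightarrow> real \<Rightarrow> real \<Rightarrow> nat \<Rightarrow> 'a \<Rightarrow> real" where
  "weight l s \<beta> n x = (1 - \<eta> / 4 * l) ^ n * exp_weight l s (v x) + (1 / 2 + \<beta> * v x) / (\<beta> * s)"

context
  fixes l s \<beta> :: real
  assumes l: "0 < l" "l \<le> \<phi>' s" "\<eta> / 4 * l < 1" and s: "1 \<le> s" and \<beta>: "0 < \<beta>"
begin

lemma exp_weight_v_ge_1: "1 \<le> exp_weight l s (v x)"
  using l s v_ge_1 by (intro exp_weight_ge_1) auto

lemma weight_ge: "(1 / 2 + \<beta> * v x) / (\<beta> * s) \<le> weight l s \<beta> n x"
  using exp_weight_v_ge_1[of x] l by (simp add: weight_def)

lemma weight_nonneg: "0 \<le> weight l s \<beta> n x"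
proof -
  have "0 \<le> (1 / 2 + \<beta> * v x) / (\<beta> * s)" using \<beta> s v_nonneg[of x] by simp
  then show ?thesis using weight_ge[of x n] by linarith
qed

lemma exp_weight_v_measurable [measurable]: "(\<lambda>x. exp_weight l s (v x)) \<in> borel_measurable borel"
  using l s v_ge_1 by (intro exp_weight_comp_measurable) auto

lemma weight_measurable: "weight l s \<beta> n \<in> borel_measurable borel"
  unfolding weight_def[abs_def] by measurable

lemma exp_weight_v_integrable: "integrable (Q x) (\<lambda>y. exp_weight l s (v y))"
proof (rule integrable_bounded_prob[OF kernel_in_prob_measures])
  show "\<bar>exp_weight l s (v y)\<bar> \<le> exp (l * H s)" for y
    using l s v_ge_1 unfolding exp_weight_def by (auto intro!: mult_left_mono H_mono)
qed measurable

lemma weight_integrable: "integrable (Q x) (weight l s \<beta> n)"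
proof -
  interpret prob_space "Q x" by (rule prob_measuresD(1)[OF kernel_in_prob_measures])
  show ?thesis
    unfolding weight_def[abs_def] using exp_weight_v_integrable v_integrable by simp
qed

lemma integral_weight:
  "(\<integral>y. weight l s \<beta> n y \<partial>Q x)
    = (1 - \<eta> / 4 * l) ^ n * (\<integral>y. exp_weight l s (v y) \<partial>Q x) + (1 / 2 + \<beta> * (\<integral>y. v y \<partial>Q x)) / (\<beta> * s)"
proof -
  interpret prob_space "Q x" by (rule prob_measuresD(1)[OF kernel_in_prob_measures])
  show ?thesis
    unfolding weight_def[abs_def] using exp_weight_v_integrable v_integrable by (simp add: prob_space)
qed

lemma integral_exp_weight_le:
  assumes "1 \<le> u" "u \<le> s"
  shows "(\<integral>y. exp_weight l s (v y) \<partial>Q x) \<le> exp_weight l s u + l * (exp_weight l s u / \<phi> u) * ((\<integral>y. v y \<partial>Q x) - u)"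
proof -
  interpret prob_space "Q x" by (rule prob_measuresD(1)[OF kernel_in_prob_measures])
  have "(\<integral>y. exp_weight l s (v y) \<partial>Q x) \<le> (\<integral>y. exp_weight l s u + l * (exp_weight l s u / \<phi> u) * (v y - u) \<partial>Q x)"
    using exp_weight_v_integrable v_integrable assms l v_ge_1
    by (intro integral_mono exp_weight_tangent) auto
  also have "\<dots> = exp_weight l s u + l * (exp_weight l s u / \<phi> u) * ((\<integral>y. v y \<partial>Q x) - u)"
    using v_integrable by (simp add: prob_space)
  finally show ?thesis .
qed

lemma exp_weight_growth: "(\<integral>y. exp_weight l s (v y) \<partial>Q x) \<le> (1 + \<eta> / 4 * l) * exp_weight l s (v x)"
proof (cases "v x \<le> s")
  case True
  let ?w = "exp_weight l s (v x)"
  have "K / \<phi> (v x) \<le> \<eta> / 4"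
    using K_le[of x] phi_v_pos[of x] by (simp add: divide_le_eq)
  have "l * (?w / \<phi> (v x)) * ((\<integral>y. v y \<partial>Q x) - v x) \<le> l * (?w / \<phi> (v x)) * K"
    using growth[of x] l exp_weight_v_ge_1[of x] phi_v_pos[of x] by (intro mult_left_mono) auto
  also have "\<dots> = l * ?w * (K / \<phi> (v x))" by simp
  also have "\<dots> \<le> l * ?w * (\<eta> / 4)"
    using \<open>K / \<phi> (v x) \<le> \<eta> / 4\<close> l exp_weight_v_ge_1[of x] by (intro mult_left_mono) auto
  finally have "(\<integral>y. exp_weight l s (v y) \<partial>Q x) \<le> ?w + l * ?w * (\<eta> / 4)"
    using integral_exp_weight_le[OF v_ge_1 True, of x] by linarith
  then show ?thesis by (simp add: algebra_simps)
next
  case False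
  interpret prob_space "Q x" by (rule prob_measuresD(1)[OF kernel_in_prob_measures])
  have "exp_weight l s (v y) \<le> exp_weight l s (v x)" for y
    using False l s v_ge_1 unfolding exp_weight_def by (auto intro!: mult_left_mono H_mono)
  then have "(\<integral>y. exp_weight l s (v y) \<partial>Q x) \<le> (\<integral>y. exp_weight l s (v x) \<partial>Q x)"
    using exp_weight_v_integrable by (intro integral_mono) auto
  moreover have "0 \<le> \<eta> / 4 * l * exp_weight l s (v x)"
    using l \<eta>_pos exp_weight_v_ge_1[of x] by simp
  ultimately show ?thesis by (simp add: prob_space algebra_simps)
qed

lemma exp_weight_decay:
  assumes "M < v x" "v x \<le> s"
  shows "(\<integral>y. exp_weight l s (v y) \<partial>Q x) \<le> (1 - \<eta> * l) * exp_weight l s (v x)"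
proof -
  have "l * (exp_weight l s (v x) / \<phi> (v x)) * ((\<integral>y. v y \<partial>Q x) - v x)
      \<le> l * (exp_weight l s (v x) / \<phi> (v x)) * (- (\<eta> * \<phi> (v x)))"
    using decay[OF assms(1)] l exp_weight_v_ge_1[of x] phi_v_pos[of x] by (intro mult_left_mono) auto
  also have "\<dots> = - (\<eta> * l * exp_weight l s (v x))" using phi_v_pos[of x] by simp
  finally show ?thesis
    using integral_exp_weight_le[OF v_ge_1 assms(2), of x] by (simp add: algebra_simps)
qed

lemma weight_growth:
  assumes \<Lambda>: "1 + 2 * \<beta> * K \<le> \<Lambda>" "1 + \<eta> / 4 * l \<le> \<Lambda> * (1 - \<eta> / 4 * l)"
  shows "(\<integral>y. weight l s \<beta> n y \<partial>Q x) \<le> \<Lambda> * weight l s \<beta> (Suc n) x"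
proof -
  have "(\<integral>y. exp_weight l s (v y) \<partial>Q x) \<le> \<Lambda> * (1 - \<eta> / 4 * l) * exp_weight l s (v x)"
    using exp_weight_growth[of x] mult_right_mono[OF \<Lambda>(2), of "exp_weight l s (v x)"] exp_weight_v_ge_1[of x]
    by linarith
  then have "(1 - \<eta> / 4 * l) ^ n * (\<integral>y. exp_weight l s (v y) \<partial>Q x)
      \<le> (1 - \<eta> / 4 * l) ^ n * (\<Lambda> * (1 - \<eta> / 4 * l) * exp_weight l s (v x))"
    using l by (intro mult_left_mono) auto
  moreover have "(1 / 2 + \<beta> * (\<integral>y. v y \<partial>Q x)) / (\<beta> * s) \<le> \<Lambda> * (1 / 2 + \<beta> * v x) / (\<beta> * s)"
  proof (rule divide_right_mono)
    have "\<beta> * (\<integral>y. v y \<partial>Q x) \<le> \<beta> * (v x + K)" using growth \<beta> by (intro mult_left_mono) auto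
    moreover have "(1 + 2 * \<beta> * K) * (1 / 2 + \<beta> * v x) \<le> \<Lambda> * (1 / 2 + \<beta> * v x)"
      using \<Lambda>(1) \<beta> v_nonneg[of x] by (intro mult_right_mono) auto
    moreover have "0 \<le> 2 * \<beta> * K * (\<beta> * v x)" using \<beta> K_pos v_nonneg[of x] by simp
    ultimately show "1 / 2 + \<beta> * (\<integral>y. v y \<partial>Q x) \<le> \<Lambda> * (1 / 2 + \<beta> * v x)" by (simp add: algebra_simps)
  qed (use \<beta> s in simp)
  ultimately show ?thesis
    unfolding integral_weight by (simp add: weight_def distrib_left mult_ac)
qed

lemma weight_pair_decay:
  assumes x: "M < v x" "v x \<le> s" and "v y \<le> v x"
  shows "(\<integral>z. weight l s \<beta> n z \<partial>Q x) + (\<integral>z. weight l s \<beta> n z \<partial>Q y) \<le> weight l s \<beta> (Suc n) x + weight l s \<beta> (Suc n) y"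
proof -
  let ?b = "(1 - \<eta> / 4 * l) ^ n" and ?w = "\<lambda>x. exp_weight l s (v x)"
  have "?w y \<le> ?w x" using assms l s v_ge_1 by (intro exp_weight_mono) auto
  then have "\<eta> * l * ?w y \<le> \<eta> * l * ?w x" using l \<eta>_pos by (intro mult_left_mono) auto
  moreover have "0 \<le> \<eta> * l * ?w x" using l \<eta>_pos exp_weight_v_ge_1[of x] by simp
  ultimately have "(1 - \<eta> * l) * ?w x + (1 + \<eta> / 4 * l) * ?w y \<le> (1 - \<eta> / 4 * l) * (?w x + ?w y)"
    by (simp add: algebra_simps)
  then have "(\<integral>z. ?w z \<partial>Q x) + (\<integral>z. ?w z \<partial>Q y) \<le> (1 - \<eta> / 4 * l) * (?w x + ?w y)"
    using exp_weight_decay[OF x] exp_weight_growth[of y] by linarith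
  then have exp_part: "?b * ((\<integral>z. ?w z \<partial>Q x) + (\<integral>z. ?w z \<partial>Q y)) \<le> ?b * ((1 - \<eta> / 4 * l) * (?w x + ?w y))"
    using l by (intro mult_left_mono) auto
  have "0 \<le> \<eta> * \<phi> (v x)" using \<eta>_pos phi_v_pos[of x] by simp
  then have "(\<integral>z. v z \<partial>Q x) + (\<integral>z. v z \<partial>Q y) \<le> v x + v y"
    using decay[OF x(1)] growth[of y] K_le[of x] K_pos by linarith
  then have "\<beta> * ((\<integral>z. v z \<partial>Q x) + (\<integral>z. v z \<partial>Q y)) \<le> \<beta> * (v x + v y)" using \<beta> by simp
  then have linear_part: "(1 + \<beta> * ((\<integral>z. v z \<partial>Q x) + (\<integral>z. v z \<partial>Q y))) / (\<beta> * s) \<le> (1 + \<beta> * (v x + v y)) / (\<beta> * s)"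
    using \<beta> s by (intro divide_right_mono) auto
  have "(\<integral>z. weight l s \<beta> n z \<partial>Q x) + (\<integral>z. weight l s \<beta> n z \<partial>Q y)
      = ?b * ((\<integral>z. ?w z \<partial>Q x) + (\<integral>z. ?w z \<partial>Q y)) + (1 + \<beta> * ((\<integral>z. v z \<partial>Q x) + (\<integral>z. v z \<partial>Q y))) / (\<beta> * s)"
    unfolding integral_weight by (simp add: algebra_simps add_divide_distrib)
  also have "\<dots> \<le> ?b * ((1 - \<eta> / 4 * l) * (?w x + ?w y)) + (1 + \<beta> * (v x + v y)) / (\<beta> * s)"
    by (intro add_mono exp_part linear_part)
  also have "\<dots> = weight l s \<beta> (Suc n) x + weight l s \<beta> (Suc n) y"
    by (simp add: weight_def algebra_simps add_divide_distrib)
  finally show ?thesis .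
qed

lemma weight_0_sum_ge_1: "1 \<le> weight l s \<beta> 0 x + weight l s \<beta> 0 y"
proof -
  have "0 \<le> (1 / 2 + \<beta> * v x) / (\<beta> * s)" using \<beta> s v_nonneg[of x] by simp
  then show ?thesis using exp_weight_v_ge_1[of x] weight_nonneg[of 0 y] by (simp add: weight_def)
qed

lemma weight_sum_ge_1:
  assumes "s < max (v x) (v y)"
  shows "1 \<le> weight l s \<beta> n x + weight l s \<beta> n y"
proof -
  have "\<beta> * s \<le> \<beta> * (v x + v y)" using assms \<beta> v_nonneg[of x] v_nonneg[of y] by (intro mult_left_mono) auto
  then have "1 \<le> (1 / 2 + \<beta> * v x + (1 / 2 + \<beta> * v y)) / (\<beta> * s)"
    using \<beta> s by (simp add: le_divide_eq algebra_simps)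
  then show ?thesis using weight_ge[of x n] weight_ge[of y n] by (simp add: add_divide_distrib)
qed

context
  fixes q \<Lambda> :: real
  assumes q: "0 < q" "q < 1"
    and \<Lambda>: "1 + 2 * \<beta> * K \<le> \<Lambda>" "1 + \<eta> / 4 * l \<le> \<Lambda> * (1 - \<eta> / 4 * l)" "\<gamma> powr (1 - q) * \<Lambda> powr q \<le> 1"
begin

lemma kantorovich_iter_0_le:
  "kantorovich (iter 0 x) (iter 0 y) \<le> d x y powr (1 - q) * (weight l s \<beta> 0 x + weight l s \<beta> 0 y) powr q"
proof -
  have "kantorovich (iter 0 x) (iter 0 y) \<le> d x y"
    using kantorovich_return_le[of x y] bdist_le_d[of x y] by simp
  also have "\<dots> \<le> d x y powr (1 - q)"
    using powr_mono'[of "1 - q" 1 "d x y"] q d_nonneg[of x y] d_le_1[of x y] by simp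
  also have "\<dots> \<le> d x y powr (1 - q) * (weight l s \<beta> 0 x + weight l s \<beta> 0 y) powr q"
    using weight_0_sum_ge_1[of x y] q ge_one_powr_ge_zero[of _ q] by (simp add: mult_le_cancel_left1)
  finally show ?thesis .
qed

lemma contraction_absorbs_growth:
  "(\<gamma> * A) powr (1 - q) * (\<Lambda> * S) powr q \<le> A powr (1 - q) * S powr q"
proof -
  have "(\<gamma> * A) powr (1 - q) * (\<Lambda> * S) powr q = (\<gamma> powr (1 - q) * \<Lambda> powr q) * (A powr (1 - q) * S powr q)"
    by (simp add: powr_mult)
  also have "\<dots> \<le> 1 * (A powr (1 - q) * S powr q)" using \<Lambda>(3) by (intro mult_right_mono) auto
  finally show ?thesis by simp
qed

context
  fixes n :: nat
  assumes IH: "\<And>x y. kantorovich (iter n x) (iter n y)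
    \<le> d x y powr (1 - q) * (weight l s \<beta> n x + weight l s \<beta> n y) powr q"
begin

lemma kantorovich_iter_Suc_le_if_wasserstein_le:
  assumes "wasserstein d (Q x) (Q y) \<le> ennreal A" "0 \<le> A"
    and "(\<integral>z. weight l s \<beta> n z \<partial>Q x) + (\<integral>z. weight l s \<beta> n z \<partial>Q y) \<le> B"
  shows "kantorovich (iter (Suc n) x) (iter (Suc n) y) \<le> A powr (1 - q) * B powr q"
  unfolding iter.simps
  by (rule kantorovich_bind_wasserstein_le[OF assms(1,2) iter_kernel d_measurable d_nonneg weight_measurable
        weight_integrable weight_integrable weight_nonneg assms(3) IH q])

lemma kantorovich_iter_Suc_le:
  "kantorovich (iter (Suc n) x) (iter (Suc n) y)
    \<le> d x y powr (1 - q) * (weight l s \<beta> (Suc n) x + weight l s \<beta> (Suc n) y) powr q"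
proof -
  let ?J = "weight l s \<beta>"
  define S where "S = ?J (Suc n) x + ?J (Suc n) y"
  have "(\<integral>z. ?J n z \<partial>Q x) + (\<integral>z. ?J n z \<partial>Q y) \<le> \<Lambda> * S"
    using weight_growth[OF \<Lambda>(1,2), where n=n and x=x] weight_growth[OF \<Lambda>(1,2), where n=n and x=y]
    by (simp add: S_def distrib_left)
  then have contracted: "kantorovich (iter (Suc n) x) (iter (Suc n) y) \<le> A powr (1 - q) * S powr q"
    if "wasserstein d (Q x) (Q y) \<le> ennreal (\<gamma> * A)" "0 \<le> A" for A
    using kantorovich_iter_Suc_le_if_wasserstein_le[OF that(1)] contraction_absorbs_growth[of A S] \<gamma>(1) that(2)
    by force
  consider "d x y < 1" | "d x y = 1" "v x \<le> M" "v y \<le> M" | "d x y = 1" "s < max (v x) (v y)"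
    | "d x y = 1" "M < max (v x) (v y)" "max (v x) (v y) \<le> s"
    using d_le_1[of x y] by linarith
  then show ?thesis
  proof cases
    case 1
    then show ?thesis using contracted[OF contracting d_nonneg] by (simp add: S_def)
  next
    case 2
    then show ?thesis using contracted[of 1] small by (simp add: S_def)
  next
    case 3
    then have "1 \<le> S powr q" unfolding S_def using q by (intro ge_one_powr_ge_zero weight_sum_ge_1) auto
    then show ?thesis
      using kantorovich_le_1[OF iter_in_prob_measures iter_in_prob_measures, of "Suc n" x "Suc n" y] 3 by (simp add: S_def)
  next
    case 4
    then have "(\<integral>z. ?J n z \<partial>Q x) + (\<integral>z. ?J n z \<partial>Q y) \<le> S"
      using weight_pair_decay[of x y n] weight_pair_decay[of y x n] unfolding S_def by (cases "v y \<le> v x") auto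
    moreover have "wasserstein d (Q x) (Q y) \<le> ennreal 1"
      using wasserstein_le_1[OF kernel_in_prob_measures kernel_in_prob_measures d_le_1] by simp
    ultimately show ?thesis using kantorovich_iter_Suc_le_if_wasserstein_le[of x y 1 S] 4(1) by (simp add: S_def)
  qed
qed

end

lemma kantorovich_iter_le_weight:
  "kantorovich (iter n x) (iter n y) \<le> (weight l s \<beta> n x + weight l s \<beta> n y) powr q"
proof -
  have "kantorovich (iter n x) (iter n y) \<le> d x y powr (1 - q) * (weight l s \<beta> n x + weight l s \<beta> n y) powr q"
  proof (induction n arbitrary: x y)
    case 0
    show ?case by (rule kantorovich_iter_0_le)
  next
    case (Suc n)
    then show ?case by (rule kantorovich_iter_Suc_le)
  qed
  also have "\<dots> \<le> 1 * (weight l s \<beta> n x + weight l s \<beta> n y) powr q"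
    using q d_nonneg[of x y] d_le_1[of x y] by (intro mult_right_mono powr_le1) auto
  finally show ?thesis by simp
qed

end

lemma discounted_exp_weight_le:
  assumes \<epsilon>: "0 < \<epsilon>" "l = \<epsilon> * \<phi>' s" and q: "q < 1"
    and a: "0 < a" and R: "s \<le> R" and ratio: "\<phi> R / \<phi> s = (\<phi> R / \<phi> a) powr (1 - q)"
    and H_R_le: "(1 + 1 / (\<epsilon> * (1 - q))) * H R \<le> \<eta> / 4 * real n"
  shows "(1 - \<eta> / 4 * l) ^ n * exp_weight l s (v x) \<le> \<phi> a / \<phi> R"
proof -
  have pos: "0 < \<phi> a" "0 < \<phi> R" using a R s by (auto intro!: pos)
  have "(1 - q) * ln (\<phi> R / \<phi> a) = ln (\<phi> R / \<phi> s)" using pos by (simp add: ratio ln_powr)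
  also have "\<dots> \<le> \<phi>' s * (H R - H s)" by (rule ln_ratio_le_derivative_mult_H[OF s R])
  also have "\<dots> \<le> \<phi>' s * H R" using derivative_pos[of s] s H_nonneg[OF s] by (intro mult_left_mono) auto
  finally have ln_le: "ln (\<phi> R / \<phi> a) \<le> \<phi>' s * H R / (1 - q)" using q by (simp add: le_divide_eq mult.commute)
  have "(1 - \<eta> / 4 * l) ^ n \<le> exp (- (\<eta> / 4 * l)) ^ n"
    using l exp_ge_add_one_self[of "- (\<eta> / 4 * l)"] by (intro power_mono) auto
  also have "\<dots> = exp (- (l * (\<eta> / 4 * real n)))" by (simp add: exp_of_nat_mult[symmetric] algebra_simps)
  also have "\<dots> \<le> exp (- (l * ((1 + 1 / (\<epsilon> * (1 - q))) * H R)))" using H_R_le l by simp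
  finally have "(1 - \<eta> / 4 * l) ^ n * exp_weight l s (v x)
      \<le> exp (- (l * ((1 + 1 / (\<epsilon> * (1 - q))) * H R))) * exp (l * H R)"
    using l s R v_ge_1[of x] unfolding exp_weight_def
    by (intro mult_mono) (auto intro!: mult_left_mono H_mono)
  also have "\<dots> = exp (- (\<phi>' s * H R / (1 - q)))"
    using \<epsilon> q by (simp add: exp_add[symmetric] field_simps)
  also have "\<dots> \<le> exp (- ln (\<phi> R / \<phi> a))" using ln_le by simp
  also have "\<dots> = \<phi> a / \<phi> R" using pos by (simp add: exp_minus)
  finally show ?thesis .
qed

lemma weight_le_ratio_powr:
  assumes \<epsilon>: "0 < \<epsilon>" "l = \<epsilon> * \<phi>' s" and q: "0 < q" "q < 1"
    and a: "1 \<le> a" "v x \<le> a" and R: "a \<le> s" "s \<le> R"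
    and ratios: "\<phi> a / \<phi> s = (\<phi> a / \<phi> R) powr q" "\<phi> R / \<phi> s = (\<phi> R / \<phi> a) powr (1 - q)"
    and H_R_le: "(1 + 1 / (\<epsilon> * (1 - q))) * H R \<le> \<eta> / 4 * real n"
  shows "weight l s \<beta> n x \<le> (1 + (1 / 2 + \<beta>) / \<beta>) * (\<phi> a / \<phi> R) powr q"
proof -
  have pos: "0 < \<phi> a" "0 < \<phi> R" "0 < \<phi> s" "\<phi> a \<le> \<phi> R" using a R s by (auto intro!: pos mono)
  have "(1 - \<eta> / 4 * l) ^ n * exp_weight l s (v x) \<le> \<phi> a / \<phi> R"
    using a by (intro discounted_exp_weight_le[OF \<epsilon> q(2) _ R(2) ratios(2) H_R_le]) simp
  also have "\<dots> \<le> (\<phi> a / \<phi> R) powr q"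
    using powr_mono'[of q 1 "\<phi> a / \<phi> R"] pos q by simp
  finally have exp_part: "(1 - \<eta> / 4 * l) ^ n * exp_weight l s (v x) \<le> (\<phi> a / \<phi> R) powr q" .
  have "(1 / 2 + \<beta> * v x) / (\<beta> * s) \<le> (1 / 2 + \<beta>) * a / (\<beta> * s)"
  proof (rule divide_right_mono)
    have "\<beta> * v x \<le> \<beta> * a" using \<beta> a(2) by simp
    then show "1 / 2 + \<beta> * v x \<le> (1 / 2 + \<beta>) * a" using a(1) by (simp add: distrib_right)
  qed (use \<beta> s in simp)
  also have "\<dots> = (1 / 2 + \<beta>) / \<beta> * (a / s)" by simp
  also have "\<dots> \<le> (1 / 2 + \<beta>) / \<beta> * (\<phi> a / \<phi> s)"
    using scale_le[of a s] pos s a R \<beta> by (intro mult_left_mono) (simp_all add: field_simps)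
  finally have "(1 / 2 + \<beta> * v x) / (\<beta> * s) \<le> (1 / 2 + \<beta>) / \<beta> * (\<phi> a / \<phi> R) powr q"
    by (simp add: ratios)
  with exp_part show ?thesis unfolding weight_def distrib_right by simp
qed

end

lemma exponent_scale:
  assumes "1 < \<Lambda>"
  obtains \<epsilon> where "0 < \<epsilon>" "\<And>s. 1 \<le> s \<Longrightarrow> \<epsilon> * \<phi>' s \<le> \<phi>' s" "\<And>s. 1 \<le> s \<Longrightarrow> \<eta> / 4 * (\<epsilon> * \<phi>' s) < 1"
    "\<And>s. 1 \<le> s \<Longrightarrow> 1 + \<eta> / 4 * (\<epsilon> * \<phi>' s) \<le> \<Lambda> * (1 - \<eta> / 4 * (\<epsilon> * \<phi>' s))"
proof -
  define e where "e = (\<Lambda> - 1) / (\<eta> / 4 * (1 + \<Lambda>) * \<phi>' 1)"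
  have "0 < e" unfolding e_def using assms \<eta>_pos derivative_pos[of 1] by (intro divide_pos_pos mult_pos_pos) auto
  define \<epsilon> where "\<epsilon> = min 1 e"
  have \<epsilon>: "0 < \<epsilon>" "\<epsilon> \<le> 1" "\<epsilon> \<le> e" using \<open>0 < e\<close> by (auto simp: \<epsilon>_def)
  have \<phi>': "0 < \<phi>' s" "\<phi>' s \<le> \<phi>' 1" if "1 \<le> s" for s
    using that derivative_pos[of s] derivative_antimono[of 1 s] by auto
  have scaled_le: "\<eta> / 4 * (\<epsilon> * \<phi>' s) * (1 + \<Lambda>) \<le> \<Lambda> - 1" if "1 \<le> s" for s
  proof -
    have "\<epsilon> * \<phi>' s \<le> e * \<phi>' 1" using \<epsilon> \<phi>'[OF that] by (intro mult_mono) auto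
    then have "\<eta> / 4 * (1 + \<Lambda>) * (\<epsilon> * \<phi>' s) \<le> \<eta> / 4 * (1 + \<Lambda>) * (e * \<phi>' 1)"
      using \<eta>_pos assms by (intro mult_left_mono) auto
    also have "\<dots> = \<Lambda> - 1" using \<eta>_pos assms derivative_pos[of 1] by (simp add: e_def)
    finally show ?thesis by (simp add: algebra_simps)
  qed
  show ?thesis
  proof (rule that[OF \<epsilon>(1)])
    fix s :: real assume s: "1 \<le> s"
    show "\<epsilon> * \<phi>' s \<le> \<phi>' s" using \<epsilon> \<phi>'[OF s] by (simp add: mult_left_le_one_le)
    show "\<eta> / 4 * (\<epsilon> * \<phi>' s) < 1"
    proof (rule mult_right_less_imp_less)
      show "\<eta> / 4 * (\<epsilon> * \<phi>' s) * (1 + \<Lambda>) < 1 * (1 + \<Lambda>)" by (rule le_less_trans[OF scaled_le[OF s]]) simp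
    qed (use assms in simp)
    show "1 + \<eta> / 4 * (\<epsilon> * \<phi>' s) \<le> \<Lambda> * (1 - \<eta> / 4 * (\<epsilon> * \<phi>' s))"
      using scaled_le[OF s] by (simp add: algebra_simps add_divide_distrib)
  qed
qed

lemma kantorovich_iter_le_weights:
  assumes q: "0 < q" "q < 1"
  obtains \<beta> \<epsilon> where "0 < \<beta>" "0 < \<epsilon>" "\<And>s. 1 \<le> s \<Longrightarrow> \<epsilon> * \<phi>' s \<le> \<phi>' s \<and> \<eta> / 4 * (\<epsilon> * \<phi>' s) < 1"
    "\<And>s n x y. 1 \<le> s \<Longrightarrow> kantorovich (iter n x) (iter n y)
      \<le> (weight (\<epsilon> * \<phi>' s) s \<beta> n x + weight (\<epsilon> * \<phi>' s) s \<beta> n y) powr q"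
proof -
  define \<Lambda> where "\<Lambda> = (1 / \<gamma>) powr ((1 - q) / q)"
  have \<Lambda>: "1 < \<Lambda>" unfolding \<Lambda>_def using \<gamma> q by (intro gr_one_powr) auto
  have "\<Lambda> powr q = (1 / \<gamma>) powr (1 - q)" using q by (simp add: \<Lambda>_def powr_powr)
  then have \<Lambda>_\<gamma>: "\<gamma> powr (1 - q) * \<Lambda> powr q \<le> 1"
    using \<gamma> by (simp add: powr_divide)
  define \<beta> where "\<beta> = (\<Lambda> - 1) / (2 * K)"
  have \<beta>: "0 < \<beta>" "1 + 2 * \<beta> * K \<le> \<Lambda>" using K_pos \<Lambda> by (simp_all add: \<beta>_def field_simps)
  obtain \<epsilon> where \<epsilon>: "0 < \<epsilon>" and scale: "\<And>s. 1 \<le> s \<Longrightarrow> \<epsilon> * \<phi>' s \<le> \<phi>' s" "\<And>s. 1 \<le> s \<Longrightarrow> \<eta> / 4 * (\<epsilon> * \<phi>' s) < 1"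
      "\<And>s. 1 \<le> s \<Longrightarrow> 1 + \<eta> / 4 * (\<epsilon> * \<phi>' s) \<le> \<Lambda> * (1 - \<eta> / 4 * (\<epsilon> * \<phi>' s))"
    using exponent_scale[OF \<Lambda>] by blast
  show ?thesis
  proof (rule that[OF \<beta>(1) \<epsilon>])
    show "\<epsilon> * \<phi>' s \<le> \<phi>' s \<and> \<eta> / 4 * (\<epsilon> * \<phi>' s) < 1" if "1 \<le> s" for s
      using scale(1,2)[OF that] by simp
    show "kantorovich (iter n x) (iter n y) \<le> (weight (\<epsilon> * \<phi>' s) s \<beta> n x + weight (\<epsilon> * \<phi>' s) s \<beta> n y) powr q"
      if "1 \<le> s" for s n x y
      using \<epsilon> derivative_pos[of s] that
      by (intro kantorovich_iter_le_weight[OF _ scale(1,2)[OF that] that \<beta>(1) q \<beta>(2) scale(3)[OF that] \<Lambda>_\<gamma>]) simp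
  qed
qed

lemma kantorovich_iter_le_max_ratio:
  assumes q: "0 < q" "q < 1" and \<beta>: "0 < \<beta>" and \<epsilon>: "0 < \<epsilon>"
    and l: "\<And>s. 1 \<le> s \<Longrightarrow> \<epsilon> * \<phi>' s \<le> \<phi>' s \<and> \<eta> / 4 * (\<epsilon> * \<phi>' s) < 1"
    and le_weights: "\<And>s. 1 \<le> s \<Longrightarrow> kantorovich (iter n x) (iter n y)
      \<le> (weight (\<epsilon> * \<phi>' s) s \<beta> n x + weight (\<epsilon> * \<phi>' s) s \<beta> n y) powr q"
    and a: "1 \<le> a" "v x \<le> a" "v y \<le> a"
    and R: "1 \<le> R" "(1 + 1 / (\<epsilon> * (1 - q))) * H R \<le> \<eta> / 4 * real n"
    and D: "D = 1 + (1 / 2 + \<beta>) / \<beta>"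
  shows "kantorovich (iter n x) (iter n y) \<le> (2 * D) powr q * (\<phi> a / \<phi> R) powr (q * q)"
proof (cases "R \<le> a")
  case True
  have "0 < \<phi> R" using R(1) by (intro pos) simp
  then have "1 \<le> (\<phi> a / \<phi> R) powr (q * q)" using mono[OF _ True] R(1) q by (intro ge_one_powr_ge_zero) auto
  moreover have "1 \<le> (2 * D) powr q" using D \<beta> q by (intro ge_one_powr_ge_zero) auto
  ultimately have "1 * 1 \<le> (2 * D) powr q * (\<phi> a / \<phi> R) powr (q * q)" by (intro mult_mono) auto
  then show ?thesis using kantorovich_le_1[OF iter_in_prob_measures iter_in_prob_measures, of n x n y] by linarith
next
  case False
  then obtain s where s: "a \<le> s" "s \<le> R"
    and ratios: "\<phi> a / \<phi> s = (\<phi> a / \<phi> R) powr q" "\<phi> R / \<phi> s = (\<phi> R / \<phi> a) powr (1 - q)"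
    using intermediate_level[of a R q] a q by auto
  have s_ge_1: "1 \<le> s" using a s by simp
  have weight_le: "weight (\<epsilon> * \<phi>' s) s \<beta> n z \<le> D * (\<phi> a / \<phi> R) powr q" if "v z \<le> a" for z
    using weight_le_ratio_powr[of "\<epsilon> * \<phi>' s" s \<beta> \<epsilon> q a z R n] l[OF s_ge_1] \<epsilon> s_ge_1 \<beta> q a(1) s ratios that
      derivative_pos[of s] R(2) by (simp add: D)
  have nonneg: "0 \<le> weight (\<epsilon> * \<phi>' s) s \<beta> n z" for z
    using weight_nonneg[of "\<epsilon> * \<phi>' s" s \<beta> n z] l[OF s_ge_1] \<epsilon> s_ge_1 \<beta> derivative_pos[of s] by simp
  have "kantorovich (iter n x) (iter n y) \<le> (weight (\<epsilon> * \<phi>' s) s \<beta> n x + weight (\<epsilon> * \<phi>' s) s \<beta> n y) powr q"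
    by (rule le_weights[OF s_ge_1])
  also have "\<dots> \<le> (2 * D * (\<phi> a / \<phi> R) powr q) powr q"
    using weight_le[OF a(2)] weight_le[OF a(3)] nonneg q by (intro powr_mono2 add_nonneg_nonneg) auto
  also have "\<dots> = (2 * D) powr q * (\<phi> a / \<phi> R) powr (q * q)"
    by (simp add: powr_mult powr_powr)
  finally show ?thesis .
qed

theorem kantorovich_iter_le_ratio:
  assumes \<delta>: "0 < \<delta>" "\<delta> < 1"
  shows "\<exists>C>0. \<exists>c>0. \<forall>n x y R. 1 \<le> R \<longrightarrow> H R \<le> c * real n \<longrightarrow>
    kantorovich (iter n x) (iter n y) \<le> C * ((\<phi> (v x) + \<phi> (v y)) / \<phi> R) powr \<delta>"
proof -
  define q where "q = sqrt \<delta>"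
  have q: "0 < q" "q < 1" and q_square: "q * q = \<delta>" using \<delta> by (auto simp: q_def)
  obtain \<beta> \<epsilon> where \<beta>: "0 < \<beta>" and \<epsilon>: "0 < \<epsilon>" and l: "\<And>s. 1 \<le> s \<Longrightarrow> \<epsilon> * \<phi>' s \<le> \<phi>' s \<and> \<eta> / 4 * (\<epsilon> * \<phi>' s) < 1"
    and le_weights: "\<And>s n x y. 1 \<le> s \<Longrightarrow> kantorovich (iter n x) (iter n y)
      \<le> (weight (\<epsilon> * \<phi>' s) s \<beta> n x + weight (\<epsilon> * \<phi>' s) s \<beta> n y) powr q"
    using kantorovich_iter_le_weights[OF q] by metis
  define k where "k = 1 + 1 / (\<epsilon> * (1 - q))"
  have k: "0 < k" using \<epsilon> q by (simp add: k_def add_pos_nonneg)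
  define D where "D = 1 + (1 / 2 + \<beta>) / \<beta>"
  have "kantorovich (iter n x) (iter n y) \<le> (2 * D) powr q * ((\<phi> (v x) + \<phi> (v y)) / \<phi> R) powr \<delta>"
    if R: "1 \<le> R" and H_R_le: "H R \<le> \<eta> / 4 / k * real n" for n x y R
  proof -
    define a where "a = max (v x) (v y)"
    have a: "1 \<le> a" "v x \<le> a" "v y \<le> a" using v_ge_1[of x] by (auto simp: a_def)
    have "k * H R \<le> \<eta> / 4 * real n" using H_R_le k by (simp add: field_simps)
    then have "kantorovich (iter n x) (iter n y) \<le> (2 * D) powr q * (\<phi> a / \<phi> R) powr \<delta>"
      unfolding q_square[symmetric] k_def by (intro kantorovich_iter_le_max_ratio[OF q \<beta> \<epsilon> l le_weights a R _ D_def])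
    also have "\<dots> \<le> (2 * D) powr q * ((\<phi> (v x) + \<phi> (v y)) / \<phi> R) powr \<delta>"
    proof (intro mult_left_mono powr_mono2 divide_right_mono)
      show "\<phi> a \<le> \<phi> (v x) + \<phi> (v y)" using phi_v_pos[of x] phi_v_pos[of y] by (auto simp: a_def max_def)
    qed (use \<delta> a R in \<open>auto intro!: nonneg divide_nonneg_nonneg\<close>)
    finally show ?thesis .
  qed
  moreover have "0 < D" unfolding D_def using \<beta> by (intro add_pos_pos divide_pos_pos) simp_all
  then have "0 < (2 * D) powr q" by simp
  moreover have "0 < \<eta> / 4 / k" using \<eta>_pos k by simp
  ultimately show ?thesis by blast
qed

end

locale harris_drift_kernel = drift_kernel Q v "\<lambda>x. \<phi> (v x)" \<eta> K + concave_rate \<phi>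
  for Q :: "'a::polish_space \<Rightarrow> 'a measure" and \<phi> v \<eta> K +
  fixes d :: "'a \<Rightarrow> 'a \<Rightarrow> real" and \<gamma> :: real
  assumes d_measurable: "(\<lambda>z. d (fst z) (snd z)) \<in> borel_measurable (borel \<Otimes>\<^sub>M borel)"
    and bdist_le_d: "\<And>x y. bdist x y \<le> d x y" and d_le_1: "\<And>x y. d x y \<le> 1"
    and \<gamma>: "0 < \<gamma>" "\<gamma> < 1"
    and contracting: "\<And>x y. d x y < 1 \<Longrightarrow> wasserstein d (Q x) (Q y) \<le> ennreal (\<gamma> * d x y)"
    and small: "\<And>M. \<exists>\<kappa><1. \<forall>x y. v x \<le> M \<longrightarrow> v y \<le> M \<longrightarrow> wasserstein d (Q x) (Q y) \<le> ennreal \<kappa>"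
begin

lemma shifted_harris_kernel:
  obtains A M \<gamma>' K' where "0 \<le> A" "harris_kernel Q \<phi> d (\<lambda>x. A + v x) \<gamma>' M (\<eta> / 2) K'"
proof -
  obtain A where A: "1 < A" "8 * (K + 1) / \<eta> < \<phi> A" using unbounded by blast
  then have \<phi>A: "8 * (K + 1) < \<eta> * \<phi> A" using \<eta>_pos by (simp add: field_simps)
  obtain z where z: "0 < z" "2 * K / \<eta> + \<phi> A < \<phi> z" using unbounded by blast
  obtain \<kappa> where \<kappa>: "\<kappa> < 1" "\<And>x y. v x \<le> z \<Longrightarrow> v y \<le> z \<Longrightarrow> wasserstein d (Q x) (Q y) \<le> ennreal \<kappa>"
    using small by blast
  have \<phi>_shift: "\<phi> A \<le> \<phi> (A + v x)" "\<phi> (A + v x) \<le> \<phi> A + \<phi> (v x)" for x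
    using A v_nonneg[of x] by (auto intro: mono subadditive)
  have "harris_kernel Q \<phi> d (\<lambda>x. A + v x) (max \<gamma> \<kappa>) (A + z) (\<eta> / 2) (K + 1)"
  proof unfold_locales
    fix x y
    interpret prob_space "Q x" by (rule prob_measuresD(1)[OF kernel_in_prob_measures])
    have integral: "(\<integral>y. A + v y \<partial>Q x) = A + (\<integral>y. v y \<partial>Q x)" using v_integrable by (simp add: prob_space)
    show "integrable (Q x) (\<lambda>y. A + v y)" using v_integrable by simp
    have "\<eta> * \<phi> A \<le> \<eta> * \<phi> (A + v x)" using \<phi>_shift(1) \<eta>_pos by (intro mult_left_mono) auto
    then show "4 * (K + 1) \<le> \<eta> / 2 * \<phi> (A + v x)" using \<phi>A by simp
    have "0 \<le> \<eta> * \<phi> (v x)" using \<eta>_pos W_nonneg by simp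
    then show "(\<integral>y. A + v y \<partial>Q x) \<le> A + v x + (K + 1)" unfolding integral using drift[of x] by linarith
    show "(\<integral>y. A + v y \<partial>Q x) \<le> A + v x - \<eta> / 2 * \<phi> (A + v x)" if "A + z < A + v x"
    proof -
      have "2 * K / \<eta> + \<phi> A < \<phi> (v x)" using z that mono[of z "v x"] by simp
      then have "2 * K + \<eta> * \<phi> A < \<eta> * \<phi> (v x)" using \<eta>_pos by (simp add: field_simps)
      moreover have "\<eta> * \<phi> (A + v x) \<le> \<eta> * (\<phi> A + \<phi> (v x))" using \<phi>_shift(2) \<eta>_pos by (intro mult_left_mono) auto
      ultimately show ?thesis unfolding integral using drift[of x] by (simp add: distrib_left)
    qed
    have "0 \<le> d x y" using bdist_le_d[of x y] bdist_nonneg[of x y] by linarith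
    then show "wasserstein d (Q x) (Q y) \<le> ennreal (max \<gamma> \<kappa> * d x y)" if "d x y < 1"
      using contracting[OF that] by (elim order_trans) (intro ennreal_leI mult_right_mono, simp_all)
    show "wasserstein d (Q x) (Q y) \<le> ennreal (max \<gamma> \<kappa>)" if "A + v x \<le> A + z" "A + v y \<le> A + z"
      using \<kappa>(2)[of x y] that ennreal_leI[of \<kappa> "max \<gamma> \<kappa>"] by (auto intro: order_trans)
  qed (use A v_nonneg \<gamma> \<kappa>(1) K_nonneg \<eta>_pos d_measurable bdist_le_d d_le_1
      in \<open>simp_all add: less_max_iff_disj add_increasing2\<close>)
  then show ?thesis using that[of A] A by simp
qed

theorem subgeometric_contraction:
  assumes \<delta>: "0 < \<delta>" "\<delta> < 1"
  shows "\<exists>C>0. \<exists>c>0. \<forall>n x y R. 1 \<le> R \<longrightarrow> H R \<le> c * real n \<longrightarrow>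
    kantorovich (iter n x) (iter n y) \<le> C * ((1 + \<phi> (v x) + \<phi> (v y)) / \<phi> R) powr \<delta>"
proof -
  obtain A M \<gamma>' K' where "0 \<le> A" and shifted: "harris_kernel Q \<phi> d (\<lambda>x. A + v x) \<gamma>' M (\<eta> / 2) K'"
    by (rule shifted_harris_kernel)
  obtain C c where constants_pos: "0 < C" "0 < c" and contraction: "\<And>n x y R. 1 \<le> R \<Longrightarrow> H R \<le> c * real n \<Longrightarrow>
      kantorovich (iter n x) (iter n y) \<le> C * ((\<phi> (A + v x) + \<phi> (A + v y)) / \<phi> R) powr \<delta>"
    using harris_kernel.kantorovich_iter_le_ratio[OF shifted \<delta>] by blast
  have "kantorovich (iter n x) (iter n y) \<le> C * (1 + 2 * \<phi> A) powr \<delta> * ((1 + \<phi> (v x) + \<phi> (v y)) / \<phi> R) powr \<delta>"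
    if R: "1 \<le> R" "H R \<le> c * real n" for n x y R
  proof -
    have nonneg: "0 \<le> \<phi> A" "0 \<le> \<phi> (v x)" "0 \<le> \<phi> (v y)" "0 < \<phi> R" "0 \<le> \<phi> (A + v x)" "0 \<le> \<phi> (A + v y)"
      using \<open>0 \<le> A\<close> v_nonneg R(1) by (auto intro!: nonneg pos add_nonneg_nonneg)
    have "\<phi> (A + v x) + \<phi> (A + v y) \<le> (\<phi> A + \<phi> (v x)) + (\<phi> A + \<phi> (v y))"
      using \<open>0 \<le> A\<close> v_nonneg by (intro add_mono subadditive)
    also have "\<dots> \<le> (1 + 2 * \<phi> A) * (1 + \<phi> (v x) + \<phi> (v y))"
      using mult_nonneg_nonneg[OF nonneg(1,2)] mult_nonneg_nonneg[OF nonneg(1,3)] by (simp add: algebra_simps)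
    finally have "(\<phi> (A + v x) + \<phi> (A + v y)) / \<phi> R \<le> (1 + 2 * \<phi> A) * ((1 + \<phi> (v x) + \<phi> (v y)) / \<phi> R)"
      using nonneg(4) by (simp add: divide_right_mono)
    then have "((\<phi> (A + v x) + \<phi> (A + v y)) / \<phi> R) powr \<delta> \<le> ((1 + 2 * \<phi> A) * ((1 + \<phi> (v x) + \<phi> (v y)) / \<phi> R)) powr \<delta>"
      using nonneg \<delta> by (intro powr_mono2) auto
    also have "\<dots> = (1 + 2 * \<phi> A) powr \<delta> * ((1 + \<phi> (v x) + \<phi> (v y)) / \<phi> R) powr \<delta>"
      by (rule powr_mult)
    finally show ?thesis
      using contraction[OF R, of x y] constants_pos(1) by (smt (verit) mult.assoc mult_left_mono)
  qed
  moreover have "0 < C * (1 + 2 * \<phi> A) powr \<delta>"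
    using constants_pos(1) nonneg[OF \<open>0 \<le> A\<close>] by (intro mult_pos_pos) (auto simp: add_pos_nonneg)
  ultimately show ?thesis using constants_pos(2) by blast
qed

lemma subgeometric_contraction_bind:
  assumes \<delta>: "0 < \<delta>" "\<delta> < 1"
  shows "\<exists>C>0. \<exists>c>0. \<forall>n R. \<forall>\<mu>\<in>prob_measures. \<forall>\<nu>\<in>prob_measures.
    integrable \<mu> (\<lambda>x. \<phi> (v x)) \<longrightarrow> integrable \<nu> (\<lambda>x. \<phi> (v x)) \<longrightarrow> 1 \<le> R \<longrightarrow> H R \<le> c * real n \<longrightarrow>
    kantorovich (\<mu> \<bind> iter n) (\<nu> \<bind> iter n) \<le> C * ((1 + (\<integral>x. \<phi> (v x) \<partial>\<mu>) + (\<integral>x. \<phi> (v x) \<partial>\<nu>)) / \<phi> R) powr \<delta>"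
proof -
  obtain C c where constants_pos: "0 < C" "0 < c" and contraction: "\<And>n x y R. 1 \<le> R \<Longrightarrow> H R \<le> c * real n \<Longrightarrow>
      kantorovich (iter n x) (iter n y) \<le> C * ((1 + \<phi> (v x) + \<phi> (v y)) / \<phi> R) powr \<delta>"
    using subgeometric_contraction[OF \<delta>] by blast
  have "kantorovich (\<mu> \<bind> iter n) (\<nu> \<bind> iter n) \<le> C * ((1 + (\<integral>x. \<phi> (v x) \<partial>\<mu>) + (\<integral>x. \<phi> (v x) \<partial>\<nu>)) / \<phi> R) powr \<delta>"
    if \<mu>: "\<mu> \<in> prob_measures" "integrable \<mu> (\<lambda>x. \<phi> (v x))" and \<nu>: "\<nu> \<in> prob_measures" "integrable \<nu> (\<lambda>x. \<phi> (v x))"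
      and R: "1 \<le> R" "H R \<le> c * real n" for n \<mu> \<nu> R
  proof -
    define J where "J x = (1 / 2 + \<phi> (v x)) / \<phi> R" for x
    have J: "integrable \<xi> J \<and> (\<integral>x. J x \<partial>\<xi>) = (1 / 2 + (\<integral>x. \<phi> (v x) \<partial>\<xi>)) / \<phi> R"
      if "\<xi> \<in> prob_measures" "integrable \<xi> (\<lambda>x. \<phi> (v x))" for \<xi>
    proof -
      interpret prob_space \<xi> by (rule prob_measuresD(1)[OF that(1)])
      show ?thesis unfolding J_def[abs_def] using that(2) by (simp add: prob_space)
    qed
    have "0 < \<phi> R" using R(1) by (intro pos) simp
    then have J_nonneg: "0 \<le> J x" for x using W_nonneg[of x] by (simp add: J_def)
    have J_measurable: "J \<in> borel_measurable borel" unfolding J_def[abs_def] by measurable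
    have "kantorovich (\<mu> \<bind> iter n) (\<nu> \<bind> iter n) \<le> C * ((\<integral>x. J x \<partial>\<mu>) + (\<integral>x. J x \<partial>\<nu>)) powr \<delta>"
    proof (rule kantorovich_bind_powr_le[OF \<mu>(1) \<nu>(1) iter_kernel J_measurable _ _ J_nonneg])
      show "kantorovich (iter n x) (iter n y) \<le> C * (J x + J y) powr \<delta>" for x y
        using contraction[OF R, of x y] by (simp add: J_def add_divide_distrib[symmetric] add_ac)
    qed (use J[OF \<mu>] J[OF \<nu>] constants_pos \<delta> in simp_all)
    also have "(\<integral>x. J x \<partial>\<mu>) + (\<integral>x. J x \<partial>\<nu>) = (1 + (\<integral>x. \<phi> (v x) \<partial>\<mu>) + (\<integral>x. \<phi> (v x) \<partial>\<nu>)) / \<phi> R"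
      using J[OF \<mu>] J[OF \<nu>] by (simp add: add_divide_distrib)
    finally show ?thesis .
  qed
  with constants_pos show ?thesis by blast
qed

theorem subgeometric_convergence:
  assumes \<pi>: "\<pi> \<in> prob_measures" "\<pi> \<bind> Q = \<pi>" and \<delta>: "0 < \<delta>" "\<delta> < 1"
  shows "\<exists>C>0. \<exists>c>0. \<forall>n R. \<forall>\<mu>\<in>prob_measures. integrable \<mu> (\<lambda>x. \<phi> (v x)) \<longrightarrow> 1 \<le> R \<longrightarrow> H R \<le> c * real n \<longrightarrow>
    kantorovich (\<mu> \<bind> iter n) \<pi> \<le> C * ((1 + (\<integral>x. \<phi> (v x) \<partial>\<mu>)) / \<phi> R) powr \<delta>"
proof -
  define B where "B = (\<integral>x. \<phi> (v x) \<partial>\<pi>)"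
  have B: "0 \<le> B" unfolding B_def by (intro integral_nonneg_AE) (simp add: W_nonneg)
  have "integrable \<pi> (\<lambda>x. \<phi> (v x))"
    using invariant_nn_integral_le[OF \<pi>] \<pi>(1) W_nonneg
    by (intro integrableI_nonneg) (auto simp: in_prob_measures_iff intro: le_less_trans cong: measurable_cong_sets)
  then obtain C c where constants_pos: "0 < C" "0 < c" and contraction: "\<And>n R \<mu>. \<mu> \<in> prob_measures \<Longrightarrow> integrable \<mu> (\<lambda>x. \<phi> (v x)) \<Longrightarrow>
      1 \<le> R \<Longrightarrow> H R \<le> c * real n \<Longrightarrow> kantorovich (\<mu> \<bind> iter n) \<pi> \<le> C * ((1 + (\<integral>x. \<phi> (v x) \<partial>\<mu>) + B) / \<phi> R) powr \<delta>"
    using subgeometric_contraction_bind[OF \<delta>] \<pi>(1) unfolding B_def by (metis invariant_iter[OF \<pi>])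
  have "kantorovich (\<mu> \<bind> iter n) \<pi> \<le> C * (1 + B) powr \<delta> * ((1 + (\<integral>x. \<phi> (v x) \<partial>\<mu>)) / \<phi> R) powr \<delta>"
    if "\<mu> \<in> prob_measures" "integrable \<mu> (\<lambda>x. \<phi> (v x))" and R: "1 \<le> R" "H R \<le> c * real n" for n \<mu> R
  proof -
    define A where "A = (\<integral>x. \<phi> (v x) \<partial>\<mu>)"
    have A: "0 \<le> A" unfolding A_def by (intro integral_nonneg_AE) (simp add: W_nonneg)
    have \<phi>R: "0 < \<phi> R" using R(1) by (intro pos) simp
    have "1 + A + B \<le> (1 + B) * (1 + A)" using mult_nonneg_nonneg[OF A B] by (simp add: algebra_simps)
    then have "C * ((1 + A + B) / \<phi> R) powr \<delta> \<le> C * ((1 + B) * ((1 + A) / \<phi> R)) powr \<delta>"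
      using A B constants_pos \<delta> \<phi>R by (intro mult_left_mono powr_mono2) (simp_all add: divide_right_mono)
    then show ?thesis
      using contraction[OF that] unfolding A_def powr_mult by (simp add: mult.assoc)
  qed
  moreover have "0 < C * (1 + B) powr \<delta>" using constants_pos B by simp
  ultimately show ?thesis using constants_pos(2) by blast
qed

theorem ex1_invariant:
  assumes feller: "\<And>f :: 'a \<Rightarrow> real. continuous_on UNIV f \<Longrightarrow> bounded (range f) \<Longrightarrow> continuous_on UNIV (\<lambda>x. \<integral>y. f y \<partial>Q x)"
  shows "\<exists>!\<pi>. \<pi> \<in> prob_measures \<and> \<pi> \<bind> Q = \<pi>"
proof -
  obtain C c where constants_pos: "0 < C" "0 < c" and contraction: "\<And>n x y R. 1 \<le> R \<Longrightarrow> H R \<le> c * real n \<Longrightarrow>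
      kantorovich (iter n x) (iter n y) \<le> C * ((1 + \<phi> (v x) + \<phi> (v y)) / \<phi> R) powr (1 / 2)"
    using subgeometric_contraction[of "1 / 2"] by auto
  define R where "R n = H_phi_inv \<phi> (c * real n)" for n
  define a where "a n = C * (1 / \<phi> (R n)) powr (1 / 2)" for n
  have R: "1 \<le> R n" "H (R n) \<le> c * real n" "0 < \<phi> (R n)" for n
    using H_phi_inv[of "c * real n"] phi_H_phi_inv_pos[of "c * real n"] constants_pos by (auto simp: R_def)
  have "filterlim (\<lambda>n. c * real n) at_top sequentially"
    using constants_pos by (intro filterlim_tendsto_pos_mult_at_top[OF tendsto_const] filterlim_real_sequentially) auto
  then have "filterlim (\<lambda>n. \<phi> (R n)) at_top sequentially"
    unfolding R_def by (rule filterlim_compose[OF phi_H_phi_inv_at_top])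
  then have "(\<lambda>n. 1 / \<phi> (R n)) \<longlonglongrightarrow> 0"
    by (intro tendsto_divide_0[OF tendsto_const] filterlim_at_top_imp_at_infinity)
  then have "a \<longlonglongrightarrow> C * 0 powr (1 / 2)"
    unfolding a_def[abs_def] using R(3)
    by (intro tendsto_mult tendsto_const tendsto_powr') (auto intro!: always_eventually less_imp_le)
  moreover have "kantorovich (iter n x) (iter n y) \<le> a n * (1 + \<phi> (v x) + \<phi> (v y))" for n x y
  proof -
    define u where "u = 1 + \<phi> (v x) + \<phi> (v y)"
    have u: "1 \<le> u" using W_nonneg[of x] W_nonneg[of y] by (simp add: u_def)
    have "kantorovich (iter n x) (iter n y) \<le> C * (u / \<phi> (R n)) powr (1 / 2)"
      unfolding u_def by (rule contraction[OF R(1,2)])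
    also have "\<dots> = a n * u powr (1 / 2)" using u R(3)[of n] by (simp add: a_def powr_divide)
    also have "\<dots> \<le> a n * u"
      using powr_mono[of "1 / 2" 1 u] u constants_pos by (intro mult_left_mono) (auto simp: a_def)
    finally show ?thesis by (simp add: u_def)
  qed
  ultimately interpret contracting_drift_kernel Q v "\<lambda>x. \<phi> (v x)" \<eta> K a
    by unfold_locales simp_all
  show ?thesis
    using invariant_exists[OF feller] invariant_unique by metis
qed

end

section \<open>Markov semigroups\<close>

locale markov_semigroup =
  fixes P :: "real \<Rightarrow> 'a::polish_space \<Rightarrow> 'a measure"
  assumes markov: "markov_tf P"
begin

lemma P_in_prob_measures: "0 \<le> t \<Longrightarrow> P t x \<in> prob_measures"
  using markov by (simp add: markov_tf_def in_prob_measures_iff)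

lemma P_kernel: "0 \<le> t \<Longrightarrow> P t \<in> borel \<rightarrow>\<^sub>M prob_algebra borel"
  using markov by (intro measurable_prob_algebraI measurable_subprob_algebra)
    (auto simp: markov_tf_def prob_space_imp_subprob_space)

lemma P_0: "P 0 x = return borel x"
  using markov by (simp add: markov_tf_def)

lemma emeasure_bind_P:
  assumes "\<mu> \<in> prob_measures" "0 \<le> t" "A \<in> sets borel"
  shows "emeasure (\<mu> \<bind> P t) A = (\<integral>\<^sup>+x. emeasure (P t x) A \<partial>\<mu>)"
  using assms kernel_measurable_subprob[OF assms(1) P_kernel[OF assms(2)]]
  by (intro emeasure_bind[where N=borel]) (simp_all add: prob_measuresD(3))

lemma P_add:
  assumes "0 \<le> s" "0 \<le> t"
  shows "P (s + t) x = P s x \<bind> P t"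
proof (rule measure_eqI)
  note P_s = P_in_prob_measures[OF assms(1)]
  have "P s x \<bind> P t \<in> prob_measures" by (rule bind_in_prob_algebra[OF P_s P_kernel[OF assms(2)]])
  then show "sets (P (s + t) x) = sets (P s x \<bind> P t)"
    using P_in_prob_measures[of "s + t" x] assms by (simp add: in_prob_measures_iff)
  fix A assume "A \<in> sets (P (s + t) x)"
  then have "A \<in> sets borel" using P_in_prob_measures[of "s + t" x] assms by (simp add: in_prob_measures_iff)
  then show "emeasure (P (s + t) x) A = emeasure (P s x \<bind> P t) A"
    using markov assms emeasure_bind_P[OF P_s assms(2)] by (simp add: markov_tf_def)
qed

lemma bind_P_P:
  assumes "\<mu> \<in> prob_measures" "0 \<le> s" "0 \<le> t"
  shows "(\<mu> \<bind> P s) \<bind> P t = \<mu> \<bind> P (s + t)"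
  unfolding P_add[OF assms(2,3), abs_def]
  by (rule bind_assoc[OF kernel_measurable_subprob[OF assms(1) P_kernel[OF assms(2)]]
        measurable_prob_algebraD[OF P_kernel[OF assms(3)]]])

lemma markov_kernel_P: "0 \<le> h \<Longrightarrow> markov_kernel (P h)"
  by (rule markov_kernel.intro) (rule P_kernel)

lemma iter_P:
  assumes "0 \<le> h"
  shows "markov_kernel.iter (P h) n = P (real n * h)"
proof -
  interpret markov_kernel "P h" by (rule markov_kernel_P[OF assms])
  show ?thesis
  proof (induction n)
    case 0
    show ?case by (rule ext) (simp add: P_0)
  next
    case (Suc n)
    show ?case
      using assms by (intro ext) (simp add: Suc P_add[symmetric] distrib_right)
  qed
qed

lemma invariant_prob_iff:
  "invariant_prob P \<pi> \<longleftrightarrow> \<pi> \<in> prob_measures \<and> (\<forall>t\<ge>0. \<pi> \<bind> P t = \<pi>)"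
proof -
  have "\<pi> \<bind> P t = \<pi> \<longleftrightarrow> (\<forall>A\<in>sets borel. (\<integral>\<^sup>+x. emeasure (P t x) A \<partial>\<pi>) = emeasure \<pi> A)"
    if "\<pi> \<in> prob_measures" "0 \<le> t" for t
  proof -
    have "sets (\<pi> \<bind> P t) = sets borel" "sets \<pi> = sets borel"
      using that bind_in_prob_algebra[OF that(1) P_kernel[OF that(2)]] by (auto simp: in_prob_measures_iff)
    then show ?thesis
      using emeasure_bind_P[OF that] by (auto intro!: measure_eqI)
  qed
  then show ?thesis
    by (auto simp: invariant_prob_def in_prob_measures_iff)
qed

lemma invariant_prob_iff_skeleton:
  assumes "0 \<le> h" and unique: "\<exists>!\<pi>. \<pi> \<in> prob_measures \<and> \<pi> \<bind> P h = \<pi>"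
  shows "invariant_prob P \<pi> \<longleftrightarrow> \<pi> \<in> prob_measures \<and> \<pi> \<bind> P h = \<pi>"
proof -
  have "\<pi> \<bind> P t = \<pi>" if \<pi>: "\<pi> \<in> prob_measures" "\<pi> \<bind> P h = \<pi>" and "0 \<le> t" for t
  proof -
    have "(\<pi> \<bind> P t) \<bind> P h = (\<pi> \<bind> P h) \<bind> P t"
      using bind_P_P[OF \<pi>(1)] assms(1) \<open>0 \<le> t\<close> by (simp add: add.commute)
    then have "(\<pi> \<bind> P t) \<bind> P h = \<pi> \<bind> P t" by (simp add: \<pi>(2))
    then show ?thesis
      using unique \<pi> bind_in_prob_algebra[OF \<pi>(1) P_kernel[OF \<open>0 \<le> t\<close>]] by blast
  qed
  then show ?thesis using assms(1) by (auto simp: invariant_prob_iff)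
qed

end

section \<open>Contraction from the coupling assumptions\<close>

definition scaled_cost :: "real \<Rightarrow> ('a \<Rightarrow> 'a \<Rightarrow> real) \<Rightarrow> 'a \<Rightarrow> 'a \<Rightarrow> real" where
  "scaled_cost N \<theta> x y = min 1 (N * \<theta> x y)"

lemma premetric_measurable:
  fixes \<theta> :: "'a::second_countable_topology \<Rightarrow> 'a \<Rightarrow> real"
  assumes "premetric \<theta>"
  shows "(\<lambda>z. \<theta> (fst z) (snd z)) \<in> borel_measurable (borel \<Otimes>\<^sub>M borel)"
  unfolding borel_prod
  by (rule borel_measurableI_greater) (use assms in \<open>auto simp: premetric_def\<close>)

lemma scaled_cost_measurable:
  fixes \<theta> :: "'a::second_countable_topology \<Rightarrow> 'a \<Rightarrow> real"
  assumes "premetric \<theta>"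
  shows "(\<lambda>z. scaled_cost N \<theta> (fst z) (snd z)) \<in> borel_measurable (borel \<Otimes>\<^sub>M borel)"
  unfolding scaled_cost_def using premetric_measurable[OF assms] by measurable

lemma has_markov_law_distr:
  assumes law: "has_markov_law P x M X" and "0 \<le> t" and sets: "sets (P t x) = sets borel"
  shows "distr M borel (X t) = P t x"
proof (rule measure_eqI)
  have X: "X t \<in> M \<rightarrow>\<^sub>M borel" using law \<open>0 \<le> t\<close> by (auto simp: has_markov_law_def)
  fix A assume "A \<in> sets (distr M borel (X t))"
  then have A_borel: "A \<in> sets borel" by simp
  have finite_dim_laws: "\<forall>l. (\<forall>i<length l. 0 \<le> fst (l ! i) \<and> snd (l ! i) \<in> sets borel) \<longrightarrow>
      emeasure M {\<omega>\<in>space M. \<forall>i<length l. X (\<Sum>j\<le>i. fst (l ! j)) \<omega> \<in> snd (l ! i)} = mkv_fdd P x l"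
    using law by (simp add: has_markov_law_def)
  have "emeasure M {\<omega>\<in>space M. X t \<omega> \<in> A} = (\<integral>\<^sup>+y. indicator A y \<partial>P t x)"
    using finite_dim_laws[rule_format, of "[(t, A)]"] A_borel \<open>0 \<le> t\<close> by simp
  moreover have "X t -` A \<inter> space M = {\<omega>\<in>space M. X t \<omega> \<in> A}" by auto
  ultimately show "emeasure (distr M borel (X t)) A = emeasure (P t x) A"
    using A_borel sets by (simp add: emeasure_distr[OF X A_borel])
qed (simp add: sets)

context markov_semigroup
begin

lemma assumption_A_at_time:
  assumes assumption_A: "assumption_A TYPE('w) P \<theta> r L" and "0 \<le> t"
  obtains M :: "'w measure" and X Y where "prob_space M" "X \<in> M \<rightarrow>\<^sub>M borel" "Y \<in> M \<rightarrow>\<^sub>M borel"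
    "distr M borel X = P t x" "dTV (distr M borel Y) (P t y) \<le> L t * \<theta> x y"
    "(\<integral>\<^sup>+\<omega>. ennreal (\<theta> (X \<omega>) (Y \<omega>)) \<partial>M) \<le> ennreal (r t * \<theta> x y)"
proof -
  have "\<exists>(M::'w measure) X Y. has_markov_law P x M X \<and> (\<forall>t\<ge>0. Y t \<in> M \<rightarrow>\<^sub>M borel) \<and>
      (\<forall>t\<ge>0. dTV (distr M borel (Y t)) (P t y) \<le> L t * \<theta> x y) \<and>
      (\<forall>t\<ge>0. (\<integral>\<^sup>+\<omega>. ennreal (\<theta> (X t \<omega>) (Y t \<omega>)) \<partial>M) \<le> ennreal (r t * \<theta> x y))"
    using assumption_A by (simp add: assumption_A_def)
  then obtain M :: "'w measure" and X Y where law: "has_markov_law P x M X" and "Y t \<in> M \<rightarrow>\<^sub>M borel"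
    "dTV (distr M borel (Y t)) (P t y) \<le> L t * \<theta> x y"
    "(\<integral>\<^sup>+\<omega>. ennreal (\<theta> (X t \<omega>) (Y t \<omega>)) \<partial>M) \<le> ennreal (r t * \<theta> x y)"
    using \<open>0 \<le> t\<close> by blast
  moreover have "prob_space M" "X t \<in> M \<rightarrow>\<^sub>M borel"
    using law \<open>0 \<le> t\<close> by (auto simp: has_markov_law_def)
  moreover have "distr M borel (X t) = P t x"
    by (rule has_markov_law_distr[OF law \<open>0 \<le> t\<close> prob_measuresD(2)[OF P_in_prob_measures[OF \<open>0 \<le> t\<close>]]])
  ultimately show ?thesis using that by blast
qed

lemma wasserstein_le_if_assumption_A:
  assumes assumption_A: "assumption_A TYPE('w) P \<theta> r L" and \<theta>: "premetric \<theta>" and "0 \<le> t" "0 \<le> N"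
  shows "wasserstein (scaled_cost N \<theta>) (P t x) (P t y) \<le> ennreal ((N * r t + L t) * \<theta> x y)"
proof -
  have nonneg: "0 \<le> r t" "0 \<le> L t" "0 \<le> \<theta> x y" for x y
    using assumption_A \<theta> \<open>0 \<le> t\<close> by (auto simp: assumption_A_def premetric_def)
  obtain M :: "'w measure" and X Y where M: "prob_space M"
    and X [measurable]: "X \<in> M \<rightarrow>\<^sub>M borel" and Y [measurable]: "Y \<in> M \<rightarrow>\<^sub>M borel"
    and distr_X: "distr M borel X = P t x" and dTV: "dTV (distr M borel Y) (P t y) \<le> L t * \<theta> x y"
    and XY: "(\<integral>\<^sup>+\<omega>. ennreal (\<theta> (X \<omega>) (Y \<omega>)) \<partial>M) \<le> ennreal (r t * \<theta> x y)"
    using assumption_A_at_time[OF assumption_A \<open>0 \<le> t\<close>] .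
  have [measurable]: "(\<lambda>\<omega>. \<theta> (X \<omega>) (Y \<omega>)) \<in> borel_measurable M"
    using measurable_compose[OF measurable_Pair[OF X Y] premetric_measurable[OF \<theta>]] by simp
  obtain c where coupling: "c \<in> couplings (P t x) (P t y)"
    and coupling_cost_le: "\<forall>g\<in>borel_measurable (borel \<Otimes>\<^sub>M borel). (\<forall>z. g z \<le> 1) \<longrightarrow>
      (\<integral>\<^sup>+z. g z \<partial>c) \<le> (\<integral>\<^sup>+\<omega>. g (X \<omega>, Y \<omega>) \<partial>M) + ennreal (dTV (distr M borel Y) (P t y))"
    using total_variation_coupling[OF M X Y P_in_prob_measures[OF \<open>0 \<le> t\<close>, of y]] unfolding distr_X by blast
  have "wasserstein (scaled_cost N \<theta>) (P t x) (P t y) \<le> (\<integral>\<^sup>+z. ennreal (scaled_cost N \<theta> (fst z) (snd z)) \<partial>c)"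
    unfolding wasserstein_def by (rule INF_lower[OF coupling])
  also have "\<dots> \<le> (\<integral>\<^sup>+\<omega>. ennreal (scaled_cost N \<theta> (X \<omega>) (Y \<omega>)) \<partial>M) + ennreal (dTV (distr M borel Y) (P t y))"
    using coupling_cost_le[rule_format, of "\<lambda>z. ennreal (scaled_cost N \<theta> (fst z) (snd z))"] scaled_cost_measurable[OF \<theta>, of N]
    by (simp add: scaled_cost_def)
  also have "(\<integral>\<^sup>+\<omega>. ennreal (scaled_cost N \<theta> (X \<omega>) (Y \<omega>)) \<partial>M) \<le> (\<integral>\<^sup>+\<omega>. ennreal N * ennreal (\<theta> (X \<omega>) (Y \<omega>)) \<partial>M)"
    using \<open>0 \<le> N\<close> nonneg by (intro nn_integral_mono) (simp add: scaled_cost_def ennreal_leI flip: ennreal_mult)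
  also have "\<dots> = ennreal N * (\<integral>\<^sup>+\<omega>. ennreal (\<theta> (X \<omega>) (Y \<omega>)) \<partial>M)" by (rule nn_integral_cmult) measurable
  also have "\<dots> + ennreal (dTV (distr M borel Y) (P t y)) \<le> ennreal N * ennreal (r t * \<theta> x y) + ennreal (L t * \<theta> x y)"
    by (intro add_mono mult_left_mono XY ennreal_leI dTV) simp
  also have "\<dots> = ennreal ((N * r t + L t) * \<theta> x y)"
    using nonneg \<open>0 \<le> N\<close> by (simp add: algebra_simps flip: ennreal_mult ennreal_plus)
  finally show ?thesis by (simp add: add_right_mono)
qed

lemma contracting_time:
  assumes assumption_A: "assumption_A TYPE('w) P \<theta> r L" and \<theta>: "premetric \<theta>" and "0 \<le> t0"
  shows "\<exists>h\<ge>t0. \<exists>N\<ge>1. \<forall>x y. scaled_cost N \<theta> x y < 1 \<longrightarrow>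
    wasserstein (scaled_cost N \<theta>) (P h x) (P h y) \<le> ennreal (1 / 2 * scaled_cost N \<theta> x y)"
proof -
  have "(r \<longlongrightarrow> 0) at_top" using assumption_A by (simp add: assumption_A_def)
  then have "\<forall>\<^sub>F h in at_top. r h < 1 / 4 \<and> t0 \<le> h"
    by (intro eventually_conj eventually_ge_at_top order_tendstoD(2)[where y=0]) auto
  then obtain h where h: "r h < 1 / 4" "t0 \<le> h" by (auto dest: eventually_happens)
  then have "0 \<le> h" using \<open>0 \<le> t0\<close> by simp
  then have L: "0 \<le> L h" using assumption_A by (simp add: assumption_A_def)
  define N where "N = 1 + 4 * L h"
  have N: "1 \<le> N" using L by (simp add: N_def)
  have "N * r h \<le> N * (1 / 4)" using h(1) N by (intro mult_left_mono) auto
  then have half: "N * r h + L h \<le> N / 2" by (simp add: N_def)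
  have "wasserstein (scaled_cost N \<theta>) (P h x) (P h y) \<le> ennreal (1 / 2 * scaled_cost N \<theta> x y)"
    if "scaled_cost N \<theta> x y < 1" for x y
  proof -
    have "0 \<le> \<theta> x y" using \<theta> by (simp add: premetric_def)
    have "wasserstein (scaled_cost N \<theta>) (P h x) (P h y) \<le> ennreal ((N * r h + L h) * \<theta> x y)"
      using N by (intro wasserstein_le_if_assumption_A[OF assumption_A \<theta> \<open>0 \<le> h\<close>]) simp
    also have "\<dots> \<le> ennreal (N / 2 * \<theta> x y)"
      by (intro ennreal_leI mult_right_mono half) fact
    also have "N / 2 * \<theta> x y = 1 / 2 * scaled_cost N \<theta> x y"
      using that by (auto simp: scaled_cost_def min_def split: if_splits)
    finally show ?thesis .
  qed
  then show ?thesis using h(2) N by blast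
qed

lemma wasserstein_le_if_assumption_B1:
  assumes assumption_B1: "assumption_B1 P \<theta> B t" and "0 \<le> t" "0 < N"
  shows "\<exists>\<kappa><1. \<forall>x\<in>B. \<forall>y\<in>B. wasserstein (scaled_cost N \<theta>) (P t x) (P t y) \<le> ennreal \<kappa>"
proof -
  have "0 < 1 / (2 * N)" using \<open>0 < N\<close> by simp
  then obtain D m where D: "D \<in> sets borel" and m: "0 < m" "\<And>x. x \<in> B \<Longrightarrow> m \<le> measure (P t x) D"
    and small: "\<And>x y. x \<in> D \<Longrightarrow> y \<in> D \<Longrightarrow> \<theta> x y \<le> 1 / (2 * N)"
    using assumption_B1 unfolding assumption_B1_def by meson
  have "wasserstein (scaled_cost N \<theta>) (P t x) (P t y) \<le> ennreal (1 - m * m / 2)" if "x \<in> B" "y \<in> B" for x y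
  proof -
    have "scaled_cost N \<theta> x y \<le> 1 / 2" if "x \<in> D" "y \<in> D" for x y
      using small[OF that] \<open>0 < N\<close> by (simp add: scaled_cost_def field_simps)
    then have "wasserstein (scaled_cost N \<theta>) (P t x) (P t y)
        \<le> ennreal (1 - 1 / 2 * (measure (P t x) D * measure (P t y) D))"
      by (intro wasserstein_le_if_small_on P_in_prob_measures \<open>0 \<le> t\<close> D) (simp_all add: scaled_cost_def)
    also have "\<dots> \<le> ennreal (1 - m * m / 2)"
      using mult_mono[OF m(2)[OF that(1)] m(2)[OF that(2)]] m(1) by (intro ennreal_leI) simp
    finally show ?thesis .
  qed
  moreover have "1 - m * m / 2 < 1" using m(1) by simp
  ultimately show ?thesis by blast
qed

end

section \<open>Semigroups with a Lyapunov function\<close>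

locale lyapunov_semigroup = markov_semigroup P + concave_rate \<phi>
  for P :: "real \<Rightarrow> 'a::polish_space \<Rightarrow> 'a measure" and \<phi> :: "real \<Rightarrow> real" +
  fixes V :: "'a \<Rightarrow> real" and K :: real
  assumes V_measurable [measurable]: "V \<in> borel_measurable borel" and V_nonneg: "\<And>x. 0 \<le> V x"
    and K_nonneg: "0 \<le> K"
    and lyapunov: "\<And>t x. 0 \<le> t \<Longrightarrow>
        (\<integral>\<^sup>+y. ennreal (V y) \<partial>P t x) + (\<integral>\<^sup>+s\<in>{0..t}. (\<integral>\<^sup>+y. ennreal (\<phi> (V y)) \<partial>P s x) \<partial>lborel)
      \<le> ennreal (V x + K * t)"
begin

lemma phi_V_nonneg: "0 \<le> \<phi> (V x)"
  by (intro nonneg V_nonneg)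

lemma V_growth:
  assumes "0 \<le> t"
  shows "integrable (P t x) V" "(\<integral>y. V y \<partial>P t x) \<le> V x + K * t"
proof -
  note [measurable_cong] = prob_measuresD(2)[OF P_in_prob_measures[OF assms]]
  have V_le: "(\<integral>\<^sup>+y. ennreal (V y) \<partial>P t x) \<le> ennreal (V x + K * t)"
    by (rule order_trans[OF _ lyapunov[OF assms]]) simp
  then show "integrable (P t x) V"
    using V_nonneg by (intro integrableI_nonneg) (auto intro: le_less_trans)
  show "(\<integral>y. V y \<partial>P t x) \<le> V x + K * t"
    using V_le assms K_nonneg V_nonneg[of x] by (intro integral_real_bounded) simp_all
qed

lemma phi_V_growth:
  assumes "0 \<le> t"
  shows "integrable (P t x) (\<lambda>y. \<phi> (V y))" "(\<integral>y. \<phi> (V y) \<partial>P t x) \<le> \<phi> (V x) + slope * K * t"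
proof -
  have prob_P: "prob_space (P t x)" using P_in_prob_measures[OF assms] by (simp add: in_prob_measures_iff)
  note Jensen = Jensen[OF prob_P V_growth(1)[OF assms] V_nonneg]
  show "integrable (P t x) (\<lambda>y. \<phi> (V y))" by (rule Jensen(1))
  have Kt_nonneg: "0 \<le> K * t" using assms K_nonneg by simp
  have "0 \<le> (\<integral>y. V y \<partial>P t x)" by (intro integral_nonneg_AE) (simp add: V_nonneg)
  then have "\<phi> (\<integral>y. V y \<partial>P t x) \<le> \<phi> (V x + K * t)" by (intro mono V_growth(2)[OF assms])
  also have "\<dots> \<le> \<phi> (V x) + \<phi> (K * t)" by (rule subadditive[OF V_nonneg Kt_nonneg])
  also have "\<dots> \<le> \<phi> (V x) + slope * K * t" using le_slope[OF Kt_nonneg] by simp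
  finally show "(\<integral>y. \<phi> (V y) \<partial>P t x) \<le> \<phi> (V x) + slope * K * t" using Jensen(2) by linarith
qed

lemma phi_V_quasi_mono:
  assumes "0 \<le> s" "s \<le> t"
  shows "ennreal (\<integral>y. \<phi> (V y) \<partial>P t x) \<le> (\<integral>\<^sup>+y. ennreal (\<phi> (V y)) \<partial>P s x) + ennreal (slope * K * t)"
proof -
  have "0 \<le> t" "0 \<le> t - s" using assms by simp_all
  interpret prob_space "P s x" by (rule prob_measuresD(1)[OF P_in_prob_measures[OF assms(1)]])
  note [measurable_cong] = prob_measuresD(2)[OF P_in_prob_measures[OF assms(1)]]
  have phi_V_nn: "(\<integral>\<^sup>+y. ennreal (\<phi> (V y)) \<partial>P u z) = ennreal (\<integral>y. \<phi> (V y) \<partial>P u z)" if "0 \<le> u" for u z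
    using phi_V_growth(1)[OF that] phi_V_nonneg by (intro nn_integral_eq_integral) auto
  have "ennreal (\<integral>y. \<phi> (V y) \<partial>P t x) = (\<integral>\<^sup>+z. \<integral>\<^sup>+y. ennreal (\<phi> (V y)) \<partial>P (t - s) z \<partial>P s x)"
  proof -
    have "(\<integral>\<^sup>+y. ennreal (\<phi> (V y)) \<partial>(P s x \<bind> P (t - s))) = (\<integral>\<^sup>+z. \<integral>\<^sup>+y. ennreal (\<phi> (V y)) \<partial>P (t - s) z \<partial>P s x)"
      using V_nonneg by (intro nn_integral_bind_kernel[OF P_in_prob_measures[OF assms(1)] P_kernel[OF \<open>0 \<le> t - s\<close>]]) simp
    then show ?thesis
      using P_add[OF assms(1) \<open>0 \<le> t - s\<close>, of x] phi_V_nn[OF \<open>0 \<le> t\<close>, of x] by simp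
  qed
  also have "\<dots> \<le> (\<integral>\<^sup>+z. ennreal (\<phi> (V z)) + ennreal (slope * K * t) \<partial>P s x)"
  proof (rule nn_integral_mono)
    fix z
    have "slope * K * (t - s) \<le> slope * K * t"
      using assms(1) slope_pos K_nonneg by (intro mult_left_mono) auto
    then have "(\<integral>y. \<phi> (V y) \<partial>P (t - s) z) \<le> \<phi> (V z) + slope * K * t"
      using phi_V_growth(2)[OF \<open>0 \<le> t - s\<close>, of z] by linarith
    then show "(\<integral>\<^sup>+y. ennreal (\<phi> (V y)) \<partial>P (t - s) z) \<le> ennreal (\<phi> (V z)) + ennreal (slope * K * t)"
      using phi_V_nonneg slope_pos K_nonneg \<open>0 \<le> t\<close> by (simp add: phi_V_nn[OF \<open>0 \<le> t - s\<close>] ennreal_leI flip: ennreal_plus)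
  qed
  also have "\<dots> = (\<integral>\<^sup>+y. ennreal (\<phi> (V y)) \<partial>P s x) + ennreal (slope * K * t)"
    using V_nonneg by (subst nn_integral_add) (auto simp: emeasure_space_1)
  finally show ?thesis .
qed

(* The integrand in time need not be measurable a priori; quasi-monotonicity bounds it below by a constant. *)
lemma skeleton_drift:
  assumes "0 \<le> h"
  shows "(\<integral>y. V y \<partial>P h x) + h * (\<integral>y. \<phi> (V y) \<partial>P h x) \<le> V x + K * h + slope * K * h\<^sup>2"
proof -
  let ?V = "\<integral>y. V y \<partial>P h x" and ?m = "(\<integral>y. \<phi> (V y) \<partial>P h x) - slope * K * h"
  have V: "0 \<le> ?V" by (intro integral_nonneg_AE) (simp add: V_nonneg)
  have quasi_mono_error: "0 \<le> slope * K * h" using slope_pos K_nonneg assms by simp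
  have "ennreal ?m \<le> (\<integral>\<^sup>+y. ennreal (\<phi> (V y)) \<partial>P s x)" if "0 \<le> s" "s \<le> h" for s
    using phi_V_quasi_mono[OF that, of x] quasi_mono_error by (simp add: ennreal_minus_le_iff add.commute flip: ennreal_minus)
  then have "(\<integral>\<^sup>+s\<in>{0..h}. ennreal ?m \<partial>lborel) \<le> (\<integral>\<^sup>+s\<in>{0..h}. (\<integral>\<^sup>+y. ennreal (\<phi> (V y)) \<partial>P s x) \<partial>lborel)"
    by (intro nn_integral_mono) (simp split: split_indicator)
  moreover have "(\<integral>\<^sup>+s\<in>{0..h}. ennreal ?m \<partial>lborel) = ennreal (h * ?m)"
    using assms by (subst nn_integral_cmult_indicator) (simp_all add: ennreal_mult' mult.commute)
  moreover have "(\<integral>\<^sup>+y. ennreal (V y) \<partial>P h x) = ennreal ?V"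
    using V_growth(1)[OF assms] V_nonneg by (intro nn_integral_eq_integral) auto
  ultimately have "ennreal ?V + ennreal (h * ?m)
      \<le> (\<integral>\<^sup>+y. ennreal (V y) \<partial>P h x) + (\<integral>\<^sup>+s\<in>{0..h}. (\<integral>\<^sup>+y. ennreal (\<phi> (V y)) \<partial>P s x) \<partial>lborel)"
    by (intro add_mono) simp_all
  also have "\<dots> \<le> ennreal (V x + K * h)" by (rule lyapunov[OF assms])
  finally have sum_le: "ennreal ?V + ennreal (h * ?m) \<le> ennreal (V x + K * h)" .
  have "?V + h * ?m \<le> V x + K * h"
  proof (cases "0 \<le> h * ?m")
    case True
    have "0 \<le> V x + K * h" using assms K_nonneg V_nonneg[of x] by simp
    then show ?thesis using sum_le unfolding ennreal_plus[OF V True, symmetric] by (simp only: ennreal_le_iff)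
  next
    case False
    then show ?thesis using V_growth(2)[OF assms, of x] by linarith
  qed
  then show ?thesis by (simp add: algebra_simps power2_eq_square)
qed

lemma measure_P_add_ge:
  assumes s: "0 \<le> s" and t: "0 \<le> t" and D: "D \<in> sets borel" and bounds: "0 \<le> c" "0 < M"
    and ge_on_sublevel: "\<And>y. V y \<le> M \<Longrightarrow> c \<le> measure (P t y) D"
  shows "c * (1 - (V x + K * s) / M) \<le> measure (P (s + t) x) D"
proof -
  interpret prob_space "P s x" by (rule prob_measuresD(1)[OF P_in_prob_measures[OF s]])
  have P_t: "P t \<in> P s x \<rightarrow>\<^sub>M subprob_algebra borel"
    by (rule kernel_measurable_subprob[OF P_in_prob_measures[OF s] P_kernel[OF t]])
  have "(\<integral>y. V y \<partial>P s x) / M \<le> (V x + K * s) / M" using V_growth(2)[OF s] bounds(2) by (intro divide_right_mono) auto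
  then have "c * (1 - (V x + K * s) / M) \<le> c * (1 - (\<integral>y. V y \<partial>P s x) / M)" using bounds(1) by (intro mult_left_mono) auto
  also have "\<dots> = (\<integral>y. c * (1 - V y / M) \<partial>P s x)" using V_growth(1)[OF s] by (simp add: prob_space)
  also have "\<dots> \<le> (\<integral>y. measure (P t y) D \<partial>P s x)"
  proof (rule integral_mono)
    show "integrable (P s x) (\<lambda>y. measure (P t y) D)"
      using prob_measuresD(1)[OF P_in_prob_measures[OF t]] measure_measurable_subprob_algebra2[OF _ P_t] D
      by (intro integrable_const_bound[where B=1]) (auto intro!: prob_space.prob_le_1)
    fix y
    show "c * (1 - V y / M) \<le> measure (P t y) D"
    proof (cases "V y \<le> M")
      case True
      have "c * (1 - V y / M) \<le> c * 1" using bounds V_nonneg[of y] by (intro mult_left_mono) auto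
      then show ?thesis using ge_on_sublevel[OF True] by simp
    next
      case False
      then have "c * (1 - V y / M) \<le> 0" using bounds by (intro mult_nonneg_nonpos) (auto simp: le_divide_eq)
      then show ?thesis using measure_nonneg[of "P t y" D] by linarith
    qed
  qed (use V_growth(1)[OF s] in simp)
  also have "\<dots> = measure (P (s + t) x) D"
    unfolding P_add[OF s t] by (rule measure_bind[OF P_t D, symmetric])
  finally show ?thesis .
qed

lemma assumption_B1_later:
  assumes assumption_B1: "\<And>M. 0 < M \<Longrightarrow> assumption_B1 P \<theta> {x. V x \<le> M} t0" and t: "0 \<le> t0" "t0 \<le> t"
  shows "assumption_B1 P \<theta> {x. V x \<le> M} t"
  unfolding assumption_B1_def
proof (intro allI impI)
  fix \<epsilon> :: real assume "0 < \<epsilon>"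
  define s where "s = t - t0"
  have s: "0 \<le> s" "t = s + t0" using t by (simp_all add: s_def)
  define M' where "M' = 2 * (1 + \<bar>M\<bar> + K * s)"
  have M': "0 < M'" using K_nonneg s(1) by (simp add: M'_def add_pos_nonneg)
  obtain D c where D: "D \<in> sets borel" and minorised: "0 < c" "\<And>x. V x \<le> M' \<Longrightarrow> c \<le> measure (P t0 x) D"
    and small: "\<forall>x\<in>D. \<forall>y\<in>D. \<theta> x y \<le> \<epsilon>"
    using assumption_B1[OF M', unfolded assumption_B1_def, rule_format, OF \<open>0 < \<epsilon>\<close>] by auto
  have "c / 2 \<le> measure (P t x) D" if "V x \<le> M" for x
  proof -
    have "(V x + K * s) / M' \<le> 1 / 2" using that M' by (simp add: divide_le_eq M'_def)
    then have "c * (1 / 2) \<le> c * (1 - (V x + K * s) / M')" using minorised(1) by (intro mult_left_mono) auto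
    also have "\<dots> \<le> measure (P t x) D" unfolding s(2) using minorised M' by (intro measure_P_add_ge s t D) auto
    finally show ?thesis by simp
  qed
  then show "\<exists>D\<in>sets borel. (\<exists>c>0. \<forall>x\<in>{x. V x \<le> M}. c \<le> measure (P t x) D) \<and> (\<forall>x\<in>D. \<forall>y\<in>D. \<theta> x y \<le> \<epsilon>)"
    using D minorised(1) small by (intro bexI[of _ D] conjI exI[of _ "c / 2"]) auto
qed

definition skeleton_potential :: "real \<Rightarrow> 'a \<Rightarrow> real" where
  "skeleton_potential h x = V x + h * \<phi> (V x)"

lemma V_le_skeleton_potential: "0 \<le> h \<Longrightarrow> V x \<le> skeleton_potential h x"
  using phi_V_nonneg by (simp add: skeleton_potential_def)

lemma skeleton_potential_nonneg: "0 \<le> h \<Longrightarrow> 0 \<le> skeleton_potential h x"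
  using V_nonneg phi_V_nonneg by (simp add: skeleton_potential_def)

lemma phi_V_measurable [measurable]: "(\<lambda>x. \<phi> (V x)) \<in> borel_measurable borel"
  by (rule comp_measurable[OF V_measurable V_nonneg])

lemma skeleton_potential_measurable [measurable]: "skeleton_potential h \<in> borel_measurable borel"
  unfolding skeleton_potential_def[abs_def] by measurable

lemma phi_skeleton_potential_measurable:
  "0 \<le> h \<Longrightarrow> (\<lambda>x. \<phi> (skeleton_potential h x)) \<in> borel_measurable borel"
  by (intro comp_measurable skeleton_potential_measurable skeleton_potential_nonneg)

lemma phi_skeleton_potential_le:
  assumes "0 \<le> h"
  shows "\<phi> (skeleton_potential h x) \<le> (1 + slope * h) * \<phi> (V x)"
proof -
  have h_phi_V: "0 \<le> h * \<phi> (V x)" using assms phi_V_nonneg by simp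
  have "\<phi> (skeleton_potential h x) \<le> \<phi> (V x) + \<phi> (h * \<phi> (V x))"
    unfolding skeleton_potential_def by (rule subadditive[OF V_nonneg h_phi_V])
  also have "\<dots> \<le> \<phi> (V x) + slope * (h * \<phi> (V x))" using le_slope[OF h_phi_V] by simp
  finally show ?thesis by (simp add: algebra_simps)
qed

lemma drift_kernel_skeleton:
  assumes "0 < h"
  shows "drift_kernel (P h) (skeleton_potential h) (\<lambda>x. \<phi> (skeleton_potential h x))
    (h / (1 + slope * h)) (K * h + slope * K * h\<^sup>2)"
proof -
  have h: "0 \<le> h" using assms by simp
  have slope_h: "0 < 1 + slope * h" using slope_pos h by (simp add: add_pos_nonneg)
  interpret markov_kernel "P h" by (rule markov_kernel_P[OF h])
  show ?thesis
  proof unfold_locales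
    fix x
    show "0 \<le> \<phi> (skeleton_potential h x)" by (rule nonneg[OF skeleton_potential_nonneg[OF h]])
    show "integrable (P h x) (skeleton_potential h)"
      unfolding skeleton_potential_def[abs_def] using V_growth(1)[OF h] phi_V_growth(1)[OF h] by simp
    have "h / (1 + slope * h) * \<phi> (skeleton_potential h x) \<le> h / (1 + slope * h) * ((1 + slope * h) * \<phi> (V x))"
      using h slope_h by (intro mult_left_mono phi_skeleton_potential_le) auto
    also have "\<dots> = h * \<phi> (V x)" using slope_h by simp
    finally have "h / (1 + slope * h) * \<phi> (skeleton_potential h x) \<le> h * \<phi> (V x)" .
    moreover have "(\<integral>y. skeleton_potential h y \<partial>P h x) = (\<integral>y. V y \<partial>P h x) + h * (\<integral>y. \<phi> (V y) \<partial>P h x)"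
      unfolding skeleton_potential_def using V_growth(1)[OF h] phi_V_growth(1)[OF h] by simp
    ultimately show "(\<integral>y. skeleton_potential h y \<partial>P h x) + h / (1 + slope * h) * \<phi> (skeleton_potential h x)
        \<le> skeleton_potential h x + (K * h + slope * K * h\<^sup>2)"
      using skeleton_drift[OF h, of x] by (simp add: skeleton_potential_def)
  qed (use assms slope_h slope_pos K_nonneg skeleton_potential_nonneg[OF h]
      phi_skeleton_potential_measurable[OF h] in simp_all)
qed

theorem harris_drift_skeleton:
  assumes \<theta>: "premetric \<theta>" "\<And>x y. bdist x y \<le> \<theta> x y" and assumption_A: "assumption_A TYPE('w) P \<theta> r L"
    and "0 < t0" and assumption_B1: "\<And>M. 0 < M \<Longrightarrow> assumption_B1 P \<theta> {x. V x \<le> M} t0"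
  shows "\<exists>h>0. \<exists>N \<eta> K'. harris_drift_kernel (P h) \<phi> (skeleton_potential h) \<eta> K' (scaled_cost N \<theta>) (1 / 2)"
proof -
  have "0 \<le> t0" using \<open>0 < t0\<close> by simp
  obtain h N where h: "t0 \<le> h" and N: "1 \<le> N" and contracting: "\<And>x y. scaled_cost N \<theta> x y < 1 \<Longrightarrow>
      wasserstein (scaled_cost N \<theta>) (P h x) (P h y) \<le> ennreal (1 / 2 * scaled_cost N \<theta> x y)"
    using contracting_time[OF assumption_A \<theta>(1) \<open>0 \<le> t0\<close>] by blast
  have "0 < h" using h \<open>0 < t0\<close> by simp
  interpret drift_kernel "P h" "skeleton_potential h" "\<lambda>x. \<phi> (skeleton_potential h x)"
    "h / (1 + slope * h)" "K * h + slope * K * h\<^sup>2"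
    by (rule drift_kernel_skeleton[OF \<open>0 < h\<close>])
  have "harris_drift_kernel (P h) \<phi> (skeleton_potential h) (h / (1 + slope * h)) (K * h + slope * K * h\<^sup>2)
    (scaled_cost N \<theta>) (1 / 2)"
  proof unfold_locales
    fix x y
    have "1 * \<theta> x y \<le> N * \<theta> x y" using \<theta>(1) N by (intro mult_right_mono) (auto simp: premetric_def)
    then show "bdist x y \<le> scaled_cost N \<theta> x y"
      using \<theta>(2)[of x y] bdist_le_1[of x y] by (simp add: scaled_cost_def)
    show "wasserstein (scaled_cost N \<theta>) (P h x) (P h y) \<le> ennreal (1 / 2 * scaled_cost N \<theta> x y)"
      if "scaled_cost N \<theta> x y < 1" by (rule contracting[OF that])
    fix M
    obtain \<kappa> where "\<kappa> < 1" and \<kappa>: "\<forall>x\<in>{x. V x \<le> M}. \<forall>y\<in>{x. V x \<le> M}.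
        wasserstein (scaled_cost N \<theta>) (P h x) (P h y) \<le> ennreal \<kappa>"
      using wasserstein_le_if_assumption_B1[OF assumption_B1_later[OF assumption_B1 \<open>0 \<le> t0\<close> h], of N M] N \<open>0 < h\<close> by auto
    have "V x \<le> M" if "skeleton_potential h x \<le> M" for x
      using V_le_skeleton_potential[of h x] \<open>0 < h\<close> that by simp
    with \<kappa> \<open>\<kappa> < 1\<close> show "\<exists>\<kappa><1. \<forall>x y. skeleton_potential h x \<le> M \<longrightarrow> skeleton_potential h y \<le> M \<longrightarrow>
        wasserstein (scaled_cost N \<theta>) (P h x) (P h y) \<le> ennreal \<kappa>"
      by blast
  qed (use scaled_cost_measurable[OF \<theta>(1)] in \<open>simp_all add: scaled_cost_def\<close>)
  with \<open>0 < h\<close> show ?thesis by blast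
qed

end

lemma skeleton_time:
  assumes "0 < h" "h \<le> t"
  obtains n s where "0 \<le> s" "s \<le> h" "t = s + real n * h" "t \<le> 2 * (real n * h)"
proof
  define n where "n = nat \<lfloor>t / h\<rfloor>"
  have "1 \<le> t / h" using assms by simp
  then have n: "real n \<le> t / h" "t / h < real n + 1" "1 \<le> real n" by (auto simp: n_def)
  then show "0 \<le> t - real n * h" "t - real n * h \<le> h" "t = t - real n * h + real n * h"
    using assms(1) by (auto simp: field_simps)
  have "t / h \<le> 2 * real n" using n by linarith
  then show "t \<le> 2 * (real n * h)" using assms(1) by (simp add: field_simps)
qed

lemma one_plus_powr_le:
  fixes z :: real
  assumes "0 \<le> z" "0 < \<delta>" "\<delta> < 1"
  shows "(1 + z) powr \<delta> \<le> 2 * (1 + z powr \<delta>)"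
proof -
  have "(1 + z) powr \<delta> \<le> (2 * max 1 z) powr \<delta>" using assms by (intro powr_mono2) auto
  also have "\<dots> = 2 powr \<delta> * max 1 z powr \<delta>" by (rule powr_mult)
  also have "\<dots> \<le> 2 * (1 + z powr \<delta>)"
    using powr_mono[of \<delta> 1 2] assms by (intro mult_mono) (auto simp: max_def)
  finally show ?thesis .
qed

context lyapunov_semigroup
begin

lemma integral_phi_skeleton_potential_le:
  assumes "0 \<le> h" "0 \<le> s" "s \<le> h"
  shows "integrable (P s x) (\<lambda>y. \<phi> (skeleton_potential h y))"
    "1 + (\<integral>y. \<phi> (skeleton_potential h y) \<partial>P s x) \<le> (1 + slope * h) * (1 + slope * K * h) * (1 + \<phi> (V x))"
proof -
  show integrable: "integrable (P s x) (\<lambda>y. \<phi> (skeleton_potential h y))"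
  proof (rule Bochner_Integration.integrable_bound)
    show "integrable (P s x) (\<lambda>y. (1 + slope * h) * \<phi> (V y))" using phi_V_growth(1)[OF assms(2)] by simp
    show "(\<lambda>y. \<phi> (skeleton_potential h y)) \<in> borel_measurable (P s x)"
      using phi_skeleton_potential_measurable[OF assms(1)] P_in_prob_measures[OF assms(2)]
      by (simp add: in_prob_measures_iff cong: measurable_cong_sets)
    show "AE y in P s x. norm (\<phi> (skeleton_potential h y)) \<le> norm ((1 + slope * h) * \<phi> (V y))"
    proof (rule AE_I2)
      fix y
      show "norm (\<phi> (skeleton_potential h y)) \<le> norm ((1 + slope * h) * \<phi> (V y))"
        using phi_skeleton_potential_le[OF assms(1), of y] nonneg[OF skeleton_potential_nonneg[OF assms(1), of y]]
        unfolding real_norm_def by linarith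
    qed
  qed
  have h: "0 \<le> slope * h" "0 \<le> slope * K * h" using slope_pos assms(1) K_nonneg by simp_all
  have "(\<integral>y. \<phi> (skeleton_potential h y) \<partial>P s x) \<le> (\<integral>y. (1 + slope * h) * \<phi> (V y) \<partial>P s x)"
    using integrable phi_V_growth(1)[OF assms(2)] phi_skeleton_potential_le[OF assms(1)] by (intro integral_mono) auto
  also have "\<dots> = (1 + slope * h) * (\<integral>y. \<phi> (V y) \<partial>P s x)" by simp
  also have "\<dots> \<le> (1 + slope * h) * (\<phi> (V x) + slope * K * h)"
  proof (rule mult_left_mono)
    have "slope * K * s \<le> slope * K * h" using slope_pos K_nonneg assms(3) by (intro mult_left_mono) auto
    then show "(\<integral>y. \<phi> (V y) \<partial>P s x) \<le> \<phi> (V x) + slope * K * h" using phi_V_growth(2)[OF assms(2), of x] by linarith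
  qed (use h in simp)
  finally have "1 + (\<integral>y. \<phi> (skeleton_potential h y) \<partial>P s x) \<le> (1 + slope * h) * (1 + \<phi> (V x) + slope * K * h)"
    using h by (simp add: algebra_simps)
  also have "\<dots> \<le> (1 + slope * h) * ((1 + slope * K * h) * (1 + \<phi> (V x)))"
    using h mult_nonneg_nonneg[OF h(2) phi_V_nonneg[of x]] by (intro mult_left_mono) (simp_all add: algebra_simps)
  finally show "1 + (\<integral>y. \<phi> (skeleton_potential h y) \<partial>P s x) \<le> (1 + slope * h) * (1 + slope * K * h) * (1 + \<phi> (V x))"
    by (simp add: mult.assoc)
qed

lemma skeleton_moment_powr_le:
  assumes h: "0 \<le> h" "0 \<le> s" "s \<le> h" and "0 < \<rho>" and \<delta>: "0 < \<delta>" "\<delta> < 1"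
  shows "((1 + (\<integral>y. \<phi> (skeleton_potential h y) \<partial>P s x)) / \<rho>) powr \<delta>
    \<le> 2 * ((1 + slope * h) * (1 + slope * K * h)) powr \<delta> * (1 + \<phi> (V x) powr \<delta>) / \<rho> powr \<delta>"
proof -
  let ?A = "(1 + slope * h) * (1 + slope * K * h)"
  have A: "0 \<le> ?A" using slope_pos h(1) K_nonneg by simp
  have "0 \<le> (\<integral>y. \<phi> (skeleton_potential h y) \<partial>P s x)"
    by (intro integral_nonneg_AE) (simp add: nonneg[OF skeleton_potential_nonneg[OF h(1)]])
  then have "((1 + (\<integral>y. \<phi> (skeleton_potential h y) \<partial>P s x)) / \<rho>) powr \<delta> \<le> (?A * (1 + \<phi> (V x)) / \<rho>) powr \<delta>"
    using integral_phi_skeleton_potential_le(2)[OF h, of x] \<open>0 < \<rho>\<close> \<delta> by (intro powr_mono2 divide_right_mono) simp_all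
  also have "\<dots> = ?A powr \<delta> * (1 + \<phi> (V x)) powr \<delta> / \<rho> powr \<delta>"
    using A \<open>0 < \<rho>\<close> phi_V_nonneg[of x] by (simp add: powr_mult powr_divide)
  also have "\<dots> \<le> ?A powr \<delta> * (2 * (1 + \<phi> (V x) powr \<delta>)) / \<rho> powr \<delta>"
    by (intro divide_right_mono mult_left_mono one_plus_powr_le phi_V_nonneg \<delta>) auto
  also have "\<dots> = 2 * ?A powr \<delta> * (1 + \<phi> (V x) powr \<delta>) / \<rho> powr \<delta>" by simp
  finally show ?thesis .
qed

theorem subgeometric_rate:
  assumes "0 < h" and skeleton: "harris_drift_kernel (P h) \<phi> (skeleton_potential h) \<eta> K' d \<gamma>"
    and \<pi>: "\<pi> \<in> prob_measures" "\<pi> \<bind> P h = \<pi>" and \<delta>: "0 < \<delta>" "\<delta> < 1"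
  shows "\<exists>C1>0. \<exists>C2>0. \<forall>x. \<forall>t\<ge>0. kantorovich (P t x) \<pi> \<le> C1 * (1 + \<phi> (V x) powr \<delta>) / \<phi> (H_phi_inv \<phi> (C2 * t)) powr \<delta>"
proof -
  have h: "0 \<le> h" using \<open>0 < h\<close> by simp
  obtain C c where constants_pos: "0 < C" "0 < c" and convergence: "\<And>n R \<mu>. \<mu> \<in> prob_measures \<Longrightarrow>
      integrable \<mu> (\<lambda>x. \<phi> (skeleton_potential h x)) \<Longrightarrow> 1 \<le> R \<Longrightarrow> H R \<le> c * real n \<Longrightarrow>
      kantorovich (\<mu> \<bind> P (real n * h)) \<pi> \<le> C * ((1 + (\<integral>x. \<phi> (skeleton_potential h x) \<partial>\<mu>)) / \<phi> R) powr \<delta>"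
    using harris_drift_kernel.subgeometric_convergence[OF skeleton \<pi> \<delta>] unfolding iter_P[OF h] by blast
  define C2 where "C2 = c / (2 * h)"
  have C2: "0 < C2" using constants_pos \<open>0 < h\<close> by (simp add: C2_def)
  define R where "R t = H_phi_inv \<phi> (C2 * t)" for t
  have R: "1 \<le> R t" "H (R t) = C2 * t" "0 < \<phi> (R t)" if "0 \<le> t" for t
    using H_phi_inv[of "C2 * t"] phi_H_phi_inv_pos[of "C2 * t"] C2 that by (simp_all add: R_def)
  define C1 where "C1 = max (C * (2 * ((1 + slope * h) * (1 + slope * K * h)) powr \<delta>)) (\<phi> (R h) powr \<delta>)"
  have C1: "0 < C1" using R(3)[OF h] by (simp add: C1_def less_max_iff_disj)
  have "kantorovich (P t x) \<pi> \<le> C1 * (1 + \<phi> (V x) powr \<delta>) / \<phi> (R t) powr \<delta>" if t: "0 \<le> t" for x t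
  proof (cases "t < h")
    case True
    have "R t \<le> R h" unfolding R_def using t True C2 by (intro H_phi_inv_mono mult_left_mono) auto
    then have "\<phi> (R t) powr \<delta> \<le> \<phi> (R h) powr \<delta>"
      using R[OF t] \<delta> by (intro powr_mono2 mono) auto
    also have "\<dots> \<le> C1" by (simp add: C1_def)
    also have "\<dots> \<le> C1 * (1 + \<phi> (V x) powr \<delta>)" using C1 by simp
    finally have "1 \<le> C1 * (1 + \<phi> (V x) powr \<delta>) / \<phi> (R t) powr \<delta>" using R(3)[OF t] by simp
    then show ?thesis using kantorovich_le_1[OF P_in_prob_measures[OF t] \<pi>(1), of x] by linarith
  next
    case False
    then have "h \<le> t" by simp
    then obtain n s where s: "0 \<le> s" "s \<le> h" "t = s + real n * h" "t \<le> 2 * (real n * h)"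
      by (rule skeleton_time[OF \<open>0 < h\<close>])
    have "C2 * t \<le> C2 * (2 * (real n * h))" using s(4) C2 by (intro mult_left_mono) auto
    then have "H (R t) \<le> c * real n" using R(2)[OF t] \<open>0 < h\<close> by (simp add: C2_def)
    then have "kantorovich (P t x) \<pi> \<le> C * ((1 + (\<integral>y. \<phi> (skeleton_potential h y) \<partial>P s x)) / \<phi> (R t)) powr \<delta>"
      using convergence[OF P_in_prob_measures[OF s(1)] integral_phi_skeleton_potential_le(1)[OF h s(1,2)] R(1)[OF t]]
        P_add[OF s(1), of "real n * h" x] h s(3) by simp
    also have "\<dots> \<le> C * (2 * ((1 + slope * h) * (1 + slope * K * h)) powr \<delta> * (1 + \<phi> (V x) powr \<delta>) / \<phi> (R t) powr \<delta>)"
      using constants_pos by (intro mult_left_mono skeleton_moment_powr_le h s(1,2) R(3)[OF t] \<delta>) simp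
    also have "\<dots> = C * (2 * ((1 + slope * h) * (1 + slope * K * h)) powr \<delta>) * (1 + \<phi> (V x) powr \<delta>) / \<phi> (R t) powr \<delta>"
      by simp
    also have "\<dots> \<le> C1 * (1 + \<phi> (V x) powr \<delta>) / \<phi> (R t) powr \<delta>"
      by (intro divide_right_mono mult_right_mono) (auto simp: C1_def)
    finally show ?thesis .
  qed
  with C1 C2 show ?thesis unfolding R_def by blast
qed

end

theorem theorem2p7:
  fixes P :: "real \<Rightarrow> 'a::polish_space \<Rightarrow> 'a measure"
    and V :: "'a \<Rightarrow> real" and \<phi> :: "real \<Rightarrow> real" and K :: real
    and \<theta> :: "'a \<Rightarrow> 'a \<Rightarrow> real" and r L :: "real \<Rightarrow> real" and t0 :: real
  assumes markov: "markov_tf P"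
    and feller: "feller P"
    and V_meas: "V \<in> borel_measurable borel" and V_nonneg: "\<forall>x. V x \<ge> 0"
    and phi_concave: "concave_on {0..} \<phi>"
    and phi_diff: "\<forall>s\<ge>0. \<phi> differentiable (at s within {0..})"
    and phi_nonneg: "\<forall>s\<ge>0. \<phi> s \<ge> 0"
    and phi_mono: "mono_on {0..} \<phi>"
    and phi_infty: "filterlim \<phi> at_top at_top"
    and phi_0: "\<phi> 0 = 0"
    and K_pos: "K > 0"
    and lyapunov: "\<forall>t\<ge>0. \<forall>x.
        (\<integral>\<^sup>+ y. ennreal (V y) \<partial>P t x)
          + (\<integral>\<^sup>+ s\<in>{0..t}. (\<integral>\<^sup>+ y. ennreal (\<phi> (V y)) \<partial>P s x) \<partial>lborel)
        \<le> ennreal (V x + K * t)"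
    and theta_premetric: "premetric \<theta>"
    and theta_ge: "\<forall>x y. min (dist x y) 1 \<le> \<theta> x y"
    and assmA: "assumption_A TYPE('w) P \<theta> r L"
    and t0_pos: "t0 > 0"
    and assmB1: "\<forall>M>0. assumption_B1 P \<theta> {x. V x \<le> M} t0"
  shows "\<exists>\<pi>. invariant_prob P \<pi> \<and> (\<forall>\<pi>'. invariant_prob P \<pi>' \<longrightarrow> \<pi>' = \<pi>) \<and>
     (\<forall>\<delta>. 0 < \<delta> \<and> \<delta> < 1 \<longrightarrow> (\<exists>C1>0. \<exists>C2>0. \<forall>x. \<forall>t\<ge>0.
        wasserstein (\<lambda>x y. min (dist x y) 1) (P t x) \<pi>
          \<le> ennreal (C1 * (1 + \<phi> (V x) powr \<delta>) / \<phi> (H_phi_inv \<phi> (C2 * t)) powr \<delta>)))"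
proof -
  interpret concave_rate \<phi>
    by unfold_locales (use phi_concave phi_diff phi_nonneg phi_mono phi_infty phi_0 in auto)
  interpret lyapunov_semigroup P \<phi> V K
    by unfold_locales (use markov V_meas V_nonneg K_pos lyapunov in auto)
  obtain h N \<eta> K' where h: "0 < h"
    and skeleton: "harris_drift_kernel (P h) \<phi> (skeleton_potential h) \<eta> K' (scaled_cost N \<theta>) (1 / 2)"
    using harris_drift_skeleton[OF theta_premetric _ assmA t0_pos] theta_ge assmB1 unfolding bdist_def by blast
  have unique: "\<exists>!\<pi>. \<pi> \<in> prob_measures \<and> \<pi> \<bind> P h = \<pi>"
    using h feller by (intro harris_drift_kernel.ex1_invariant[OF skeleton]) (simp add: feller_def)
  then obtain \<pi> where \<pi>: "\<pi> \<in> prob_measures" "\<pi> \<bind> P h = \<pi>" by blast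
  have invariant_iff: "invariant_prob P \<pi>' \<longleftrightarrow> \<pi>' = \<pi>" for \<pi>'
    using invariant_prob_iff_skeleton[OF _ unique] unique \<pi> h by auto
  have "\<exists>C1>0. \<exists>C2>0. \<forall>x. \<forall>t\<ge>0. wasserstein (\<lambda>x y. min (dist x y) 1) (P t x) \<pi>
      \<le> ennreal (C1 * (1 + \<phi> (V x) powr \<delta>) / \<phi> (H_phi_inv \<phi> (C2 * t)) powr \<delta>)" if "0 < \<delta>" "\<delta> < 1" for \<delta>
  proof -
    have "wasserstein (\<lambda>x y. min (dist x y) 1) (P t x) \<pi> \<le> ennreal E" if "kantorovich (P t x) \<pi> \<le> E" "0 \<le> t" for x t E
      using wasserstein_le_kantorovich[OF P_in_prob_measures[OF that(2)] \<pi>(1), of x] ennreal_leI[OF that(1)]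
      unfolding bdist_def[abs_def] by (rule order_trans)
    then show ?thesis using subgeometric_rate[OF h skeleton \<pi> that] by meson
  qed
  then show ?thesis by (intro exI[of _ \<pi>]) (simp add: invariant_iff)
qed

end
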